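(* Let $0<t<1$, $m\in\mathbb N$, and let $R_n^{(m)}$ be the $m$-point correlation function for the potential $V(z)=|z|^2-\mathrm{Re}(tz^2)$. Let $a_1,\dots,a_m\in\mathbb C$. If $z_0$ lies inside of the ellipse $\partial E_t$, then $$\lim_{n\to\infty}\frac1{n^m}R_n^{(m)}\left(z_0+\tfrac{a_1}{\sqrt n},\dots,z_0+\tfrac{a_m}{\sqrt n}\right)=\det\left(\tfrac1\pi e^{-\frac12|a_k-a_l|^2+i\,\mathrm{Im}(\overline{a_k}a_l)}\right)_{k,l=1}^m.$$ If $z_0$ lies outside of $\partial E_t$, then $$\lim_{n\to\infty}\frac1{n^m}R_n^{(m)}\left(z_0+\tfrac{a_1}{\sqrt n},\dots,z_0+\tfrac{a_m}{\sqrt n}\right)=0.$$ If $z_0=a_t\cos\phi+i\,b_t\sin\phi\in\partial E_t$ with $\phi\in(-\pi,\pi]$, then $$\lim_{n\to\infty}\frac1{n^m}R_n^{(m)}\left(z_0+\tfrac{a_1e^{i\psi}}{\sqrt n},\dots,z_0+\tfrac{a_me^{i\psi}}{\sqrt n}\right)=\det\left(\tfrac1{2\pi}\mathrm{erfc}\left(\tfrac{\overline{a_k}+a_l}{\sqrt2}\right)e^{-\frac12|a_k-a_l|^2+i\,\mathrm{Im}(\overline{a_k}a_l)}\right)_{k,l=1}^m,$$ where $$\psi=\begin{cases}\arctan\left(\frac{1+t}{1-t}\tan\phi\right)&\text{if }\phi\in(-\frac\pi2,\frac\pi2),\\ \arctan\left(\frac{1+t}{1-t}\tan\phi\right)+\mathrm{sign}(\phi)\pi&\text{if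 }\phi\notin[-\frac\pi2,\frac\pi2],\\ \phi&\text{if }\phi=\pm\frac\pi2.\end{cases}$$
   Context: For $n\in\mathbb N$, let $(p_{k,n})_{k\ge0}$ be the polynomials with $\deg p_{k,n}=k$ and positive leading coefficient satisfying $\int_{\mathbb C}\overline{p_{k,n}(z)}p_{l,n}(z)e^{-nV(z)}\,d^2z=\delta_{kl}$ ($d^2z$ is Lebesgue measure). The normalized reproducing kernel is $K_n(w,z)=e^{-\frac n2(V(w)+V(z))}\sum_{k=0}^{n-1}\overline{p_{k,n}(w)}\,p_{k,n}(z)$, and for $1\le m\le n$ the $m$-point correlation function is $R_n^{(m)}(z_1,\dots,z_m)=\det(K_n(z_k,z_l))_{k,l=1}^m$. Let $a_t=\sqrt{\frac{1+t}{1-t}}$, $b_t=\sqrt{\frac{1-t}{1+t}}$ and $\partial E_t=\{z\in\mathbb C:\frac{(\mathrm{Re}\,z)^2}{a_t^2}+\frac{(\mathrm{Im}\,z)^2}{b_t^2}=1\}$; "inside" means the left-hand side is $<1$, "outside" means $>1$. $\mathrm{erfc}(z)=\frac{2}{\sqrt\pi}\int_z^\infty e^{-w^2}dw$ (entire function). *)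

theory Defs
  imports "HOL-Analysis.Analysis" "HOL-Computational_Algebra.Polynomial"
begin

text \<open>The weight is \<open>exp (- n * V z)\<close> and \<open>lborel\<close> on \<^typ>\<open>complex\<close> is planar Lebesgue measure.
  Using \<^const>\<open>has_bochner_integral\<close> makes the integrability of the inner products part of the
  condition. A leading coefficient is positive if it is real and positive.\<close>

definition orthonormal_polys :: "(complex \<Rightarrow> real) \<Rightarrow> nat \<Rightarrow> (nat \<Rightarrow> complex poly) \<Rightarrow> bool" where
  "orthonormal_polys V n p \<longleftrightarrow>
     (\<forall>k. degree (p k) = k \<and> lead_coeff (p k) \<in> \<real> \<and> Re (lead_coeff (p k)) > 0) \<and>
     (\<forall>k l. has_bochner_integral lborel
        (\<lambda>z. cnj (poly (p k) z) * poly (p l) z * of_real (exp (- real n * V z)))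
        (if k = l then 1 else 0))"

definition onp :: "(complex \<Rightarrow> real) \<Rightarrow> nat \<Rightarrow> nat \<Rightarrow> complex poly" where
  "onp V n = (THE p. orthonormal_polys V n p)"

definition kernel :: "(complex \<Rightarrow> real) \<Rightarrow> nat \<Rightarrow> complex \<Rightarrow> complex \<Rightarrow> complex" where
  "kernel V n w z =
     of_real (exp (- (real n / 2) * (V w + V z))) *
     (\<Sum>k<n. cnj (poly (onp V n k) w) * poly (onp V n k) z)"

text \<open>The number of points is \<open>m = CARD('m)\<close>, so \<open>m \<ge> 1\<close> holds automatically. The formula is the
  correlation function for \<open>m \<le> n\<close>; smaller \<open>n\<close> do not matter for limits as \<open>n\<close> tends to infinity.\<close>

definition corr_fun :: "(complex \<Rightarrow> real) \<Rightarrow> nat \<Rightarrow> complex ^ 'm \<Rightarrow> complex" where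
  "corr_fun V n z = det (\<chi> k l. kernel V n (z $ k) (z $ l))"

definition elliptic_potential :: "real \<Rightarrow> complex \<Rightarrow> real" where
  "elliptic_potential t z = (cmod z)\<^sup>2 - Re (of_real t * z\<^sup>2)"

definition semi_a :: "real \<Rightarrow> real" where
  "semi_a t = sqrt ((1 + t) / (1 - t))"

definition semi_b :: "real \<Rightarrow> real" where
  "semi_b t = sqrt ((1 - t) / (1 + t))"

definition ellipse_form :: "real \<Rightarrow> complex \<Rightarrow> real" where
  "ellipse_form t z = (Re z)\<^sup>2 / (semi_a t)\<^sup>2 + (Im z)\<^sup>2 / (semi_b t)\<^sup>2"

definition inside_ellipse :: "real \<Rightarrow> complex set" where
  "inside_ellipse t = {z. ellipse_form t z < 1}"

definition outside_ellipse :: "real \<Rightarrow> complex set" where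
  "outside_ellipse t = {z. ellipse_form t z > 1}"

text \<open>The integral of \<open>exp (- w\<^sup>2)\<close> from \<open>z\<close> to \<open>\<infinity>\<close> is taken along the horizontal ray
  \<open>w = z + s\<close>, \<open>s \<ge> 0\<close>; this gives the entire function extending the real \<open>erfc\<close>.\<close>

definition erfc :: "complex \<Rightarrow> complex" where
  "erfc z = of_real (2 / sqrt pi) *
     (LINT s:{0..}|lborel. exp (- (z + of_real s)\<^sup>2))"

text \<open>For \<open>\<phi>\<close> in \<open>{- pi<..pi}\<close> the last branch is exactly the case \<open>\<phi> = \<plusminus> pi / 2\<close>.\<close>

definition normal_angle :: "real \<Rightarrow> real \<Rightarrow> real" where
  "normal_angle t \<phi> =
     (if \<phi> \<in> {- pi / 2<..<pi / 2} then arctan ((1 + t) / (1 - t) * tan \<phi>)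
      else if \<phi> \<notin> {- pi / 2..pi / 2} then arctan ((1 + t) / (1 - t) * tan \<phi>) + sgn \<phi> * pi
      else \<phi>)"

definition ginibre_factor :: "complex \<Rightarrow> complex \<Rightarrow> complex" where
  "ginibre_factor a b =
     exp (of_real (- (1 / 2) * (cmod (a - b))\<^sup>2) + \<i> * of_real (Im (cnj a * b)))"

end

theory Submission
  imports Defs "HOL-Probability.Probability" "HOL-Complex_Analysis.Complex_Analysis"
begin

text \<open>
  The orthonormal polynomials are rescaled Hermite polynomials, and by Mehler's formula the terms of
  the kernel are the coefficients of an explicit function of an auxiliary variable \<open>\<rho>\<close>; the
  full series at \<open>\<rho> = 1\<close> is, up to a unimodular gauge factor that cancels in the determinant,
  exactly the Ginibre kernel. On the diagonal the coefficients are nonnegative, so the Chernoff bound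
  controls the tail or the head of the series: the logarithmic derivative of the exponent
  at \<open>\<rho> = 1\<close> is the ellipse form minus \<open>1\<close>, negative inside and positive outside.
  Off-diagonal terms are dominated by diagonal ones. On the boundary the first \<open>n\<close> coefficients
  are summed by Cauchy's formula on the circle \<open>\<rho> = exp ((-1 + i s) / (\<sigma> sqrt n))\<close>, where
  dominated convergence leaves a Gaussian contour integral, which is the complementary error function.
\<close>

section \<open>Gaussian integrals over the plane\<close>

text \<open>On the diagonal, the three cases are limit theorems for one distribution. The
  nonnegative terms at z, divided by their sum, form a probability law in k whose generating
  function is given by Mehler's formula; its mean is n times the ellipse form, up to a bounded
  error. Inside and outside, this mean misses n by a multiple of n, so cutting at n keeps or drops
  all but an exponentially small mass. On the boundary the mean is n to leading order and the
  variance is about \<sigma>^2 n, so the cut runs through the bulk at the scale sqrt n, and half an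
  erfc appears as a Gaussian tail. Off the diagonal the terms are complex and the law is only a
  guide. The obstacle on the boundary is that the critical point of the exponent and the pole of 1 /
  (1 - \<rho>), which turns coefficients into partial sums, both lie at \<rho> = 1. A circle whose
  distance from 1 is comparable with 1 / sqrt n keeps both contributions at the same order.
  Throughout, \<rho> = 1 must lie strictly inside the disc of convergence; its radius is 1 / t,
  which exceeds 1.\<close>

lemma lborel_complex_eq: "lborel = distr (lborel \<Otimes>\<^sub>M lborel) borel (\<lambda>(x, y). Complex x y)"
\<comment> \<open>Agreement on boxes determines Lebesgue measure. The identification opens integrals
  over the complex type to Fubini on pairs of reals.\<close>
proof (rule lborel_eqI)
  have meas [measurable]: "(\<lambda>(x, y). Complex x y) \<in> borel_measurable (lborel \<Otimes>\<^sub>M lborel)"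
    unfolding Complex_eq by measurable
  show "emeasure (distr (lborel \<Otimes>\<^sub>M lborel) borel (\<lambda>(x, y). Complex x y)) (box l u) = (\<Prod>b\<in>Basis. (u - l) \<bullet> b)"
    if le: "\<And>b. b \<in> Basis \<Longrightarrow> l \<bullet> b \<le> u \<bullet> b" for l u
  proof -
    have le': "Re l \<le> Re u" "Im l \<le> Im u"
      using le[of 1] le[of \<i>] by (auto simp: Basis_complex_def)
    have "(\<lambda>(x, y). Complex x y) -` box l u \<inter> space (lborel \<Otimes>\<^sub>M lborel)
          = {Re l<..<Re u} \<times> {Im l<..<Im u}"
      by (auto simp: box_def Basis_complex_def space_pair_measure)
    then have "emeasure (distr (lborel \<Otimes>\<^sub>M lborel) borel (\<lambda>(x, y). Complex x y)) (box l u)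
          = emeasure (lborel \<Otimes>\<^sub>M lborel) ({Re l<..<Re u} \<times> {Im l<..<Im u})"
      by (subst emeasure_distr) auto
    also have "\<dots> = emeasure lborel {Re l<..<Re u} * emeasure lborel {Im l<..<Im u}"
      by (rule lborel.emeasure_pair_measure_Times) auto
    finally show ?thesis
      using le' by (simp add: Basis_complex_def ennreal_mult)
  qed
qed auto

lemma Complex_measurable [measurable]:
  "(\<lambda>(x, y). Complex x y) \<in> borel_measurable (lborel \<Otimes>\<^sub>M lborel)"
  unfolding Complex_eq by measurable

lemma integrable_lborel_complex_iff:
  fixes f :: "complex \<Rightarrow> 'a :: {banach, second_countable_topology}"
  assumes "f \<in> borel_measurable borel"
  shows "integrable lborel f \<longleftrightarrow> integrable (lborel \<Otimes>\<^sub>M lborel) (\<lambda>(x, y). f (Complex x y))"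
  by (subst lborel_complex_eq, subst integrable_distr_eq) (use assms in \<open>auto simp: split_def\<close>)

lemma integral_lborel_complex:
  fixes f :: "complex \<Rightarrow> 'a :: {banach, second_countable_topology}"
  assumes "f \<in> borel_measurable borel"
  shows "integral\<^sup>L lborel f = integral\<^sup>L (lborel \<Otimes>\<^sub>M lborel) (\<lambda>(x, y). f (Complex x y))"
  by (subst lborel_complex_eq, subst integral_distr) (use assms in \<open>auto simp: split_def\<close>)

lemma has_bochner_integral_gaussian:
  assumes "a > 0"
  shows "has_bochner_integral lborel (\<lambda>x. exp (- (a * x\<^sup>2))) (sqrt (pi / a))"
proof -
  have eq: "(\<lambda>x. exp (- (a * x\<^sup>2))) = (\<lambda>x. sqrt (pi / a) * normal_density 0 (1 / sqrt (2 * a)) x)"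
    using assms by (auto simp: normal_density_def fun_eq_iff power_divide real_sqrt_divide)
  show ?thesis
    unfolding eq using assms
    by (auto simp: has_bochner_integral_iff intro!: integral_normal_density)
qed

lemmas integrable_gaussian = integrable.intros[OF has_bochner_integral_gaussian]

text \<open>Polynomial growth costs only an arbitrarily small share of Gaussian decay. Integrability
  and vanishing boundary terms then follow without tracking degrees; each Horner step of the
  induction halves the share \<open>e\<close>.\<close>

lemma poly_le_exp_square:
  fixes p :: "complex poly"
  assumes "e > 0"
  shows "\<exists>C>0. \<forall>z. norm (poly p z) \<le> C * exp (e * (norm z)\<^sup>2)"
  using assms
proof (induction p arbitrary: e)
  case 0
  then show ?case by (intro exI[of _ 1]) auto
next
  case (pCons a p)
  obtain C where C: "C > 0" "\<And>z. norm (poly p z) \<le> C * exp (e / 2 * (norm z)\<^sup>2)"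
    using pCons.IH[of "e / 2"] pCons.prems by auto
  \<comment> \<open>\<open>K\<close> must satisfy 1 \<le> K and 1 \<le> K e / 2, so that x \<le> 1 +
    x^2 is at most K (1 + e x^2 / 2) and hence at most K exp (e x^2 / 2).\<close>
  define K where "K = max 1 (2 / e)"
  have K: "x \<le> K * exp (e / 2 * x\<^sup>2)" if "x \<ge> 0" for x :: real
  proof -
    have "x \<le> 1 + x\<^sup>2"
      by (cases "x \<le> 1"; simp add: power2_eq_square add_increasing2)
        (metis mult_left_mono mult.right_neutral add_increasing less_eq_real_def linorder_not_le that zero_less_one)
    also have "\<dots> \<le> K * 1 + K * (e / 2 * x\<^sup>2)"
    proof (rule add_mono)
      have "2 / e \<le> K" by (simp add: K_def)
      then have "1 \<le> K * (e / 2)" using pCons.prems by (simp add: field_simps)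
      then have "1 * x\<^sup>2 \<le> K * (e / 2) * x\<^sup>2" by (rule mult_right_mono) auto
      then show "x\<^sup>2 \<le> K * (e / 2 * x\<^sup>2)" by simp
    qed (simp add: K_def)
    also have "\<dots> \<le> K * exp (e / 2 * x\<^sup>2)"
      using mult_left_mono[OF exp_ge_add_one_self[of "e / 2 * x\<^sup>2"], of K]
      by (simp add: K_def distrib_left)
    finally show ?thesis .
  qed
  have "norm (poly (pCons a p) z) \<le> (norm a + K * C) * exp (e * (norm z)\<^sup>2)" for z
  proof -
    have "norm (poly (pCons a p) z) \<le> norm a + norm z * norm (poly p z)"
      by (simp add: norm_triangle_le norm_mult)
    also have "\<dots> \<le> norm a * exp (e * (norm z)\<^sup>2) + (K * exp (e / 2 * (norm z)\<^sup>2)) * (C * exp (e / 2 * (norm z)\<^sup>2))"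
      using pCons.prems C K[of "norm z"]
      by (intro add_mono mult_mono) (auto simp: mult_le_cancel_left1 K_def)
    also have "\<dots> = (norm a + K * C) * exp (e * (norm z)\<^sup>2)"
      by (simp add: algebra_simps flip: exp_add)
    finally show ?thesis .
  qed
  moreover have "norm a + K * C > 0" using C by (intro add_nonneg_pos mult_pos_pos) (auto simp: K_def)
  ultimately show ?case by blast
qed

lemma integrable_poly_gaussian:
  fixes r :: "complex poly"
  assumes "a > 0"
  shows "integrable lborel (\<lambda>x::real. poly r (of_real x) * of_real (exp (- (a * x\<^sup>2))))"
proof -
  obtain C where C: "C > 0" "\<And>z. norm (poly r z) \<le> C * exp (a / 2 * (norm z)\<^sup>2)"
    using poly_le_exp_square[of "a / 2" r] assms by auto
  show ?thesis
  proof (rule Bochner_Integration.integrable_bound[where f = "\<lambda>x. C * exp (- (a / 2 * x\<^sup>2))"])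
    show "integrable lborel (\<lambda>x. C * exp (- (a / 2 * x\<^sup>2)))"
      using assms by (intro integrable_mult_right integrable_gaussian) auto
    show "AE x in lborel. norm (poly r (of_real x) * of_real (exp (- (a * x\<^sup>2)))) \<le> norm (C * exp (- (a / 2 * x\<^sup>2)))"
    proof (intro AE_I2)
      fix x :: real
      have "norm (poly r (of_real x) * of_real (exp (- (a * x\<^sup>2)))) \<le> C * exp (a / 2 * x\<^sup>2) * exp (- (a * x\<^sup>2))"
        using C(2)[of "of_real x"] by (simp add: norm_mult)
      also have "\<dots> = C * exp (- (a / 2 * x\<^sup>2))"
        by (simp add: field_simps flip: exp_add)
      finally show "norm (poly r (of_real x) * of_real (exp (- (a * x\<^sup>2)))) \<le> norm (C * exp (- (a / 2 * x\<^sup>2)))"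
        using C(1) by simp
    qed
  qed (simp, intro borel_measurable_continuous_onI continuous_intros)
qed

lemma tendsto_poly_gaussian:
  fixes r :: "complex poly"
  assumes "a > 0" "F = at_top \<or> F = at_bot"
  shows "((\<lambda>x::real. poly r (of_real x) * of_real (exp (- (a * x\<^sup>2)))) \<longlongrightarrow> 0) F"
proof -
  obtain C where C: "C > 0" "\<And>z. norm (poly r z) \<le> C * exp (a / 2 * (norm z)\<^sup>2)"
    using poly_le_exp_square[of "a / 2" r] assms by auto
  have "((\<lambda>x. C * exp (- (a / 2 * x\<^sup>2))) \<longlongrightarrow> 0) F"
    using assms(2) \<open>a > 0\<close> by (elim disjE; simp only:) real_asymp+
  then show ?thesis
  proof (rule Lim_null_comparison[rotated], intro always_eventually allI)
    fix x :: real
    have "norm (poly r (of_real x) * of_real (exp (- (a * x\<^sup>2)))) \<le> C * exp (a / 2 * x\<^sup>2) * exp (- (a * x\<^sup>2))"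
      using C(2)[of "of_real x"] by (simp add: norm_mult)
    also have "\<dots> = C * exp (- (a / 2 * x\<^sup>2))"
      by (simp add: field_simps flip: exp_add)
    finally show "norm (poly r (of_real x) * of_real (exp (- (a * x\<^sup>2)))) \<le> C * exp (- (a / 2 * x\<^sup>2))" .
  qed
qed

text \<open>The integrand is the derivative of \<open>r\<close> times the Gaussian, and the boundary
  values vanish. Every integration by parts over the plane is reduced to this.\<close>

lemma integral_poly_gaussian_deriv:
  fixes r :: "complex poly"
  assumes "a > 0"
  shows "(\<integral>x. poly (pderiv r - smult (of_real (2 * a)) ([:0, 1:] * r)) (of_real x) * of_real (exp (- (a * x\<^sup>2))) \<partial>lborel) = 0"
proof -
  let ?g = "\<lambda>x::real. poly (pderiv r - smult (of_real (2 * a)) ([:0, 1:] * r)) (of_real x) * of_real (exp (- (a * x\<^sup>2)))"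
  let ?G = "\<lambda>x::real. poly r (of_real x) * of_real (exp (- (a * x\<^sup>2)))"
  have "(LBINT x=-\<infinity>..\<infinity>. ?g x) = 0 - 0"
  proof (rule interval_integral_FTC_integrable)
    show "(?G has_vector_derivative ?g x) (at x)" for x
    proof -
      have "((\<lambda>z. poly r z * exp (- (of_real a * z\<^sup>2))) has_field_derivative
              poly (pderiv r) (of_real x) * exp (- (of_real a * (of_real x)\<^sup>2))
              + exp (- (of_real a * (of_real x)\<^sup>2)) * (- (of_real a * (2 * of_real x))) * poly r (of_real x)) (at (of_real x))"
        by (auto intro!: derivative_eq_intros)
      from has_vector_derivative_real_field[OF this]
      show ?thesis by (simp add: algebra_simps o_def exp_of_real[symmetric])
    qed
    show "isCont ?g x" for x by (intro continuous_intros)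
    show "set_integrable lborel (einterval (-\<infinity>) \<infinity>) ?g"
      using integrable_poly_gaussian[OF assms, of "pderiv r - smult (of_real (2 * a)) ([:0, 1:] * r)"]
      by (simp add: set_integrable_def)
    show "((?G \<circ> real_of_ereal) \<longlongrightarrow> 0) (at_right (-\<infinity>))"
      using tendsto_poly_gaussian[OF assms, of at_bot r] by (auto simp: ereal_tendsto_simps1)
    show "((?G \<circ> real_of_ereal) \<longlongrightarrow> 0) (at_left \<infinity>)"
      using tendsto_poly_gaussian[OF assms, of at_top r] by (auto simp: ereal_tendsto_simps1)
  qed auto
  then show ?thesis
    by (simp add: interval_lebesgue_integral_def set_lebesgue_integral_def)
qed

section \<open>The weighted inner product and integration by parts\<close>

definition gweight :: "real \<Rightarrow> real \<Rightarrow> complex \<Rightarrow> complex" where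
  "gweight a b z = of_real (exp (- (a * (Re z)\<^sup>2 + b * (Im z)\<^sup>2)))"

text \<open>Conjugate-linear in the first argument. The elliptic potential is a diagonal quadratic
  form in real and imaginary part, so its weight is the case \<open>a = n * (1 - t)\<close>,
  \<open>b = n * (1 + t)\<close>.\<close>

definition gip :: "real \<Rightarrow> real \<Rightarrow> complex poly \<Rightarrow> complex poly \<Rightarrow> complex" where
  "gip a b q p = (\<integral>z. cnj (poly q z) * poly p z * gweight a b z \<partial>lborel)"

lemma gip_measurable [measurable]:
  "(\<lambda>z. cnj (poly q z) * poly p z * gweight a b z) \<in> borel_measurable borel"
  unfolding gweight_def by (intro borel_measurable_continuous_onI continuous_intros)

lemma gip_integrable:
  assumes "a > 0" "b > 0"
  shows "integrable lborel (\<lambda>z. cnj (poly q z) * poly p z * gweight a b z)"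
proof -
  \<comment> \<open>Each polynomial may grow with rate \<open>e\<close>, together 2 e; the weight
    supplies at least 4 e, which leaves decay of rate 2 e in both variables.\<close>
  define e where "e = min a b / 4"
  have e: "e > 0" "4 * e \<le> a" "4 * e \<le> b" using assms by (auto simp: e_def)
  obtain C where C: "C > 0" "\<And>z. norm (poly p z) \<le> C * exp (e * (norm z)\<^sup>2)"
    using poly_le_exp_square[OF e(1), of p] by auto
  obtain D where D: "D > 0" "\<And>z. norm (poly q z) \<le> D * exp (e * (norm z)\<^sup>2)"
    using poly_le_exp_square[OF e(1), of q] by auto
  let ?f = "\<lambda>z. cnj (poly q z) * poly p z * gweight a b z"
  let ?B = "\<lambda>(x, y). (D * C * exp (- (2 * e * x\<^sup>2))) * exp (- (2 * e * y\<^sup>2))"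
  have "integrable (lborel \<Otimes>\<^sub>M lborel) ?B"
    using e by (intro lborel_pair.Fubini_integrable)
      (auto intro!: integrable_gaussian integrable_mult_right integrable_mult_left Bochner_Integration.integrable_norm
        simp: norm_mult split_def abs_mult)
  then have "integrable (lborel \<Otimes>\<^sub>M lborel) (\<lambda>(x, y). ?f (Complex x y))"
  proof (rule Bochner_Integration.integrable_bound)
    show "AE x in lborel \<Otimes>\<^sub>M lborel. norm (case x of (x, y) \<Rightarrow> ?f (Complex x y)) \<le> norm (?B x)"
    proof (intro AE_I2)
      fix xy :: "real \<times> real"
      obtain x y where xy: "xy = (x, y)" by (cases xy)
      have "norm (?f (Complex x y)) \<le> (D * exp (e * (x\<^sup>2 + y\<^sup>2))) * (C * exp (e * (x\<^sup>2 + y\<^sup>2))) * exp (- (a * x\<^sup>2 + b * y\<^sup>2))"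
        using C(2)[of "Complex x y"] D(2)[of "Complex x y"] C(1) D(1)
        unfolding norm_mult gweight_def complex_mod_cnj
        by (intro mult_mono) (auto simp: cmod_power2)
      also have "\<dots> = D * C * exp (2 * e * x\<^sup>2 + 2 * e * y\<^sup>2 - (a * x\<^sup>2 + b * y\<^sup>2))"
        by (simp add: algebra_simps flip: exp_add)
      also have "\<dots> \<le> D * C * exp (- (2 * e * x\<^sup>2 + 2 * e * y\<^sup>2))"
        using mult_right_mono[OF e(2), of "x\<^sup>2"] mult_right_mono[OF e(3), of "y\<^sup>2"] C(1) D(1)
        by (intro mult_left_mono) auto
      also have "\<dots> = norm (?B (x, y))"
        using C(1) D(1) by (simp add: abs_mult algebra_simps flip: exp_add)
      finally show "norm (case xy of (x, y) \<Rightarrow> ?f (Complex x y)) \<le> norm (?B xy)" by (simp add: xy)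
    qed
  qed measurable
  then show ?thesis
    by (subst integrable_lborel_complex_iff) auto
qed

text \<open>Both orders are needed: integration by parts acts on the inner variable, which is once
  the real and once the imaginary part.\<close>

lemma integral_lborel_complex_iterated:
  fixes f :: "complex \<Rightarrow> complex"
  assumes "integrable lborel f"
  shows "integral\<^sup>L lborel f = (\<integral>x. (\<integral>y. f (Complex x y) \<partial>lborel) \<partial>lborel)"
    and "integral\<^sup>L lborel f = (\<integral>y. (\<integral>x. f (Complex x y) \<partial>lborel) \<partial>lborel)"
proof -
  have meas: "f \<in> borel_measurable borel" using assms by auto
  have int: "integrable (lborel \<Otimes>\<^sub>M lborel) (\<lambda>(x, y). f (Complex x y))"
    using assms integrable_lborel_complex_iff[OF meas] by simp
  show "integral\<^sup>L lborel f = (\<integral>x. (\<integral>y. f (Complex x y) \<partial>lborel) \<partial>lborel)"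
    using lborel_pair.integral_fst[OF int] integral_lborel_complex[OF meas] by simp
  show "integral\<^sup>L lborel f = (\<integral>y. (\<integral>x. f (Complex x y) \<partial>lborel) \<partial>lborel)"
    using lborel_pair.integral_snd[OF int] integral_lborel_complex[OF meas] by simp
qed

lemma gip_add_right: "a > 0 \<Longrightarrow> b > 0 \<Longrightarrow> gip a b q (p + r) = gip a b q p + gip a b q r"
  unfolding gip_def
  using Bochner_Integration.integral_add[OF gip_integrable gip_integrable, of a b a b q p q r]
  by (simp add: algebra_simps)

lemma gip_smult_right: "gip a b q (smult c p) = c * gip a b q p"
  unfolding gip_def by (subst integral_mult_right_zero[symmetric]) (simp add: mult_ac)

lemma gip_cnj: "cnj (gip a b q p) = gip a b p q"
  unfolding gip_def Bochner_Integration.integral_cnj[symmetric] by (simp add: gweight_def mult_ac)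

lemma gip_add_left: "a > 0 \<Longrightarrow> b > 0 \<Longrightarrow> gip a b (p + r) q = gip a b p q + gip a b r q"
  using gip_add_right[of a b q p r] by (metis complex_cnj_add gip_cnj)

lemma gip_smult_left: "gip a b (smult c q) p = cnj c * gip a b q p"
  by (metis complex_cnj_mult gip_cnj gip_smult_right)

lemma gip_diff_right: "a > 0 \<Longrightarrow> b > 0 \<Longrightarrow> gip a b q (p - r) = gip a b q p - gip a b q r"
  using gip_add_right[of a b q "p - r" r] by simp

lemma gip_1_1:
  assumes "a > 0" "b > 0"
  shows "gip a b 1 1 = of_real (pi / sqrt (a * b))"
proof -
  have "gip a b 1 1 = (\<integral>x. (\<integral>y. of_real (exp (- (a * x\<^sup>2)) * exp (- (b * y\<^sup>2))) \<partial>lborel) \<partial>lborel)"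
    using integral_lborel_complex_iterated(1)[OF gip_integrable[OF assms, of 1 1]]
    by (simp add: gip_def gweight_def algebra_simps flip: exp_add)
  also have "\<dots> = of_real (\<integral>x. (\<integral>y. exp (- (a * x\<^sup>2)) * exp (- (b * y\<^sup>2)) \<partial>lborel) \<partial>lborel)"
    by (simp only: integral_complex_of_real)
  also have "\<dots> = of_real (sqrt (pi / a) * sqrt (pi / b))"
    using has_bochner_integral_integral_eq[OF has_bochner_integral_gaussian[OF assms(1)]]
      has_bochner_integral_integral_eq[OF has_bochner_integral_gaussian[OF assms(2)]] by simp
  also have "sqrt (pi / a) * sqrt (pi / b) = pi / sqrt (a * b)"
    by (simp add: real_sqrt_divide real_sqrt_mult field_simps)
  finally show ?thesis .
qed

lemma poly_map_poly_cnj: "poly (map_poly cnj p) (of_real x) = cnj (poly p (of_real x))"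
  using poly_cnj[of p "of_real x"] by simp

lemma pderiv_map_poly_cnj: "pderiv (map_poly cnj p) = map_poly cnj (pderiv p)"
  by (intro poly_eqI) (simp add: coeff_pderiv coeff_map_poly)

text \<open>Along a real line the conjugate of a polynomial is again a polynomial in the real
  parameter, with conjugated coefficients, so the product falls under
  \<open>integral_poly_gaussian_deriv\<close>. The direction \<open>e\<close> will be 1 or
  \<i>.\<close>

lemma line_integral_gaussian_deriv:
  fixes c e :: complex
  assumes "a > 0"
  shows "(\<integral>s. (cnj (e * poly (pderiv q) (c + s * e)) * poly p (c + s * e)
     + cnj (poly q (c + s * e)) * (e * poly (pderiv p) (c + s * e))
     - of_real (2 * a) * of_real s * cnj (poly q (c + s * e)) * poly p (c + s * e)) * of_real (exp (- (a * s\<^sup>2))) \<partial>lborel) = 0"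
proof -
  define P where "P = pcompose p [:c, e:]"
  define Q where "Q = map_poly cnj (pcompose q [:c, e:])"
  have P: "poly P (of_real s) = poly p (c + s * e)" "poly (pderiv P) (of_real s) = e * poly (pderiv p) (c + s * e)" for s :: real
    by (simp_all add: P_def poly_pcompose pderiv_pcompose pderiv_pCons)
  have Q: "poly Q (of_real s) = cnj (poly q (c + s * e))" "poly (pderiv Q) (of_real s) = cnj (e * poly (pderiv q) (c + s * e))" for s :: real
    by (simp_all add: Q_def pderiv_map_poly_cnj poly_map_poly_cnj poly_pcompose pderiv_pcompose pderiv_pCons)
  show ?thesis
    using integral_poly_gaussian_deriv[OF assms, of "Q * P"]
    by (simp add: pderiv_mult P Q algebra_simps)
qed

lemma gip_Re_by_parts:
  assumes "a > 0" "b > 0"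
  shows "gip a b (pderiv q) p + gip a b q (pderiv p)
    = of_real a * (gip a b q ([:0, 1:] * p) + gip a b ([:0, 1:] * q) p)"
proof -
  define f where "f q p z = cnj (poly q z) * poly p z * gweight a b z" for q p z
  define E where "E z = f (pderiv q) p z + f q (pderiv p) z
      - of_real a * (f q ([:0, 1:] * p) z + f ([:0, 1:] * q) p z)" for z
  have f [intro, simp]: "integrable lborel (f q p)" "integral\<^sup>L lborel (f q p) = gip a b q p" for q p
    unfolding f_def gip_def using gip_integrable[OF assms] by simp_all
  have "integral\<^sup>L lborel E = 0"
  proof (subst integral_lborel_complex_iterated(2))
    have "(\<integral>x. E (Complex x y) \<partial>lborel) = 0" for y
    proof -
      have "E (Complex x y) = of_real (exp (- (b * y\<^sup>2))) *
        ((cnj (1 * poly (pderiv q) (\<i> * y + of_real x * 1)) * poly p (\<i> * y + of_real x * 1)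
         + cnj (poly q (\<i> * y + of_real x * 1)) * (1 * poly (pderiv p) (\<i> * y + of_real x * 1))
         - of_real (2 * a) * of_real x * cnj (poly q (\<i> * y + of_real x * 1)) * poly p (\<i> * y + of_real x * 1)) * of_real (exp (- (a * x\<^sup>2))))" for x
        by (simp add: E_def f_def gweight_def Complex_eq exp_add exp_diff exp_minus exp_of_real field_simps)
      then show ?thesis
        by (simp only: integral_mult_right_zero line_integral_gaussian_deriv[OF assms(1)] mult_zero_right)
    qed
    then show "(\<integral>y. (\<integral>x. E (Complex x y) \<partial>lborel) \<partial>lborel) = 0" by simp
  qed (unfold E_def, intro Bochner_Integration.integrable_add Bochner_Integration.integrable_diff integrable_mult_right f)
  moreover have "integral\<^sup>L lborel E = gip a b (pderiv q) p + gip a b q (pderiv p)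
      - of_real a * (gip a b q ([:0, 1:] * p) + gip a b ([:0, 1:] * q) p)"
    unfolding E_def by (simp del: mult_pCons_left)
  ultimately show ?thesis by simp
qed

text \<open>Differentiating along \<i> gives \<open>pderiv p\<close> the factor \<i> and the
  conjugated \<open>pderiv q\<close> the factor -\<i>. This sign makes the identity independent of
  \<open>gip_Re_by_parts\<close>, so that the two together can be solved for a single term.\<close>

lemma gip_Im_by_parts:
  assumes "a > 0" "b > 0"
  shows "gip a b (pderiv q) p - gip a b q (pderiv p)
    = of_real b * (gip a b q ([:0, 1:] * p) - gip a b ([:0, 1:] * q) p)"
proof -
  define f where "f q p z = cnj (poly q z) * poly p z * gweight a b z" for q p z
  define E where "E z = f (pderiv q) p z - f q (pderiv p) z
      - of_real b * (f q ([:0, 1:] * p) z - f ([:0, 1:] * q) p z)" for z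
  have f [intro, simp]: "integrable lborel (f q p)" "integral\<^sup>L lborel (f q p) = gip a b q p" for q p
    unfolding f_def gip_def using gip_integrable[OF assms] by simp_all
  have "integral\<^sup>L lborel E = 0"
  proof (subst integral_lborel_complex_iterated(1))
    have "(\<integral>y. E (Complex x y) \<partial>lborel) = 0" for x
    proof -
      have "E (Complex x y) = \<i> * of_real (exp (- (a * x\<^sup>2))) *
        ((cnj (\<i> * poly (pderiv q) (x + y * \<i>)) * poly p (x + y * \<i>)
         + cnj (poly q (x + y * \<i>)) * (\<i> * poly (pderiv p) (x + y * \<i>))
         - of_real (2 * b) * of_real y * cnj (poly q (x + y * \<i>)) * poly p (x + y * \<i>)) * of_real (exp (- (b * y\<^sup>2))))" for y
        by (simp add: E_def f_def gweight_def Complex_eq exp_add exp_diff exp_minus exp_of_real field_simps)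
      then show ?thesis
        by (simp only: integral_mult_right_zero line_integral_gaussian_deriv[OF assms(2)] mult_zero_right)
    qed
    then show "(\<integral>x. (\<integral>y. E (Complex x y) \<partial>lborel) \<partial>lborel) = 0" by simp
  qed (unfold E_def, intro Bochner_Integration.integrable_add Bochner_Integration.integrable_diff integrable_mult_right f)
  moreover have "integral\<^sup>L lborel E = gip a b (pderiv q) p - gip a b q (pderiv p)
      - of_real b * (gip a b q ([:0, 1:] * p) - gip a b ([:0, 1:] * q) p)"
    unfolding E_def by (simp del: mult_pCons_left)
  ultimately show ?thesis by simp
qed

section \<open>The orthonormal polynomials of the elliptic potential\<close>

text \<open>Rescaled monic Hermite polynomials: for c > 0 this is c^(k/2) He_k (z / sqrt c), with
  the probabilists' He_k. The recursion by the raising operator is preferred to the three-term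
  recurrence because orthogonality is derived from it.\<close>

fun hpoly :: "real \<Rightarrow> nat \<Rightarrow> complex poly" where
  "hpoly c 0 = 1"
| "hpoly c (Suc k) = [:0, 1:] * hpoly c k - smult (of_real c) (pderiv (hpoly c k))"

text \<open>The Appell property: it lets differentiation lower the index in the orthogonality proof
  and converts the defining recursion into the three-term recurrence.\<close>

lemma pderiv_hpoly: "pderiv (hpoly c (Suc k)) = smult (of_nat (Suc k)) (hpoly c k)"
proof (induction k)
  case 0
  then show ?case by (simp add: pderiv_pCons pderiv_diff)
next
  case (Suc k)
  have "pderiv (hpoly c (Suc (Suc k))) = hpoly c (Suc k) + [:0, 1:] * pderiv (hpoly c (Suc k)) - smult (of_real c) (pderiv (pderiv (hpoly c (Suc k))))"
    by (subst hpoly.simps(2)) (simp only: pderiv_diff pderiv_mult pderiv_smult, simp add: pderiv_pCons)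
  also have "\<dots> = hpoly c (Suc k) + smult (of_nat (Suc k)) ([:0, 1:] * hpoly c k - smult (of_real c) (pderiv (hpoly c k)))"
    unfolding Suc.IH pderiv_smult by (simp only: smult_diff_right mult_smult_right smult_smult mult.commute add_diff_eq)
  also have "\<dots> = smult (of_nat (Suc (Suc k))) (hpoly c (Suc k))"
    by (simp only: hpoly.simps(2)[symmetric]) (simp only: of_nat_Suc[of "Suc k"] smult_add_left smult_1_left)
  finally show ?case .
qed

lemma hpoly_monic: "degree (hpoly c k) = k \<and> lead_coeff (hpoly c k) = 1"
proof (induction k)
  case (Suc k)
  have 1: "degree ([:0, 1:] * hpoly c k) = Suc k" "lead_coeff ([:0, 1:] * hpoly c k) = 1"
    using Suc by (auto simp: degree_mult_eq lead_coeff_mult)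
  have "degree (- smult (of_real c) (pderiv (hpoly c k))) \<le> k"
    using Suc degree_smult_le[of "of_real c" "pderiv (hpoly c k)"] by (simp add: degree_pderiv)
  then have 2: "degree (- smult (of_real c) (pderiv (hpoly c k))) < degree ([:0, 1:] * hpoly c k)"
    using 1 by linarith
  show ?case
    using degree_add_eq_left[OF 2] lead_coeff_add_le[OF 2] 1 by (simp add: lead_coeff_add_le)
qed simp

lemma poly_hpoly_Suc_Suc:
  "poly (hpoly c (Suc (Suc k))) z = z * poly (hpoly c (Suc k)) z - of_real c * of_nat (Suc k) * poly (hpoly c k) z"
  by (subst hpoly.simps(2)) (simp del: hpoly.simps add: pderiv_hpoly)

lemma poly_hpoly_cnj: "poly (hpoly c k) (cnj z) = cnj (poly (hpoly c k) z)"
proof (induction k rule: induct_nat_012)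
  case (ge2 n)
  then show ?case by (simp del: hpoly.simps add: poly_hpoly_Suc_Suc)
qed auto

text \<open>The operator raising \<^const>\<open>hpoly\<close> is adjoint to a multiple of differentiation; iterating this
  yields orthogonality.\<close>

lemma gip_raise:
  assumes "a > 0" "b > 0"
  shows "gip a b q ([:0, 1:] * p - smult (of_real ((1 / a - 1 / b) / 2)) (pderiv p))
           = of_real ((1 / a + 1 / b) / 2) * gip a b (pderiv q) p"
  \<comment> \<open>Dividing the two identities by \<open>a\<close> and \<open>b\<close> and adding
    them eliminates the inner product of \<open>[:0, 1:] * q\<close> with \<open>p\<close>; half the
    result is the claim.\<close>
  using gip_Re_by_parts[OF assms, of q p] gip_Im_by_parts[OF assms, of q p] assms
  by (simp add: gip_diff_right gip_smult_right field_simps del: mult_pCons_left) algebra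

lemma gip_0_left [simp]: "gip a b 0 p = 0"
  by (simp add: gip_def)

text \<open>Each induction step on \<open>k\<close> moves one raising operator across as a
  derivative, which lowers \<open>j\<close> and contributes \<kappa> times the index. Unequal
  indices end in the derivative of 1.\<close>

lemma gip_hpoly:
  assumes ab: "a > 0" "b > 0"
  defines "c \<equiv> (1 / a - 1 / b) / 2" and "\<kappa> \<equiv> (1 / a + 1 / b) / 2"
  shows "gip a b (hpoly c j) (hpoly c k) = (if j = k then of_real (\<kappa> ^ k * fact k * (pi / sqrt (a * b))) else 0)"
proof (induction k arbitrary: j)
  case 0
  show ?case
  proof (cases j)
    case 0
    then show ?thesis using gip_1_1[OF ab] by simp
  next
    case (Suc i)
    have "gip a b 1 (hpoly c (Suc i)) = 0"
      using gip_raise[OF ab, of 1 "hpoly c i"] by (simp del: mult_pCons_left add: c_def)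
    then have "gip a b (hpoly c (Suc i)) 1 = 0"
      by (metis complex_cnj_zero gip_cnj)
    then show ?thesis using Suc by (simp del: hpoly.simps(2))
  qed
next
  case (Suc k)
  have eq: "gip a b (hpoly c j) (hpoly c (Suc k)) = of_real \<kappa> * gip a b (pderiv (hpoly c j)) (hpoly c k)"
    using gip_raise[OF ab, of "hpoly c j" "hpoly c k"] by (simp del: mult_pCons_left add: c_def \<kappa>_def)
  show ?case
  proof (cases j)
    case 0
    then show ?thesis by (subst eq) simp
  next
    case (Suc i)
    then show ?thesis
      by (subst eq) (simp add: pderiv_hpoly gip_smult_left Suc.IH del: hpoly.simps)
  qed
qed

lemma degree_diff_smult_less:
  fixes p e :: "complex poly"
  assumes "degree p = degree e" "e \<noteq> 0"
  shows "p - smult (lead_coeff p / lead_coeff e) e = 0 \<or> degree (p - smult (lead_coeff p / lead_coeff e) e) < degree p"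
  using assms by (intro eq_zero_or_degree_less degree_diff_le) (auto intro: order.trans[OF degree_smult_le])

text \<open>Strong induction on the degree: subtracting the matching multiple of \<open>p j\<close>
  removes the leading term.\<close>

lemma gip_eq_0_of_degree_less:
  assumes ab: "a > 0" "b > 0"
    and deg: "\<And>j. degree (p j) = j \<and> lead_coeff (p j) \<noteq> 0"
    and orth: "\<And>j. j < m \<Longrightarrow> gip a b (p j) r = 0"
  shows "degree q < m \<Longrightarrow> gip a b q r = 0"
proof (induction "degree q" arbitrary: q rule: less_induct)
  case less
  define j where "j = degree q"
  define s where "s = q - smult (lead_coeff q / lead_coeff (p j)) (p j)"
  have q: "q = s + smult (lead_coeff q / lead_coeff (p j)) (p j)"
    by (simp add: s_def)
  have "s = 0 \<or> degree s < degree q"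
    using degree_diff_smult_less[of q "p j"] deg[of j] by (auto simp: s_def j_def)
  then have "gip a b s r = 0"
    using less.hyps less.prems by auto
  moreover have "gip a b (p j) r = 0"
    using orth less.prems by (simp add: j_def)
  ultimately show ?case
    by (subst q) (simp add: gip_add_left[OF ab] gip_smult_left)
qed

text \<open>Needed because \<open>onp\<close> is a definite description. The remainder
  \<open>r\<close> of \<open>p k\<close> modulo \<open>e k\<close> has lower degree and is
  orthogonal to all lower degrees, so it vanishes. Normalization then makes \<mu> unimodular, and
  positive leading coefficients leave only 1.\<close>

lemma orthonormal_gip_unique:
  assumes ab: "a > 0" "b > 0"
    and p: "\<And>k. degree (p k) = k \<and> lead_coeff (p k) \<in> \<real> \<and> Re (lead_coeff (p k)) > 0"
           "\<And>k l. gip a b (p k) (p l) = (if k = l then 1 else 0)"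
    and e: "\<And>k. degree (e k) = k \<and> lead_coeff (e k) \<in> \<real> \<and> Re (lead_coeff (e k)) > 0"
           "\<And>k l. gip a b (e k) (e l) = (if k = l then 1 else 0)"
  shows "p = e"
proof
  fix k
  have p': "degree (p j) = j \<and> lead_coeff (p j) \<noteq> 0" and e': "degree (e j) = j \<and> lead_coeff (e j) \<noteq> 0" for j
    using p(1)[of j] e(1)[of j] by auto
  define \<mu> where "\<mu> = lead_coeff (p k) / lead_coeff (e k)"
  define r where "r = p k - smult \<mu> (e k)"
  have r: "r = 0 \<or> degree r < k"
    using degree_diff_smult_less[of "p k" "e k"] p'[of k] e'[of k] by (auto simp: r_def \<mu>_def)
  have orth: "gip a b q r = 0" if "degree q < k" for q
    using gip_eq_0_of_degree_less[OF ab p', of k "p k" q] gip_eq_0_of_degree_less[OF ab e', of k "e k" q] p(2) e(2) that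
    by (simp add: r_def gip_diff_right[OF ab] gip_smult_right)
  have "r = 0"
  proof (rule ccontr)
    assume "r \<noteq> 0"
    define d where "d = degree r"
    have d: "d < k" using r \<open>r \<noteq> 0\<close> by (simp add: d_def)
    \<comment> \<open>Definiteness of the inner product is bypassed: pairing \<open>r\<close> with
      \<open>e d\<close> in its own degree \<open>d\<close> reads off the leading coefficient, since
      lower degrees do not contribute.\<close>
    define s where "s = r - smult (lead_coeff r / lead_coeff (e d)) (e d)"
    have s: "s = 0 \<or> degree s < d"
      using degree_diff_smult_less[of r "e d"] e'[of d] by (auto simp: s_def d_def)
    have "gip a b s (e d) = 0"
      using s gip_eq_0_of_degree_less[OF ab e', of d "e d" s] e(2) by auto
    then have "gip a b r (e d) = cnj (lead_coeff r / lead_coeff (e d))"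
      using gip_add_left[OF ab, of s "smult (lead_coeff r / lead_coeff (e d)) (e d)" "e d"] e(2)
      unfolding s_def diff_add_cancel \<open>gip a b s (e d) = 0\<close>[unfolded s_def] by (simp add: gip_smult_left)
    moreover have "gip a b r (e d) = 0"
      using orth[of "e d"] d e'[of d] by (metis complex_cnj_zero gip_cnj)
    moreover have "lead_coeff r / lead_coeff (e d) \<noteq> 0"
      using \<open>r \<noteq> 0\<close> e'[of d] by (metis divide_eq_0_iff leading_coeff_0_iff)
    ultimately show False by (metis complex_cnj_zero_iff)
  qed
  then have pk: "p k = smult \<mu> (e k)" by (simp add: r_def)
  obtain x y where xy: "lead_coeff (p k) = of_real x" "lead_coeff (e k) = of_real y"
    using p(1)[of k] e(1)[of k] by (meson Reals_cases)
  have pos: "x / y > 0" and \<mu>: "\<mu> = of_real (x / y)"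
    using p(1)[of k] e(1)[of k] xy by (auto simp: \<mu>_def)
  have "\<mu> * cnj \<mu> = 1"
    using p(2)[of k k] e(2)[of k k] by (simp add: pk gip_smult_left gip_smult_right)
  then have "complex_of_real ((x / y) * (x / y)) = 1"
    unfolding \<mu> by (simp only: complex_cnj_complex_of_real of_real_mult)
  then have "(x / y) * (x / y) = 1"
    by (simp only: of_real_eq_1_iff)
  then have "(x / y) ^ 2 = 1" by (simp only: power2_eq_square)
  then have "x / y = 1 \<or> x / y = - 1"
    by (simp only: power2_eq_1_iff)
  then have "x / y = 1" using pos by linarith
  then show "p k = e k" by (simp add: pk \<mu>)
qed

section \<open>The elliptic weight as an anisotropic Gaussian\<close>

lemma elliptic_potential_eq: "elliptic_potential t z = (1 - t) * (Re z)\<^sup>2 + (1 + t) * (Im z)\<^sup>2"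
  by (simp add: elliptic_potential_def cmod_power2) (simp add: power2_eq_square algebra_simps)

lemma t_sq: "0 < t \<Longrightarrow> t < 1 \<Longrightarrow> 1 - t\<^sup>2 > 0" for t :: real
  by (simp add: power_less_one_iff abs_square_less_1)

context
  fixes t :: real and n :: nat
  assumes t: "0 < t" "t < 1" and n: "n > 0"
begin

text \<open>The squared norm of the k-th rescaled Hermite polynomial, not the norm; its factors are
  those of \<open>gip_hpoly\<close> at the elliptic rates.\<close>

definition hnorm where "hnorm k = (1 / (n * (1 - t\<^sup>2))) ^ k * fact k * (pi / (n * sqrt (1 - t\<^sup>2)))"

lemma hnorm_pos: "hnorm k > 0"
  unfolding hnorm_def using t_sq[OF t] n by (intro mult_pos_pos divide_pos_pos zero_less_power) auto

lemma orthonormal_polys_iff_gip: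
  "orthonormal_polys (elliptic_potential t) n p \<longleftrightarrow>
     (\<forall>k. degree (p k) = k \<and> lead_coeff (p k) \<in> \<real> \<and> Re (lead_coeff (p k)) > 0) \<and>
     (\<forall>k l. gip (n * (1 - t)) (n * (1 + t)) (p k) (p l) = (if k = l then 1 else 0))"
proof -
  have w: "complex_of_real (exp (- real n * elliptic_potential t z)) = gweight (n * (1 - t)) (n * (1 + t)) z" for z
    by (simp add: gweight_def elliptic_potential_eq algebra_simps)
  have "has_bochner_integral lborel (\<lambda>z. cnj (poly (p k) z) * poly (p l) z * gweight (n * (1 - t)) (n * (1 + t)) z) x
     \<longleftrightarrow> gip (n * (1 - t)) (n * (1 + t)) (p k) (p l) = x" for k l x
    using gip_integrable[of "n * (1 - t)" "n * (1 + t)" "p k" "p l"] t n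
    by (auto simp: has_bochner_integral_iff gip_def)
  then show ?thesis
    unfolding orthonormal_polys_def w by simp
qed

lemma onp_elliptic:
  "onp (elliptic_potential t) n = (\<lambda>k. smult (of_real (1 / sqrt (hnorm k))) (hpoly (t / (n * (1 - t\<^sup>2))) k))"
    (is "_ = ?e")
proof -
  have ab: "n * (1 - t) > 0" "n * (1 + t) > 0" using t n by auto
  have c: "(1 / (n * (1 - t)) - 1 / (n * (1 + t))) / 2 = t / (n * (1 - t\<^sup>2))"
    and \<kappa>: "(1 / (n * (1 - t)) + 1 / (n * (1 + t))) / 2 = 1 / (n * (1 - t\<^sup>2))"
    and G: "sqrt (n * (1 - t) * (n * (1 + t))) = n * sqrt (1 - t\<^sup>2)"
  proof -
    have divide_frac: "(1 / (x * y) - 1 / (x * z)) / 2 = (z - y) / 2 / (x * (y * z))"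
        "(1 / (x * y) + 1 / (x * z)) / 2 = (z + y) / 2 / (x * (y * z))"
      if "x \<noteq> 0" "y \<noteq> 0" "z \<noteq> 0" for x y z :: real
      using that by (simp_all add: field_simps)
    have sq: "1 - t\<^sup>2 = (1 - t) * (1 + t)" by (simp add: power2_eq_square algebra_simps)
    show "(1 / (n * (1 - t)) - 1 / (n * (1 + t))) / 2 = t / (n * (1 - t\<^sup>2))"
      and "(1 / (n * (1 - t)) + 1 / (n * (1 + t))) / 2 = 1 / (n * (1 - t\<^sup>2))"
      using divide_frac[of n "1 - t" "1 + t"] t n unfolding sq by simp_all
    have "n * (1 - t) * (n * (1 + t)) = (real n)\<^sup>2 * (1 - t\<^sup>2)"
      unfolding sq by (simp add: power2_eq_square algebra_simps)
    then show "sqrt (n * (1 - t) * (n * (1 + t))) = n * sqrt (1 - t\<^sup>2)"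
      by (simp add: real_sqrt_mult)
  qed
  have on: "orthonormal_polys (elliptic_potential t) n ?e"
    unfolding orthonormal_polys_iff_gip
  proof safe
    fix k l
    have pos: "hnorm k > 0" for k by (rule hnorm_pos)
    show "degree (?e k) = k" "lead_coeff (?e k) \<in> \<real>" "Re (lead_coeff (?e k)) > 0"
      using hpoly_monic[of "t / (n * (1 - t\<^sup>2))" k] pos[of k] by auto
    show "gip (n * (1 - t)) (n * (1 + t)) (?e k) (?e l) = (if k = l then 1 else 0)"
    proof -
      have "gip (n * (1 - t)) (n * (1 + t)) (hpoly (t / (n * (1 - t\<^sup>2))) k) (hpoly (t / (n * (1 - t\<^sup>2))) l)
          = (if k = l then of_real (hnorm k) else 0)"
        using gip_hpoly[OF ab, unfolded c \<kappa> G, of k l]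
        by (cases "k = l") (simp_all only: hnorm_def if_True if_False refl)
      then show ?thesis
        using pos[of k] pos[of l] by (simp add: gip_smult_left gip_smult_right flip: of_real_mult)
    qed
  qed
  show ?thesis
    unfolding onp_def
  proof (rule the_equality, rule on)
    fix p assume "orthonormal_polys (elliptic_potential t) n p"
    then show "p = ?e"
      using on unfolding orthonormal_polys_iff_gip by (intro orthonormal_gip_unique[OF ab]) blast+
  qed
qed

text \<open>Real coefficients let the conjugation move to the point, so the sum is a polynomial in
  \<open>cnj w\<close> and \<open>z\<close>, the form required by Mehler's formula.\<close>

lemma kernel_elliptic:
  "kernel (elliptic_potential t) n w z =
     of_real (exp (- (real n / 2) * (elliptic_potential t w + elliptic_potential t z))) *
     (\<Sum>k<n. poly (hpoly (t / (n * (1 - t\<^sup>2))) k) (cnj w) * poly (hpoly (t / (n * (1 - t\<^sup>2))) k) z / of_real (hnorm k))"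
proof -
  have "cnj (poly (onp (elliptic_potential t) n k) w) * poly (onp (elliptic_potential t) n k) z =
     poly (hpoly (t / (n * (1 - t\<^sup>2))) k) (cnj w) * poly (hpoly (t / (n * (1 - t\<^sup>2))) k) z / of_real (hnorm k)" for k
    using hnorm_pos[of k] by (simp add: onp_elliptic poly_hpoly_cnj field_simps flip: of_real_mult)
  then show ?thesis by (simp add: kernel_def)
qed

end

section \<open>Mehler's formula\<close>

text \<open>The classical Mehler kernel at t \<rho>, with arguments divided by sqrt (t \<kappa>).
  Its singularities sit at \<rho> = 1 / t and \<rho> = -1 / t, so for 0 < t < 1 the point \<rho> = 1
  is regular.\<close>

definition mehler :: "real \<Rightarrow> real \<Rightarrow> complex \<Rightarrow> complex \<Rightarrow> complex \<Rightarrow> complex" where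
  "mehler t \<kappa> x y \<rho> = inverse (csqrt (1 - of_real t ^ 2 * \<rho>\<^sup>2)) *
     exp ((2 * x * y * \<rho> - (x\<^sup>2 + y\<^sup>2) * t * \<rho>\<^sup>2) / (2 * of_real \<kappa> * (1 - of_real t ^ 2 * \<rho>\<^sup>2)))"

definition hcoeff :: "real \<Rightarrow> real \<Rightarrow> complex \<Rightarrow> complex \<Rightarrow> nat \<Rightarrow> complex" where
  "hcoeff t \<kappa> x y k = poly (hpoly (t * \<kappa>) k) x * poly (hpoly (t * \<kappa>) k) y / (\<kappa> ^ k * fact k)"

text \<open>The real part is positive, so the principal square root in \<open>mehler\<close> meets
  no branch cut as long as t \<rho> has modulus below 1.\<close>

lemma one_minus_notin_nonpos_Reals:
  assumes "norm (of_real t * \<rho>) < 1"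
  shows "1 - of_real t ^ 2 * \<rho>\<^sup>2 \<notin> (\<real>\<^sub>\<le>\<^sub>0 :: complex set)"
proof -
  have "Re (of_real t ^ 2 * \<rho>\<^sup>2) \<le> norm ((of_real t * \<rho>) ^ 2)"
    by (metis complex_Re_le_cmod power_mult_distrib)
  also have "\<dots> < 1" using assms by (simp add: norm_power power_less_one_iff)
  finally have "Re (1 - of_real t ^ 2 * \<rho>\<^sup>2) > 0" by simp
  then show ?thesis by (auto simp: complex_nonpos_Reals_iff)
qed

lemma one_minus_nonzero:
  assumes "norm (of_real t * \<rho>) < 1"
  shows "1 - of_real t ^ 2 * \<rho>\<^sup>2 \<noteq> (0::complex)"
  using one_minus_notin_nonpos_Reals[OF assms] by auto

text \<open>The logarithmic derivative is rational in \<rho>. Clearing denominators gives a linear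
  equation with polynomial coefficients, which can be compared with one for power series.\<close>

lemma has_field_derivative_mehler:
  assumes "norm (of_real t * \<rho>) < 1" "\<kappa> \<noteq> 0"
  shows "(mehler t \<kappa> x y has_field_derivative
    mehler t \<kappa> x y \<rho> * (of_real t ^ 2 * \<kappa> * \<rho> * (1 - of_real t ^ 2 * \<rho>\<^sup>2) + (y - t * \<rho> * x) * (x - t * \<rho> * y)) / (\<kappa> * (1 - of_real t ^ 2 * \<rho>\<^sup>2)\<^sup>2)) (at \<rho>)"
proof -
  note nz = one_minus_nonzero[OF assms(1)] one_minus_notin_nonpos_Reals[OF assms(1)]
  define s where "s = csqrt (1 - of_real t ^ 2 * \<rho>\<^sup>2)"
  have s: "s ^ 2 = 1 - of_real t ^ 2 * \<rho>\<^sup>2" "s \<noteq> 0" using nz by (auto simp: s_def)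
  have 1: "((\<lambda>\<rho>. inverse (csqrt (1 - of_real t ^ 2 * \<rho>\<^sup>2))) has_field_derivative inverse s * (of_real t ^ 2 * \<rho> / (1 - of_real t ^ 2 * \<rho>\<^sup>2))) (at \<rho>)"
  proof -
    have "((\<lambda>\<rho>. 1 - of_real t ^ 2 * \<rho>\<^sup>2) has_field_derivative (- (2 * of_real t ^ 2 * \<rho>))) (at \<rho>)"
      by (auto intro!: derivative_eq_intros)
    from DERIV_chain2[OF has_field_derivative_csqrt[OF nz(2)] this]
    have "((\<lambda>\<rho>. csqrt (1 - of_real t ^ 2 * \<rho>\<^sup>2)) has_field_derivative (inverse (2 * s) * (- (2 * of_real t ^ 2 * \<rho>)))) (at \<rho>)"
      by (simp add: s_def)
    from DERIV_inverse'[OF this] s(2) have "((\<lambda>\<rho>. inverse (csqrt (1 - of_real t ^ 2 * \<rho>\<^sup>2))) has_field_derivative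
        - (inverse s * (inverse (2 * s) * (- (2 * of_real t ^ 2 * \<rho>))) * inverse s)) (at \<rho>)"
      unfolding s_def by simp
    then show ?thesis
      by (rule DERIV_cong) (unfold s(1)[symmetric], use s(2) in \<open>simp add: field_simps power2_eq_square\<close>)
  qed
  have 2: "((\<lambda>\<rho>. (2 * x * y * \<rho> - (x\<^sup>2 + y\<^sup>2) * t * \<rho>\<^sup>2) / (2 * of_real \<kappa> * (1 - of_real t ^ 2 * \<rho>\<^sup>2))) has_field_derivative
       ((y - t * \<rho> * x) * (x - t * \<rho> * y)) / (\<kappa> * (1 - of_real t ^ 2 * \<rho>\<^sup>2)\<^sup>2)) (at \<rho>)"
    using nz assms(2)
    by (auto intro!: derivative_eq_intros simp: divide_simps) (simp add: algebra_simps power2_eq_square)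
  have alg: "i * (T * \<rho> / q) * e + e * (p / (k * q\<^sup>2)) * i = i * e * (T * k * \<rho> * q + p) / (k * q\<^sup>2)"
    if "q \<noteq> 0" "k \<noteq> 0" for i T q e p k :: complex
    using that by (simp add: field_simps power2_eq_square)
  show ?thesis
    unfolding mehler_def[abs_def]
    by (rule DERIV_cong[OF DERIV_mult[OF 1[unfolded s_def] DERIV_chain2[where f = exp, OF DERIV_exp 2]]],
        rule alg) (use nz assms(2) in auto)
qed

lemma mehler_holomorphic:
  assumes "0 < t" "\<kappa> \<noteq> 0"
  shows "mehler t \<kappa> x y holomorphic_on eball 0 (ereal (1 / t))"
proof -
  have "norm (of_real t * \<rho>) < 1" if "\<rho> \<in> eball 0 (ereal (1 / t))" for \<rho> :: complex
    using that assms by (simp add: norm_mult field_simps dist_norm)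
  then show ?thesis
    unfolding holomorphic_on_def field_differentiable_def
    using has_field_derivative_mehler[OF _ assms(2)] has_field_derivative_at_within by blast
qed

text \<open>A Wronskian argument: the quotient \<open>A * inverse F\<close> has derivative zero and
  constant term 1.\<close>

lemma fps_ode_unique:
  fixes A F q l :: "complex fps"
  assumes "q * fps_deriv A = l * A" "q * fps_deriv F = l * F" "q \<noteq> 0"
    and "fps_nth A 0 = 1" "fps_nth F 0 = 1"
  shows "A = F"
proof -
  have inv: "F * inverse F = 1"
    using assms(5) inverse_mult_eq_1[of F] by (simp add: mult.commute)
  have "q * (fps_deriv A * F - A * fps_deriv F) = 0"
    using assms(1,2) by algebra
  then have W: "fps_deriv A * F = A * fps_deriv F" using assms(3) by simp
  have "fps_deriv (A * inverse F) = A * (- fps_deriv F * (inverse F)\<^sup>2) + fps_deriv A * inverse F"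
    by (simp add: fps_inverse_deriv assms(5))
  also have "\<dots> = 0" using W inv by algebra
  finally have "A * inverse F = fps_const (fps_nth (A * inverse F) 0)"
    by (simp only: fps_deriv_eq_0_iff)
  then have "A * inverse F = 1" using assms(4,5) by simp
  then show ?thesis using inv by (metis mult.assoc mult.commute mult.right_neutral)
qed

lemma hcoeff_fps_ode:
  fixes t \<kappa> :: real and x y :: complex
  assumes "\<kappa> \<noteq> 0"
  defines "A \<equiv> Abs_fps (hcoeff t \<kappa> x y)"
  shows "fps_const (of_real \<kappa>) * (1 - fps_const (of_real t ^ 2) * fps_X\<^sup>2)\<^sup>2 * fps_deriv A =
    (fps_const (of_real t ^ 2 * of_real \<kappa>) * fps_X * (1 - fps_const (of_real t ^ 2) * fps_X\<^sup>2)
      + (fps_const y - fps_const (of_real t * x) * fps_X) * (fps_const x - fps_const (of_real t * y) * fps_X)) * A"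
proof -
  define h where "h k z = poly (hpoly (t * \<kappa>) k) z" for k z
  have h0: "h 0 z = 1" and h1: "h (Suc 0) z = z" for z by (simp_all add: h_def)
  have hS: "h (Suc (Suc k)) z = z * h (Suc k) z - of_real t * of_real \<kappa> * of_nat (Suc k) * h k z" for k z
    unfolding h_def poly_hpoly_Suc_Suc by simp
  define w :: "nat \<Rightarrow> complex" where "w k = 1 / (of_real \<kappa> ^ k * fact k)" for k
  have w0: "w 0 = 1" by (simp add: w_def)
  have wS: "w k = of_nat (Suc k) * (of_real \<kappa> * w (Suc k))" for k
    using assms(1) unfolding w_def by (simp add: fact_Suc del: of_nat_Suc)
  have A: "A = Abs_fps (\<lambda>k. h k x * h k y * w k)"
    by (rule fps_ext) (simp add: A_def hcoeff_def h_def w_def)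
  \<comment> \<open>The index-shifted series \<open>B\<close> and \<open>C\<close> turn the three-term recurrence into a linear system.\<close>
  define B where "B = Abs_fps (\<lambda>k. h (Suc k) x * h k y * w k)"
  define C where "C = Abs_fps (\<lambda>k. h k x * h (Suc k) y * w k)"
  have BC: "B = fps_const x * A - fps_const (of_real t) * fps_X * C"
  proof (rule fps_ext)
    fix k show "fps_nth B k = fps_nth (fps_const x * A - fps_const (of_real t) * fps_X * C) k"
    proof (cases k)
      case (Suc m)
      then show ?thesis
        by (simp add: A B_def C_def hS mult.assoc wS[of m]) (simp add: algebra_simps)
    qed (simp add: A B_def C_def h0 h1 w0 mult.assoc)
  qed
  have CB: "C = fps_const y * A - fps_const (of_real t) * fps_X * B"
  proof (rule fps_ext)
    fix k show "fps_nth C k = fps_nth (fps_const y * A - fps_const (of_real t) * fps_X * B) k"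
    proof (cases k)
      case (Suc m)
      then show ?thesis
        by (simp add: A B_def C_def hS mult.assoc wS[of m]) (simp add: algebra_simps)
    qed (simp add: A B_def C_def h0 h1 w0 mult.assoc)
  qed
  \<comment> \<open>Each coefficient on the left is a product of two polynomials with raised index;
    the recurrence is applied in y and in x. The surviving factor m + 1 on the coefficient of
    \<open>A\<close> is what \<open>A + fps_X * fps_deriv A\<close> encodes.\<close>
  have D: "fps_const (of_real \<kappa>) * fps_deriv A = fps_const y * B - fps_const (of_real t * x) * fps_X * B
      + fps_const (of_real t ^ 2 * of_real \<kappa>) * fps_X * (A + fps_X * fps_deriv A)"
  proof (rule fps_ext)
    fix k show "fps_nth (fps_const (of_real \<kappa>) * fps_deriv A) k = fps_nth (fps_const y * B - fps_const (of_real t * x) * fps_X * B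
      + fps_const (of_real t ^ 2 * of_real \<kappa>) * fps_X * (A + fps_X * fps_deriv A)) k"
    proof (cases k)
      case 0
      then show ?thesis using wS[of 0] by (simp add: A B_def h0 h1 w0 mult.assoc)
    next
      case (Suc m)
      have L: "fps_nth (fps_const (of_real \<kappa>) * fps_deriv A) (Suc m) = h (Suc (Suc m)) x * h (Suc (Suc m)) y * w (Suc m)"
        by (simp add: A wS[of "Suc m"] del: of_nat_Suc)
      have "fps_nth (fps_X * fps_deriv A) m = of_nat m * fps_nth A m"
        by (cases m) auto
      then have R: "fps_nth (fps_const y * B - fps_const (of_real t * x) * fps_X * B
          + fps_const (of_real t ^ 2 * of_real \<kappa>) * fps_X * (A + fps_X * fps_deriv A)) (Suc m)
        = y * (h (Suc (Suc m)) x * h (Suc m) y * w (Suc m)) - of_real t * x * (h (Suc m) x * h m y * w m)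
          + of_real t ^ 2 * of_real \<kappa> * (of_nat (Suc m) * (h m x * h m y * w m))"
        by (simp add: mult.assoc) (simp add: A B_def algebra_simps)
      show ?thesis
        unfolding Suc L R hS wS[of m] by algebra
    qed
  qed
  have c: "fps_const (of_real t ^ 2) = fps_const (of_real t :: complex) ^ 2"
    "fps_const (of_real t * x) = fps_const (of_real t) * fps_const x"
    "fps_const (of_real t * y) = fps_const (of_real t) * fps_const y"
    "fps_const (of_real t ^ 2 * of_real \<kappa>) = fps_const (of_real t :: complex) ^ 2 * fps_const (of_real \<kappa>)"
    by (simp_all add: power2_eq_square)
  \<comment> \<open>Solving the two shifted relations gives (1 - t^2 X^2) B = (x - t y X) A;
    substituting this into \<open>D\<close>, multiplied by 1 - t^2 X^2, leaves \<open>A\<close>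
    alone.\<close>
  show ?thesis using BC CB D unfolding c by algebra
qed

text \<open>\<open>mehler\<close> and the coefficient series solve the same equation with value 1 at
  0; for \<open>mehler\<close> the pointwise equation near 0 is read as one between power
  series.\<close>

theorem mehler_has_fps_expansion:
  assumes t: "0 < t" and \<kappa>: "\<kappa> \<noteq> 0"
  shows "mehler t \<kappa> x y has_fps_expansion Abs_fps (hcoeff t \<kappa> x y)"
proof -
  let ?F = "mehler t \<kappa> x y"
  define F where "F = fps_expansion ?F 0"
  have op: "open (eball (0::complex) (ereal (1 / t)))" "0 \<in> eball (0::complex) (ereal (1 / t))"
    using t by (auto simp: zero_ereal_def)
  have F: "?F has_fps_expansion F"
    unfolding F_def using op mehler_holomorphic[OF t \<kappa>] by blast
  let ?q = "fps_const (of_real \<kappa> :: complex) * (1 - fps_const (of_real t ^ 2) * fps_X\<^sup>2)\<^sup>2"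
  let ?l = "fps_const (of_real t ^ 2 * of_real \<kappa>) * fps_X * (1 - fps_const (of_real t ^ 2) * fps_X\<^sup>2)
      + (fps_const y - fps_const (of_real t * x) * fps_X) * (fps_const x - fps_const (of_real t * y) * fps_X)"
  have L: "(\<lambda>\<rho>::complex. \<kappa> * (1 - of_real t ^ 2 * \<rho>\<^sup>2)\<^sup>2 * deriv ?F \<rho>) has_fps_expansion ?q * fps_deriv F"
    by (intro fps_expansion_intros F)
  have R: "(\<lambda>\<rho>. (of_real t ^ 2 * of_real \<kappa> * \<rho> * (1 - of_real t ^ 2 * \<rho>\<^sup>2) + (y - of_real t * x * \<rho>) * (x - of_real t * y * \<rho>)) * ?F \<rho>) has_fps_expansion ?l * F"
    by (intro fps_expansion_intros F)
  have ev: "eventually (\<lambda>\<rho>::complex. \<kappa> * (1 - of_real t ^ 2 * \<rho>\<^sup>2)\<^sup>2 * deriv ?F \<rho> = (of_real t ^ 2 * of_real \<kappa> * \<rho> * (1 - of_real t ^ 2 * \<rho>\<^sup>2) + (y - of_real t * x * \<rho>) * (x - of_real t * y * \<rho>)) * ?F \<rho>) (nhds 0)"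
    using eventually_nhds_in_open[OF op]
  proof eventually_elim
    case (elim \<rho>)
    then have n: "norm (of_real t * \<rho>) < 1" using t by (simp add: norm_mult field_simps dist_norm)
    show ?case
      using one_minus_nonzero[OF n] \<kappa>
      by (subst DERIV_imp_deriv[OF has_field_derivative_mehler[OF n \<kappa>]]) (simp add: mult_ac)
  qed
  have "?q * fps_deriv F = ?l * F"
    using fps_expansion_unique_complex[OF L] R has_fps_expansion_cong[OF ev refl] by blast
  moreover have "?q \<noteq> 0"
  proof -
    have "fps_nth (1 - fps_const (of_real t ^ 2 :: complex) * fps_X\<^sup>2) 0 = 1" by simp
    then have "1 - fps_const (of_real t ^ 2 :: complex) * fps_X\<^sup>2 \<noteq> 0" by (metis fps_zero_nth zero_neq_one)
    then show ?thesis
      using \<kappa> by (intro no_zero_divisors) (auto simp only: power_eq_0_iff fps_const_eq_0_iff of_real_eq_0_iff)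
  qed
  moreover have "fps_nth F 0 = 1"
    using F[THEN has_fps_expansion_imp_0_eq_fps_nth_0] by (simp add: mehler_def)
  moreover have "fps_nth (Abs_fps (hcoeff t \<kappa> x y)) 0 = 1"
    by (simp add: hcoeff_def)
  ultimately have "Abs_fps (hcoeff t \<kappa> x y) = F"
    using fps_ode_unique[OF hcoeff_fps_ode[OF \<kappa>, of t x y]] by blast
  then show ?thesis using F by simp
qed

text \<open>Holomorphy, rather than growth estimates for the coefficients, yields convergence up to
  radius 1 / t. For t < 1 this covers \<rho> = 1 and some r > 1, the values used for the full series
  and for the tail bound.\<close>

lemma mehler_sums:
  assumes "0 < t" "\<kappa> \<noteq> 0" "norm \<rho> < 1 / t"
  shows "(\<lambda>k. hcoeff t \<kappa> x y k * \<rho> ^ k) sums mehler t \<kappa> x y \<rho>"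
  using has_fps_expansion_imp_sums_complex[OF mehler_has_fps_expansion[OF assms(1,2)] mehler_holomorphic[OF assms(1,2)], of \<rho>]
    assms(3) by simp

section \<open>Interior and exterior of the ellipse\<close>

text \<open>The constant \<kappa> of \<open>gip_hpoly\<close> at the elliptic rates;
  \<open>t * kap t n\<close> is the Hermite parameter.\<close>

definition kap :: "real \<Rightarrow> nat \<Rightarrow> real" where
  "kap t n = 1 / (n * (1 - t\<^sup>2))"

lemma kap_pos: "0 < t \<Longrightarrow> t < 1 \<Longrightarrow> n > 0 \<Longrightarrow> kap t n > 0"
  using t_sq[of t] by (simp add: kap_def)

lemma kernel_eq_hcoeff:
  assumes "0 < t" "t < 1" "n > 0"
  shows "kernel (elliptic_potential t) n w z / of_nat n =
    of_real (sqrt (1 - t\<^sup>2) / pi * exp (- (real n / 2) * (elliptic_potential t w + elliptic_potential t z)))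
      * (\<Sum>k<n. hcoeff t (kap t n) (cnj w) z k)"
proof -
  have "poly (hpoly (t / (n * (1 - t\<^sup>2))) k) (cnj w) * poly (hpoly (t / (n * (1 - t\<^sup>2))) k) z / of_real (hnorm t n k)
      = of_real (n * sqrt (1 - t\<^sup>2) / pi) * hcoeff t (kap t n) (cnj w) z k" for k
  proof -
    have c: "t / (n * (1 - t\<^sup>2)) = t * kap t n" by (simp add: kap_def)
    have h: "hnorm t n k = kap t n ^ k * fact k * (pi / (n * sqrt (1 - t\<^sup>2)))"
      using assms by (simp add: hnorm_def kap_def)
    show ?thesis
      unfolding c h hcoeff_def using assms t_sq[of t] by (simp add: field_simps)
  qed
  then have "(\<Sum>k<n. poly (hpoly (t / (n * (1 - t\<^sup>2))) k) (cnj w) * poly (hpoly (t / (n * (1 - t\<^sup>2))) k) z / of_real (hnorm t n k))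
      = of_real (n * sqrt (1 - t\<^sup>2) / pi) * (\<Sum>k<n. hcoeff t (kap t n) (cnj w) z k)"
    by (simp only: sum_distrib_left)
  then show ?thesis
    using assms by (simp add: kernel_elliptic)
qed

text \<open>The diagonal terms with the weight included. By \<open>wcoeff_sums\<close> at r = 1
  their total is 1 / sqrt (1 - t^2), independent of \<open>z\<close> and \<open>n\<close>.\<close>

definition wcoeff :: "real \<Rightarrow> nat \<Rightarrow> complex \<Rightarrow> nat \<Rightarrow> real" where
  "wcoeff t n z k = exp (- real n * elliptic_potential t z) *
     ((cmod (poly (hpoly (t * kap t n) k) z))\<^sup>2 / (kap t n ^ k * fact k))"

text \<open>For a tilt r, \<open>n * rate t z r\<close> is the exponent in the generating function
  of \<open>wcoeff\<close> after division by r^n, that is, the Chernoff exponent for a cut at index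
  n. The algebraic prefactor is left out.\<close>

definition rate :: "real \<Rightarrow> complex \<Rightarrow> real \<Rightarrow> real" where
  "rate t z r = (1 - t\<^sup>2) * r * ((Re z)\<^sup>2 / (1 + t * r) + (Im z)\<^sup>2 / (1 - t * r)) - elliptic_potential t z - ln r"

section \<open>Exponential bounds for head and tail\<close>

context
  fixes t :: real
  assumes t: "0 < t" "t < 1"
begin

lemma wcoeff_nonneg: "n > 0 \<Longrightarrow> wcoeff t n z k \<ge> 0"
  using kap_pos[OF t, of n] by (simp add: wcoeff_def)

text \<open>The term of index k is a product of one factor from each point, so the
  arithmetic-geometric mean inequality bounds it by the two diagonal terms.\<close>

lemma norm_hcoeff_le:
  assumes "n > 0"
  shows "norm (of_real (exp (- (real n / 2) * (elliptic_potential t w + elliptic_potential t z))) * hcoeff t (kap t n) (cnj w) z k)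
     \<le> (wcoeff t n w k + wcoeff t n z k) / 2"
proof -
  define f where "f v = exp (- (real n / 2) * elliptic_potential t v) * cmod (poly (hpoly (t * kap t n) k) v)" for v
  define d where "d = kap t n ^ k * fact k"
  have d: "d > 0" using kap_pos[OF t assms] by (simp add: d_def)
  have f2: "wcoeff t n v k = (f v)\<^sup>2 / d" for v
    by (simp add: wcoeff_def f_def d_def power_mult_distrib flip: exp_double)
  have "norm (of_real (exp (- (real n / 2) * (elliptic_potential t w + elliptic_potential t z))) * hcoeff t (kap t n) (cnj w) z k)
      = f w * f z / d"
  proof -
    have "exp (- (real n / 2) * (elliptic_potential t w + elliptic_potential t z))
        = exp (- (real n / 2) * elliptic_potential t w) * exp (- (real n / 2) * elliptic_potential t z)"
      by (simp only: distrib_left exp_add)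
    then show ?thesis
      using kap_pos[OF t assms]
      by (simp add: hcoeff_def norm_mult norm_divide norm_power poly_hpoly_cnj f_def d_def)
  qed
  also have "\<dots> \<le> ((f w)\<^sup>2 + (f z)\<^sup>2) / 2 / d"
    using sum_squares_bound[of "f w" "f z"] d by (intro divide_right_mono) auto
  finally show ?thesis by (simp add: f2 add_divide_distrib)
qed

text \<open>At conjugate arguments and real r the exponent in Mehler's formula is real and splits
  into the squares of \<open>Re z\<close> and \<open>Im z\<close>. The factor r^n is made explicit
  so that a cut at index n can be compared with it directly.\<close>

lemma wcoeff_sums:
  assumes n: "n > 0" and r: "0 < r" "r < 1 / t"
  shows "(\<lambda>k. wcoeff t n z k * r ^ k) sums (r ^ n * exp (n * rate t z r) / sqrt (1 - (t * r)\<^sup>2))"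
proof -
  have tr: "0 < t * r" "t * r < 1" using t r by (auto simp: field_simps)
  have trsq: "(t * r)\<^sup>2 < 1" using tr by (simp add: power_less_one_iff abs_square_less_1)
  have fac: "1 - (t * r)\<^sup>2 = (1 + t * r) * (1 - t * r)" by (simp add: power2_eq_square algebra_simps)
  have S: "(\<lambda>k. hcoeff t (kap t n) (cnj z) z k * of_real r ^ k) sums mehler t (kap t n) (cnj z) z (of_real r)"
    using kap_pos[OF t n] r t by (intro mehler_sums) auto
  have H: "hcoeff t (kap t n) (cnj z) z k = of_real ((cmod (poly (hpoly (t * kap t n) k) z))\<^sup>2 / (kap t n ^ k * fact k))" for k
    by (simp add: hcoeff_def poly_hpoly_cnj complex_norm_square[symmetric] mult.commute flip: of_real_power)
  define e where "e = n * ((1 - t\<^sup>2) * r * ((Re z)\<^sup>2 / (1 + t * r) + (Im z)\<^sup>2 / (1 - t * r)))"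
  have exponent: "(2 * cnj z * z * of_real r - ((cnj z)\<^sup>2 + z\<^sup>2) * of_real t * (of_real r)\<^sup>2) / (2 * of_real (kap t n) * (1 - of_real t ^ 2 * (of_real r)\<^sup>2)) = of_real e"
  proof -
    have 1: "2 * cnj z * z * of_real r - ((cnj z)\<^sup>2 + z\<^sup>2) * of_real t * (of_real r)\<^sup>2
        = of_real (2 * ((Re z)\<^sup>2 + (Im z)\<^sup>2) * r - 2 * ((Re z)\<^sup>2 - (Im z)\<^sup>2) * t * r\<^sup>2)"
      by (simp add: complex_eq_iff power2_eq_square algebra_simps)
    have 2: "2 * of_real (kap t n) * (1 - of_real t ^ 2 * (of_real r)\<^sup>2) = complex_of_real (2 * kap t n * (1 - (t * r)\<^sup>2))"
      by (simp add: power_mult_distrib)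
    have "(2 * ((Re z)\<^sup>2 + (Im z)\<^sup>2) * r - 2 * ((Re z)\<^sup>2 - (Im z)\<^sup>2) * t * r\<^sup>2) / (2 * kap t n * (1 - (t * r)\<^sup>2)) = e"
    proof -
      have "(2 * ((Re z)\<^sup>2 + (Im z)\<^sup>2) * r - 2 * ((Re z)\<^sup>2 - (Im z)\<^sup>2) * t * r\<^sup>2)
         = 2 * r * ((Re z)\<^sup>2 * (1 - t * r) + (Im z)\<^sup>2 * (1 + t * r))"
        by (simp add: power2_eq_square algebra_simps)
      then show ?thesis
        unfolding e_def fac kap_def using tr n t_sq[OF t] by (simp add: divide_simps)
    qed
    then show ?thesis unfolding 1 2 by (simp only: of_real_divide[symmetric])
  qed
  have M: "mehler t (kap t n) (cnj z) z (of_real r) = of_real (exp e / sqrt (1 - (t * r)\<^sup>2))"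
  proof -
    have "csqrt (1 - of_real t ^ 2 * (of_real r)\<^sup>2) = of_real (sqrt (1 - (t * r)\<^sup>2))"
    proof -
      have "1 - of_real t ^ 2 * (of_real r)\<^sup>2 = complex_of_real (1 - (t * r)\<^sup>2)"
        by (simp add: power_mult_distrib)
      moreover have "csqrt (complex_of_real (1 - (t * r)\<^sup>2)) = of_real (sqrt (1 - (t * r)\<^sup>2))"
        using trsq by (subst csqrt_of_real_nonneg) (auto simp flip: of_real_power)
      ultimately show ?thesis by (simp only:)
    qed
    then show ?thesis
      unfolding mehler_def by (simp only: exponent) (simp add: exp_of_real field_simps)
  qed
  have "(\<lambda>k. (cmod (poly (hpoly (t * kap t n) k) z))\<^sup>2 / (kap t n ^ k * fact k) * r ^ k) sums (exp e / sqrt (1 - (t * r)\<^sup>2))"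
    using S unfolding H M by (simp only: of_real_power[symmetric] of_real_mult[symmetric] sums_of_real_iff)
  from sums_mult[OF this, of "exp (- real n * elliptic_potential t z)"]
  have "(\<lambda>k. wcoeff t n z k * r ^ k) sums (exp (- real n * elliptic_potential t z) * (exp e / sqrt (1 - (t * r)\<^sup>2)))"
    by (simp add: wcoeff_def mult.assoc)
  moreover have "exp (- real n * elliptic_potential t z) * exp e = r ^ n * exp (n * rate t z r)"
  proof -
    have "r ^ n = exp (n * ln r)" using r by (simp add: exp_of_nat_mult)
    then show ?thesis by (simp add: e_def rate_def algebra_simps flip: exp_add)
  qed
  ultimately show ?thesis by (simp add: mult.assoc[symmetric])
qed

lemma wcoeff_summable: "n > 0 \<Longrightarrow> summable (wcoeff t n z)"
  using wcoeff_sums[of n 1 z] t by (auto simp: sums_iff)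

lemma wcoeff_tail_le:
  assumes n: "n > 0" and r: "1 \<le> r" "r < 1 / t"
  shows "(\<Sum>k. wcoeff t n z (k + n)) \<le> exp (n * rate t z r) / sqrt (1 - (t * r)\<^sup>2)"
proof -
  have r0: "r > 0" using r by simp
  note S = wcoeff_sums[OF n r0 r(2), of z]
  have "r ^ n * (\<Sum>k. wcoeff t n z (k + n)) = (\<Sum>k. r ^ n * wcoeff t n z (k + n))"
    using wcoeff_summable[OF n] by (intro suminf_mult[symmetric]) (simp add: summable_iff_shift)
  also have "\<dots> \<le> (\<Sum>k. wcoeff t n z (k + n) * r ^ (k + n))"
  proof (rule suminf_le)
    fix k show "r ^ n * wcoeff t n z (k + n) \<le> wcoeff t n z (k + n) * r ^ (k + n)"
      using wcoeff_nonneg[OF n] r by (subst mult.commute) (intro mult_left_mono power_increasing, auto)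
  qed (use S wcoeff_summable[OF n] summable_iff_shift[of "\<lambda>k. wcoeff t n z k * r ^ k" n] in \<open>auto simp: sums_iff summable_iff_shift intro!: summable_mult\<close>)
  also have "\<dots> \<le> (\<Sum>k. wcoeff t n z k * r ^ k)"
    using S wcoeff_nonneg[OF n] r
    by (subst (2) suminf_split_initial_segment[of _ n]) (auto simp: sums_iff intro!: sum_nonneg)
  also have "\<dots> = r ^ n * (exp (n * rate t z r) / sqrt (1 - (t * r)\<^sup>2))"
    using S by (simp add: sums_iff)
  finally show ?thesis by (rule mult_left_le_imp_le) (use r0 in simp)
qed

lemma wcoeff_head_le:
  assumes n: "n > 0" and r: "0 < r" "r \<le> 1"
  shows "(\<Sum>k<n. wcoeff t n z k) \<le> exp (n * rate t z r) / sqrt (1 - (t * r)\<^sup>2)"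
proof -
  have "t * r \<le> t * 1" using r t by (intro mult_left_mono) auto
  then have "t * r < 1" using t by linarith
  then have r1: "r < 1 / t" using t by (simp add: field_simps)
  note S = wcoeff_sums[OF n r(1) r1, of z]
  have "r ^ n * (\<Sum>k<n. wcoeff t n z k) = (\<Sum>k<n. r ^ n * wcoeff t n z k)"
    by (simp add: sum_distrib_left)
  also have "\<dots> \<le> (\<Sum>k<n. wcoeff t n z k * r ^ k)"
    using wcoeff_nonneg[OF n] r by (intro sum_mono, subst mult.commute) (intro mult_left_mono power_decreasing, auto)
  also have "\<dots> \<le> (\<Sum>k. wcoeff t n z k * r ^ k)"
    using S wcoeff_nonneg[OF n] r by (intro sum_le_suminf) (auto simp: sums_iff)
  also have "\<dots> = r ^ n * (exp (n * rate t z r) / sqrt (1 - (t * r)\<^sup>2))"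
    using S by (simp add: sums_iff)
  finally show ?thesis by (rule mult_left_le_imp_le) (use r in simp)
qed

lemma ellipse_form_eq: "ellipse_form t z = (Re z)\<^sup>2 * (1 - t) / (1 + t) + (Im z)\<^sup>2 * (1 + t) / (1 - t)"
  using t by (simp add: ellipse_form_def semi_a_def semi_b_def)

lemma rate_deriv: "(rate t z has_real_derivative (ellipse_form t z - 1)) (at 1)"
proof -
  have alg: "(1 - t\<^sup>2) * (x / (1 + t) + y / (1 - t)) + (y * t / (1 - t)\<^sup>2 - x * t / (1 + t)\<^sup>2) * (1 - t\<^sup>2)
      = x * (1 - t) / (1 + t) + y * (1 + t) / (1 - t)" for x y
  proof -
    have 1: "(1 - t\<^sup>2) * (x / (1 + t) - x * t / (1 + t)\<^sup>2) = x * (1 - t) / (1 + t)"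
      using t by (simp add: power2_eq_square divide_simps) (simp add: algebra_simps)
    have 2: "(1 - t\<^sup>2) * (y / (1 - t) + y * t / (1 - t)\<^sup>2) = y * (1 + t) / (1 - t)"
      using t by (simp add: power2_eq_square divide_simps) (simp add: algebra_simps)
    have gen: "q * (a + d) + (e - b) * q = q * (a - b) + q * (d + e)" for q a b d e :: real
      by (simp add: algebra_simps)
    show ?thesis by (subst gen) (simp only: 1 2)
  qed
  show ?thesis
    unfolding rate_def[abs_def] ellipse_form_eq
    using t alg[of "(Re z)\<^sup>2" "(Im z)\<^sup>2"]
    by (auto intro!: derivative_eq_intros simp: power2_eq_square)
qed

lemma rate_1: "rate t z 1 = 0"
proof -
  have "(1 - t\<^sup>2) * (x / (1 + t)) = (1 - t) * x" "(1 - t\<^sup>2) * (x / (1 - t)) = (1 + t) * x" for x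
    using t by (simp_all add: power2_eq_square field_simps)
  then show ?thesis by (simp add: rate_def elliptic_potential_eq distrib_left)
qed

lemma rate_neg_inside:
  assumes "z \<in> inside_ellipse t"
  shows "\<exists>r>1. r < 1 / t \<and> rate t z r < 0"
proof -
  have "ellipse_form t z - 1 < 0" using assms by (simp add: inside_ellipse_def)
  from DERIV_neg_dec_right[OF rate_deriv this] obtain d where d: "d > 0" "\<And>h. h > 0 \<Longrightarrow> h < d \<Longrightarrow> rate t z (1 + h) < rate t z 1"
    by auto
  \<comment> \<open>Halving keeps 1 + h strictly below 1 / t, where the generating function is
    available.\<close>
  define h where "h = min d (1 / t - 1) / 2"
  have "1 / t > 1" using t by simp
  then have "h > 0" "h < d" "1 + h < 1 / t" using d by (auto simp: h_def min_def field_simps)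
  then show ?thesis using d(2)[of h] rate_1[of z] by (intro exI[of _ "1 + h"]) auto
qed

lemma rate_neg_outside:
  assumes "z \<in> outside_ellipse t"
  shows "\<exists>r>0. r < 1 \<and> rate t z r < 0"
proof -
  have "ellipse_form t z - 1 > 0" using assms by (simp add: outside_ellipse_def)
  from DERIV_pos_inc_left[OF rate_deriv this] obtain d where d: "d > 0" "\<And>h. h > 0 \<Longrightarrow> h < d \<Longrightarrow> rate t z (1 - h) < rate t z 1"
    by auto
  define h where "h = min d 1 / 2"
  have "h > 0" "h < d" "h < 1" using d by (auto simp: h_def min_def)
  then show ?thesis using d(2)[of h] rate_1[of z] by (intro exI[of _ "1 - h"]) auto
qed

text \<open>The tilt r is fixed at the limit point; continuity of the exponent in the point carries
  its sign over to the nearby points \<open>z n\<close>.\<close>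

lemma tendsto_exp_rate:
  assumes "rate t z0 r < 0" "z \<longlonglongrightarrow> z0"
  shows "(\<lambda>n. exp (n * rate t (z n) r) / C) \<longlonglongrightarrow> 0"
proof -
  have "(\<lambda>n. rate t (z n) r) \<longlonglongrightarrow> rate t z0 r"
    unfolding rate_def elliptic_potential_eq divide_inverse by (intro tendsto_intros assms)
  then have "filterlim (\<lambda>n. rate t (z n) r * real n) at_bot sequentially"
    using assms(1) by (rule filterlim_tendsto_neg_mult_at_bot[OF _ _ filterlim_real_sequentially])
  then have "filterlim (\<lambda>n. real n * rate t (z n) r) at_bot sequentially" by (simp add: mult.commute)
  then have "(\<lambda>n. exp (real n * rate t (z n) r)) \<longlonglongrightarrow> 0"
    by (rule filterlim_compose[OF exp_at_bot])
  then show ?thesis by (intro tendsto_divide_zero)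
qed

lemma kernel_outside:
  assumes "z0 \<in> outside_ellipse t" "w \<longlonglongrightarrow> z0" "z \<longlonglongrightarrow> z0"
  shows "(\<lambda>n. kernel (elliptic_potential t) n (w n) (z n) / of_nat n) \<longlonglongrightarrow> 0"
proof -
  obtain r where r: "0 < r" "r < 1" "rate t z0 r < 0" using rate_neg_outside[OF assms(1)] by auto
  let ?b = "\<lambda>z n. exp (real n * rate t (z n) r) / sqrt (1 - (t * r)\<^sup>2)"
  have "(\<lambda>n. sqrt (1 - t\<^sup>2) / pi * ((?b w n + ?b z n) / 2)) \<longlonglongrightarrow> sqrt (1 - t\<^sup>2) / pi * ((0 + 0) / 2)"
    by (intro tendsto_intros tendsto_exp_rate[OF r(3)] assms) simp_all
  then have lim: "(\<lambda>n. sqrt (1 - t\<^sup>2) / pi * ((?b w n + ?b z n) / 2)) \<longlonglongrightarrow> 0" by simp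
  show ?thesis
  proof (rule Lim_null_comparison[OF _ lim], rule eventually_mono[OF eventually_gt_at_top[of 0]])
    fix n :: nat assume n: "n > 0"
    let ?e = "exp (- (real n / 2) * (elliptic_potential t (w n) + elliptic_potential t (z n)))"
    have "norm (\<Sum>k<n. of_real ?e * hcoeff t (kap t n) (cnj (w n)) (z n) k) \<le> (\<Sum>k<n. (wcoeff t n (w n) k + wcoeff t n (z n) k) / 2)"
      using norm_hcoeff_le[OF n] by (rule sum_norm_le)
    also have "\<dots> = ((\<Sum>k<n. wcoeff t n (w n) k) + (\<Sum>k<n. wcoeff t n (z n) k)) / 2"
      by (simp add: sum.distrib add_divide_distrib sum_divide_distrib)
    also have "\<dots> \<le> (?b w n + ?b z n) / 2"
      using r by (intro divide_right_mono add_mono wcoeff_head_le[OF n]) auto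
    finally have *: "norm (\<Sum>k<n. of_real ?e * hcoeff t (kap t n) (cnj (w n)) (z n) k) \<le> (?b w n + ?b z n) / 2" .
    have "kernel (elliptic_potential t) n (w n) (z n) / of_nat n
       = of_real (sqrt (1 - t\<^sup>2) / pi) * (\<Sum>k<n. of_real ?e * hcoeff t (kap t n) (cnj (w n)) (z n) k)"
      by (simp add: kernel_eq_hcoeff[OF t n] sum_distrib_left mult.assoc del: of_real_exp exp_of_real)
    then show "norm (kernel (elliptic_potential t) n (w n) (z n) / of_nat n) \<le> sqrt (1 - t\<^sup>2) / pi * ((?b w n + ?b z n) / 2)"
      using * t_sq[OF t] by (simp only: norm_mult norm_of_real) (intro mult_mono, auto)
  qed
qed

text \<open>Stated as a vanishing difference because the full series carries a phase that depends on
  n and need not converge; the phase is removed only with the gauge.\<close>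

lemma kernel_inside:
  assumes "z0 \<in> inside_ellipse t" "w \<longlonglongrightarrow> z0" "z \<longlonglongrightarrow> z0"
  shows "(\<lambda>n. kernel (elliptic_potential t) n (w n) (z n) / of_nat n -
     of_real (sqrt (1 - t\<^sup>2) / pi * exp (- (real n / 2) * (elliptic_potential t (w n) + elliptic_potential t (z n))))
       * mehler t (kap t n) (cnj (w n)) (z n) 1) \<longlonglongrightarrow> 0"
proof -
  obtain r where r: "r > 1" "r < 1 / t" "rate t z0 r < 0" using rate_neg_inside[OF assms(1)] by auto
  let ?b = "\<lambda>z n. exp (real n * rate t (z n) r) / sqrt (1 - (t * r)\<^sup>2)"
  have "(\<lambda>n. sqrt (1 - t\<^sup>2) / pi * ((?b w n + ?b z n) / 2)) \<longlonglongrightarrow> sqrt (1 - t\<^sup>2) / pi * ((0 + 0) / 2)"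
    by (intro tendsto_intros tendsto_exp_rate[OF r(3)] assms) simp_all
  then have lim: "(\<lambda>n. sqrt (1 - t\<^sup>2) / pi * ((?b w n + ?b z n) / 2)) \<longlonglongrightarrow> 0" by simp
  show ?thesis
  proof (rule Lim_null_comparison[OF _ lim], rule eventually_mono[OF eventually_gt_at_top[of 0]])
    fix n :: nat assume n: "n > 0"
    let ?e = "exp (- (real n / 2) * (elliptic_potential t (w n) + elliptic_potential t (z n)))"
    let ?h = "hcoeff t (kap t n) (cnj (w n)) (z n)"
    have S: "?h sums mehler t (kap t n) (cnj (w n)) (z n) 1"
      using mehler_sums[of t "kap t n" 1 "cnj (w n)" "z n"] kap_pos[OF t n] t by simp
    have bound: "summable (\<lambda>k. (wcoeff t n (w n) (k + n) + wcoeff t n (z n) (k + n)) / 2)"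
      using wcoeff_summable[OF n] by (intro summable_divide summable_add) (auto simp: summable_iff_shift)
    have "norm (\<Sum>k. of_real ?e * ?h (k + n)) \<le> (\<Sum>k. (wcoeff t n (w n) (k + n) + wcoeff t n (z n) (k + n)) / 2)"
      using norm_hcoeff_le[OF n] by (intro norm_suminf_le bound) 
    also have "\<dots> = ((\<Sum>k. wcoeff t n (w n) (k + n)) + (\<Sum>k. wcoeff t n (z n) (k + n))) / 2"
      using wcoeff_summable[OF n] by (subst suminf_divide, intro summable_add; (subst suminf_add)?) (auto simp: summable_iff_shift)
    also have "\<dots> \<le> (?b w n + ?b z n) / 2"
      using r by (intro divide_right_mono add_mono wcoeff_tail_le[OF n]) auto
    finally have *: "norm (\<Sum>k. of_real ?e * ?h (k + n)) \<le> (?b w n + ?b z n) / 2" .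
    have "mehler t (kap t n) (cnj (w n)) (z n) 1 = (\<Sum>k. ?h (k + n)) + (\<Sum>k<n. ?h k)"
      using S suminf_split_initial_segment[of ?h n] by (simp add: sums_iff)
    moreover have "(\<Sum>k. of_real ?e * ?h (k + n)) = of_real ?e * (\<Sum>k. ?h (k + n))"
      using S by (intro suminf_mult) (auto simp: sums_iff summable_iff_shift)
    moreover have ring: "s * e * h - s * e * (T + h) = - (s * (e * T))" for s e h T :: complex
      by (simp add: algebra_simps)
    ultimately have "kernel (elliptic_potential t) n (w n) (z n) / of_nat n - of_real (sqrt (1 - t\<^sup>2) / pi * ?e) * mehler t (kap t n) (cnj (w n)) (z n) 1
       = - (of_real (sqrt (1 - t\<^sup>2) / pi) * (\<Sum>k. of_real ?e * ?h (k + n)))"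
      by (simp only: kernel_eq_hcoeff[OF t n] of_real_mult)
    then show "norm (kernel (elliptic_potential t) n (w n) (z n) / of_nat n - of_real (sqrt (1 - t\<^sup>2) / pi * ?e) * mehler t (kap t n) (cnj (w n)) (z n) 1) \<le> sqrt (1 - t\<^sup>2) / pi * ((?b w n + ?b z n) / 2)"
      using * t_sq[OF t] by (simp only: norm_minus_cancel norm_mult norm_of_real) (intro mult_mono, auto)
  qed
qed

end

section \<open>The complementary error function as a contour integral\<close>

lemma borel_measurable_indicator_continuous:
  fixes f :: "real \<Rightarrow> complex"
  assumes "continuous_on UNIV f" and [measurable]: "A \<in> sets borel"
  shows "(\<lambda>x. indicator A x *\<^sub>R f x) \<in> borel_measurable lborel"
proof -
  have [measurable]: "f \<in> borel_measurable borel"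
    using assms(1) by (rule borel_measurable_continuous_onI)
  show ?thesis by measurable
qed

text \<open>For real \<mu> this is the characteristic function of the normal law. The imaginary part
  q of \<mu> is absorbed by the real translation s + q, so no contour has to be moved.\<close>

lemma gaussian_fourier:
  fixes \<mu> :: complex
  shows "integrable lborel (\<lambda>s::real. exp (- (of_real s)\<^sup>2 / 2 + \<i> * of_real s * \<mu>))"
    and "(\<integral>s. exp (- (of_real s)\<^sup>2 / 2 + \<i> * of_real s * \<mu>) \<partial>lborel) = of_real (sqrt (2 * pi)) * exp (- \<mu>\<^sup>2 / 2)"
proof -
  obtain p q where pq: "\<mu> = Complex p q" by (cases \<mu>)
  have base: "exp (- (complex_of_real s)\<^sup>2 / 2 + \<i> * of_real s * of_real p) = of_real (sqrt (2 * pi)) * (std_normal_density s *\<^sub>R iexp (p * s))" for s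
    by (simp only: exp_add) (simp add: std_normal_density_def scaleR_conv_of_real exp_of_real[symmetric] mult_ac)
  have int0: "integrable lborel (\<lambda>s. std_normal_density s *\<^sub>R iexp (p * s))"
    by (rule Bochner_Integration.integrable_bound[where f = std_normal_density]) auto
  have "char std_normal_distribution p = (\<integral>s. std_normal_density s *\<^sub>R iexp (p * s) \<partial>lborel)"
    unfolding char_def by (subst integral_density) auto
  then have val0: "(\<integral>s. std_normal_density s *\<^sub>R iexp (p * s) \<partial>lborel) = of_real (exp (- p\<^sup>2 / 2))"
    by (simp add: char_std_normal_distribution)
  define g where "g s = exp (- (complex_of_real s)\<^sup>2 / 2 + \<i> * of_real s * of_real p)" for s :: real
  have g: "integrable lborel g" "(\<integral>s. g s \<partial>lborel) = of_real (sqrt (2 * pi)) * of_real (exp (- p\<^sup>2 / 2))"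
    unfolding g_def base
    by (intro integrable_mult_right int0) (simp only: integral_mult_right_zero val0)
  have shift: "exp (- (complex_of_real s)\<^sup>2 / 2 + \<i> * of_real s * \<mu>) = exp (of_real (q\<^sup>2 / 2) - \<i> * of_real (p * q)) * g (q + 1 * s)" for s
    unfolding g_def exp_add[symmetric] pq Complex_eq
    by (rule arg_cong[where f = exp]) (simp add: power2_eq_square field_simps)
  show "integrable lborel (\<lambda>s::real. exp (- (of_real s)\<^sup>2 / 2 + \<i> * of_real s * \<mu>))"
    unfolding shift by (intro integrable_mult_right lborel_integrable_real_affine g) simp
  have "(\<integral>s. exp (- (of_real s)\<^sup>2 / 2 + \<i> * of_real s * \<mu>) \<partial>lborel) = exp (of_real (q\<^sup>2 / 2) - \<i> * of_real (p * q)) * (\<integral>s. g s \<partial>lborel)"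
    unfolding shift integral_mult_right_zero
    using lborel_integral_real_affine[of 1 g q] by simp
  also have "\<dots> = of_real (sqrt (2 * pi)) * (exp (of_real (q\<^sup>2 / 2) - \<i> * of_real (p * q)) * exp (of_real (- p\<^sup>2 / 2)))"
    unfolding g exp_of_real by simp
  also have "exp (of_real (q\<^sup>2 / 2) - \<i> * of_real (p * q)) * exp (of_real (- p\<^sup>2 / 2)) = exp (- \<mu>\<^sup>2 / 2)"
    unfolding exp_add[symmetric] pq Complex_eq
    by (rule arg_cong[where f = exp]) (simp add: power2_eq_square field_simps)
  finally show "(\<integral>s. exp (- (of_real s)\<^sup>2 / 2 + \<i> * of_real s * \<mu>) \<partial>lborel) = of_real (sqrt (2 * pi)) * exp (- \<mu>\<^sup>2 / 2)" .
qed

lemma integral_exp_half_line: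
  fixes v :: complex
  assumes "Re v < 0"
  shows "integrable lborel (\<lambda>x::real. indicator {0<..} x *\<^sub>R exp (v * of_real x))"
    and "(\<integral>x. indicator {0<..} x *\<^sub>R exp (v * of_real x) \<partial>lborel) = - (1 / v)"
proof -
  have v: "v \<noteq> 0" using assms by auto
  show int: "integrable lborel (\<lambda>x::real. indicator {0<..} x *\<^sub>R exp (v * of_real x))"
  proof (rule Bochner_Integration.integrable_bound)
    show "integrable lborel (\<lambda>x. indicator {0<..} x *\<^sub>R exp (- (x * (- Re v))))"
      using integrable_I0i_exp_mscale[of "- Re v"] assms by (simp add: set_integrable_def)
    show "AE x in lborel. norm (indicator {0<..} x *\<^sub>R exp (v * complex_of_real x)) \<le> norm (indicator {0<..} x *\<^sub>R exp (- (x * - Re v)))"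
      by (auto simp: indicator_def mult.commute)
  qed (intro borel_measurable_indicator_continuous continuous_intros; simp)
  have "(LBINT x=0..\<infinity>. exp (v * of_real x)) = 0 - 1 / v"
  proof (rule interval_integral_FTC_integrable)
    show "((\<lambda>x. exp (v * of_real x) / v) has_vector_derivative exp (v * of_real x)) (at x)" for x
    proof -
      have "((\<lambda>z. exp (v * z) / v) has_field_derivative exp (v * of_real x)) (at (of_real x))"
        using v by (auto intro!: derivative_eq_intros)
      from has_vector_derivative_real_field[OF this] show ?thesis by (simp add: o_def)
    qed
    show "isCont (\<lambda>x. exp (v * of_real x)) x" for x by (intro continuous_intros)
    show "set_integrable lborel (einterval 0 \<infinity>) (\<lambda>x. exp (v * of_real x))"
      using int by (simp add: set_integrable_def zero_ereal_def)
    have "((\<lambda>x. exp (v * of_real x) / v) \<longlongrightarrow> exp (v * of_real 0) / v) (at_right 0)"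
      by (intro tendsto_intros v)
    then show "(((\<lambda>x. exp (v * of_real x) / v) \<circ> real_of_ereal) \<longlongrightarrow> 1 / v) (at_right 0)"
      by (simp add: zero_ereal_def ereal_tendsto_simps1)
    have "((\<lambda>x. exp (Re v * x)) \<longlongrightarrow> 0) at_top"
      using assms by real_asymp
    then have "((\<lambda>x. exp (v * complex_of_real x)) \<longlongrightarrow> 0) at_top"
      by (rule Lim_null_comparison[rotated]) auto
    then have "((\<lambda>x. exp (v * complex_of_real x) / v) \<longlongrightarrow> 0) at_top"
      by (rule tendsto_divide_zero)
    then show "(((\<lambda>x. exp (v * of_real x) / v) \<circ> real_of_ereal) \<longlongrightarrow> 0) (at_left \<infinity>)"
      by (simp add: ereal_tendsto_simps1)
  qed auto
  then show "(\<integral>x. indicator {0<..} x *\<^sub>R exp (v * of_real x) \<partial>lborel) = - (1 / v)"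
    by (simp add: interval_lebesgue_integral_def set_lebesgue_integral_def zero_ereal_def)
qed

text \<open>The endpoint is a null set; the open half-line matches
  \<open>integral_exp_half_line\<close>.\<close>

lemma erfc_altdef:
  "erfc z = of_real (2 / sqrt pi) * (\<integral>s. indicator {0<..} s *\<^sub>R exp (- (z + of_real s)\<^sup>2) \<partial>lborel)"
proof -
  have "(\<integral>s. indicator {0..} s *\<^sub>R exp (- (z + of_real s)\<^sup>2) \<partial>lborel) = (\<integral>s. indicator {0<..} s *\<^sub>R exp (- (z + of_real s)\<^sup>2) \<partial>lborel)"
  proof (rule integral_cong_AE)
    show "AE s in lborel. indicator {0..} s *\<^sub>R exp (- (z + of_real s)\<^sup>2) = indicator {0<..} s *\<^sub>R exp (- (z + of_real s)\<^sup>2)"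
      using AE_lborel_singleton[of "0::real"] by eventually_elim (auto simp: indicator_def)
  qed (intro borel_measurable_indicator_continuous continuous_intros; simp)+
  then show ?thesis by (simp add: erfc_def set_lebesgue_integral_def)
qed

text \<open>Since Re v = -1, the number -1 / v is the integral of exp (v x) over x > 0. After
  exchanging integrals, the one over s is Gaussian and equals a multiple of exp (- (\<beta> + x)^2 /
  2); the remaining half-line integral is erfc.\<close>

lemma erfc_contour_integral:
  fixes \<beta> :: complex
  defines "v \<equiv> \<lambda>s::real. Complex (- 1) s"
  shows "(\<integral>s. exp (\<beta> * v s + (v s)\<^sup>2 / 2) / (- v s) \<partial>lborel) = of_real pi * erfc (\<beta> / of_real (sqrt 2))"
proof -
  let ?f = "\<lambda>s x. exp (\<beta> * v s + (v s)\<^sup>2 / 2) * (indicator {0<..} x *\<^sub>R exp (v s * of_real x))"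
  have v: "v s = - 1 + \<i> * of_real s" for s by (simp add: v_def Complex_eq)
  have cont: "continuous_on UNIV v" unfolding v by (intro continuous_intros)
  have g: "exp (\<gamma> * v s + (v s)\<^sup>2 / 2) = exp (1 / 2 - \<gamma>) * exp (- (of_real s)\<^sup>2 / 2 + \<i> * of_real s * (\<gamma> - 1))" for \<gamma> s
    unfolding exp_add[symmetric] v by (rule arg_cong[where f = exp]) (simp add: power2_eq_square field_simps)
  have "integrable (lborel \<Otimes>\<^sub>M lborel) (\<lambda>(s, x). ?f s x)"
  proof (rule lborel_pair.Fubini_integrable)
    have [measurable]: "v \<in> borel_measurable lborel"
      using cont by (simp add: borel_measurable_continuous_onI)
    show "(\<lambda>(s, x). ?f s x) \<in> borel_measurable (lborel \<Otimes>\<^sub>M lborel)" by measurable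
    \<comment> \<open>exp (v x) has modulus exp (- x) for every s, so the absolute integrals
      factor.\<close>
    have "integrable lborel (\<lambda>s. norm (exp (\<beta> * v s + (v s)\<^sup>2 / 2)) * (\<integral>x. norm (indicator {0<..} x *\<^sub>R exp ((- 1 :: complex) * of_real x)) \<partial>lborel))"
      unfolding g by (intro integrable_mult_left integrable_norm integrable_mult_right gaussian_fourier(1))
    also have "(\<lambda>s. norm (exp (\<beta> * v s + (v s)\<^sup>2 / 2)) * (\<integral>x. norm (indicator {0<..} x *\<^sub>R exp ((- 1 :: complex) * of_real x)) \<partial>lborel))
       = (\<lambda>s. \<integral>x. norm (case (s, x) of (s, x) \<Rightarrow> ?f s x) \<partial>lborel)"
      by (rule ext, subst integral_mult_right_zero[symmetric], rule Bochner_Integration.integral_cong)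
        (simp_all add: norm_mult v)
    finally show "integrable lborel (\<lambda>s. \<integral>x. norm (case (s, x) of (s, x) \<Rightarrow> ?f s x) \<partial>lborel)" .
    show "AE s in lborel. integrable lborel (\<lambda>x. case (s, x) of (s, x) \<Rightarrow> ?f s x)"
      by (intro AE_I2) (simp only: prod.case, intro integrable_mult_right integral_exp_half_line(1), simp add: v)
  qed
  note fubini = lborel_pair.Fubini_integral[OF this]
  have "(\<integral>s. exp (\<beta> * v s + (v s)\<^sup>2 / 2) / (- v s) \<partial>lborel) = (\<integral>s. (\<integral>x. ?f s x \<partial>lborel) \<partial>lborel)"
  proof (rule Bochner_Integration.integral_cong[OF refl])
    fix s
    have "(\<integral>x. indicator {0<..} x *\<^sub>R exp (v s * of_real x) \<partial>lborel) = - (1 / v s)"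
      by (rule integral_exp_half_line) (simp add: v)
    then show "exp (\<beta> * v s + (v s)\<^sup>2 / 2) / (- v s) = (\<integral>x. ?f s x \<partial>lborel)"
      by (simp only: integral_mult_right_zero) simp
  qed
  also have "\<dots> = (\<integral>x. (\<integral>s. ?f s x \<partial>lborel) \<partial>lborel)"
    by (rule fubini[symmetric])
  also have "\<dots> = (\<integral>x. indicator {0<..} x *\<^sub>R (of_real (sqrt (2 * pi)) * exp (- (\<beta> + of_real x)\<^sup>2 / 2)) \<partial>lborel)"
  proof (rule Bochner_Integration.integral_cong[OF refl])
    fix x :: real
    have "?f s x = indicator {0<..} x *\<^sub>R (exp (1 / 2 - (\<beta> + of_real x)) * exp (- (of_real s)\<^sup>2 / 2 + \<i> * of_real s * ((\<beta> + of_real x) - 1)))" for s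
      unfolding g[of "\<beta> + of_real x", symmetric] by (simp add: exp_add algebra_simps)
    then have "(\<integral>s. ?f s x \<partial>lborel) = indicator {0<..} x *\<^sub>R (exp (1 / 2 - (\<beta> + of_real x)) * (of_real (sqrt (2 * pi)) * exp (- ((\<beta> + of_real x) - 1)\<^sup>2 / 2)))"
      by (simp only: integral_scaleR_right integral_mult_right_zero gaussian_fourier(2))
    also have "exp (1 / 2 - (\<beta> + of_real x)) * (of_real (sqrt (2 * pi)) * exp (- ((\<beta> + of_real x) - 1)\<^sup>2 / 2))
       = of_real (sqrt (2 * pi)) * (exp (1 / 2 - (\<beta> + of_real x)) * exp (- ((\<beta> + of_real x) - 1)\<^sup>2 / 2))" by simp
    also have "exp (1 / 2 - (\<beta> + of_real x)) * exp (- ((\<beta> + of_real x) - 1)\<^sup>2 / 2) = exp (- (\<beta> + of_real x)\<^sup>2 / 2)"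
      unfolding exp_add[symmetric] by (rule arg_cong[where f = exp]) (simp add: power2_eq_square field_simps)
    finally show "(\<integral>s. ?f s x \<partial>lborel) = indicator {0<..} x *\<^sub>R (of_real (sqrt (2 * pi)) * exp (- (\<beta> + of_real x)\<^sup>2 / 2))" .
  qed
  \<comment> \<open>Scaling by sqrt 2 turns the exponent - (\<beta> + x)^2 / 2 into the one in
    \<open>erfc_altdef\<close>; this is where the argument \<beta> / sqrt 2 comes from.\<close>
  also have "\<dots> = \<bar>sqrt 2\<bar> *\<^sub>R (\<integral>x. indicator {0<..} (0 + sqrt 2 * x) *\<^sub>R (of_real (sqrt (2 * pi)) * exp (- (\<beta> + of_real (0 + sqrt 2 * x))\<^sup>2 / 2)) \<partial>lborel)"
    by (rule lborel_integral_real_affine) simp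
  also have "(\<lambda>x. indicator {0<..} (0 + sqrt 2 * x) *\<^sub>R (of_real (sqrt (2 * pi)) * exp (- (\<beta> + of_real (0 + sqrt 2 * x))\<^sup>2 / 2)))
     = (\<lambda>x. of_real (sqrt (2 * pi)) * (indicator {0<..} x *\<^sub>R exp (- (\<beta> / of_real (sqrt 2) + of_real x)\<^sup>2)))"
  proof
    fix x :: real
    have s2: "complex_of_real (sqrt 2) * of_real (sqrt 2) = 2"
      by (metis of_real_mult of_real_numeral real_sqrt_mult_self abs_numeral)
    have "- (\<beta> + of_real (0 + sqrt 2 * x))\<^sup>2 / 2 = - (\<beta> / of_real (sqrt 2) + of_real x)\<^sup>2"
    proof -
      have "\<beta> + of_real (0 + sqrt 2 * x) = of_real (sqrt 2) * (\<beta> / of_real (sqrt 2) + of_real x)"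
        by (simp add: field_simps)
      then show ?thesis using s2 by (simp only: power_mult_distrib) (simp add: power2_eq_square)
    qed
    then show "indicator {0<..} (0 + sqrt 2 * x) *\<^sub>R (of_real (sqrt (2 * pi)) * exp (- (\<beta> + of_real (0 + sqrt 2 * x))\<^sup>2 / 2))
      = of_real (sqrt (2 * pi)) * (indicator {0<..} x *\<^sub>R exp (- (\<beta> / of_real (sqrt 2) + of_real x)\<^sup>2))"
      by (simp add: indicator_def zero_less_mult_iff)
  qed
  also have "\<bar>sqrt 2\<bar> *\<^sub>R (\<integral>x. of_real (sqrt (2 * pi)) * (indicator {0<..} x *\<^sub>R exp (- (\<beta> / of_real (sqrt 2) + of_real x)\<^sup>2)) \<partial>lborel)
     = of_real (sqrt 2 * sqrt (2 * pi)) * (\<integral>x. indicator {0<..} x *\<^sub>R exp (- (\<beta> / of_real (sqrt 2) + of_real x)\<^sup>2) \<partial>lborel)"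
    by (simp add: scaleR_conv_of_real del: real_scaleR_def)
  also have "sqrt 2 * sqrt (2 * pi) = pi * (2 / sqrt pi)"
    by (simp add: real_sqrt_mult real_div_sqrt field_simps)
  finally show ?thesis by (simp add: erfc_altdef)
qed

section \<open>Partial sums as circle integrals\<close>

text \<open>The circle path starts at angle 0, which is where the integrand will concentrate; a
  symmetric interval makes that angle an interior point.\<close>

lemma integral_periodic_shift:
  fixes g :: "real \<Rightarrow> complex"
  assumes cont: "continuous_on UNIV g" and per: "\<And>x. g (x + 2 * pi) = g x"
  shows "integral {0..2 * pi} g = integral {- pi..pi} g"
proof -
  have int: "g integrable_on {a..b}" for a b
    by (intro integrable_continuous_interval continuous_on_subset[OF cont]) auto
  have "integral {- pi..0} (g \<circ> (\<lambda>x. x + 2 * pi)) = integral {- pi + 2 * pi..0 + 2 * pi} g"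
    by (intro integral_shift continuous_on_subset[OF cont]) auto
  then have "integral {- pi..0} g = integral {pi..2 * pi} g"
    using per by (simp add: o_def)
  moreover have "integral {0..pi} g + integral {pi..2 * pi} g = integral {0..2 * pi} g"
    by (intro Henstock_Kurzweil_Integration.integral_combine int) auto
  moreover have "integral {- pi..0} g + integral {0..pi} g = integral {- pi..pi} g"
    by (intro Henstock_Kurzweil_Integration.integral_combine int) auto
  ultimately show ?thesis by (metis add.commute)
qed

text \<open>Dividing by 1 - \<rho> turns coefficients into partial sums, so Cauchy's formula gives a
  whole partial sum at once. The radius stays below 1 because of the pole this creates.\<close>

lemma partial_sum_eq_circle_integral:
  assumes f: "f has_fps_expansion Abs_fps c" "f holomorphic_on ball 0 1" and r: "0 < r" "r < 1"
  shows "(\<Sum>k\<le>m. c k) = 1 / (2 * pi) *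
    integral {- pi..pi} (\<lambda>\<theta>. f (of_real r * cis \<theta>) / ((1 - of_real r * cis \<theta>) * (of_real r * cis \<theta>) ^ m))"
proof -
  define G where "G \<rho> = f \<rho> * inverse (1 - \<rho>)" for \<rho>
  have "G has_fps_expansion Abs_fps c * inverse (1 - fps_X)"
    unfolding G_def by (intro fps_expansion_intros f) simp
  then have "(deriv ^^ m) G 0 / fact m = fps_nth (Abs_fps c * inverse (1 - fps_X)) m"
    by (rule fps_nth_fps_expansion[symmetric])
  also have "\<dots> = (\<Sum>k\<le>m. c k)"
    using fps_divide_fps_X_minus1_sum[of "Abs_fps c"] by (simp add: fps_divide_unit atLeast0AtMost)
  finally have D: "(deriv ^^ m) G 0 / fact m = (\<Sum>k\<le>m. c k)" .
  have hol: "G holomorphic_on ball 0 1"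
    unfolding G_def by (intro holomorphic_intros f) auto
  have cont: "continuous_on (cball 0 r) G"
    using r by (intro holomorphic_on_imp_continuous_on holomorphic_on_subset[OF hol]) auto
  have *: "((\<lambda>u. G u / (u - 0) ^ Suc m) has_contour_integral ((2 * pi * \<i>) / fact m * (deriv ^^ m) G 0)) (circlepath 0 r)"
    using r by (intro Cauchy_has_contour_integral_higher_derivative_circlepath cont holomorphic_on_subset[OF hol]) auto
  have hi: "((\<lambda>\<theta>. G (of_real r * cis \<theta>) / (of_real r * cis \<theta>) ^ Suc m * of_real r * \<i> * cis \<theta>)
      has_integral (2 * pi * \<i>) * (\<Sum>k\<le>m. c k)) {0..2 * pi}"
  proof -
    have val: "(2 * pi * \<i>) / fact m * (deriv ^^ m) G 0 = (2 * pi * \<i>) * (\<Sum>k\<le>m. c k)"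
      unfolding D[symmetric] by simp
    have pos: "0 < 2 * pi" by simp
    from *[unfolded val circlepath_def, THEN iffD1[OF has_contour_integral_part_circlepath_iff[OF pos]]]
    show ?thesis by (simp only: add_0 diff_zero)
  qed
  have "((\<lambda>\<theta>. G (of_real r * cis \<theta>) / (of_real r * cis \<theta>) ^ m) has_integral (2 * pi) * (\<Sum>k\<le>m. c k)) {0..2 * pi}"
  proof -
    have 1: "- \<i> * (G (of_real r * cis \<theta>) / (of_real r * cis \<theta>) ^ Suc m * of_real r * \<i> * cis \<theta>) = G (of_real r * cis \<theta>) / (of_real r * cis \<theta>) ^ m" for \<theta>
    proof -
      define u where "u = of_real r * cis \<theta>"
      have "u \<noteq> 0" using r by (simp add: u_def)
      have "- \<i> * (G u / u ^ Suc m * of_real r * \<i> * cis \<theta>) = G u / u ^ Suc m * u"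
      proof -
        have "- \<i> * (q * of_real r * \<i> * cis \<theta>) = q * (of_real r * cis \<theta>)" for q
          by (simp add: algebra_simps)
        then show ?thesis by (simp only: u_def)
      qed
      also have "\<dots> = G u / u ^ m" using \<open>u \<noteq> 0\<close> by simp
      finally show ?thesis by (simp only: u_def)
    qed
    have 2: "- \<i> * ((z * \<i>) * S) = z * S" for z S 
      by (simp add: complex_eq_iff)
    show ?thesis
      using has_integral_mult_right[OF hi, of "- \<i>", unfolded 1, unfolded 2] .
  qed
  then have "2 * pi * (\<Sum>k\<le>m. c k) = integral {0..2 * pi} (\<lambda>\<theta>. G (of_real r * cis \<theta>) / (of_real r * cis \<theta>) ^ m)"
    by (simp add: integral_unique)
  also have "\<dots> = integral {- pi..pi} (\<lambda>\<theta>. G (of_real r * cis \<theta>) / (of_real r * cis \<theta>) ^ m)"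
  proof (rule integral_periodic_shift)
    show "continuous_on UNIV (\<lambda>\<theta>. G (of_real r * cis \<theta>) / (of_real r * cis \<theta>) ^ m)"
      using r by (intro continuous_intros continuous_on_compose2[OF cont]) (auto simp: norm_mult)
    show "G (of_real r * cis (x + 2 * pi)) / (of_real r * cis (x + 2 * pi)) ^ m = G (of_real r * cis x) / (of_real r * cis x) ^ m" for x
    proof -
      have "cis (x + 2 * pi) = cis x" by (simp add: complex_eq_iff)
      then show ?thesis by (simp only:)
    qed
  qed
  also have "(\<lambda>\<theta>. G (of_real r * cis \<theta>) / (of_real r * cis \<theta>) ^ m)
      = (\<lambda>\<theta>. f (of_real r * cis \<theta>) / ((1 - of_real r * cis \<theta>) * (of_real r * cis \<theta>) ^ m))"
    by (simp only: G_def divide_inverse mult.assoc inverse_mult_distrib)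
  finally have eq: "of_real (2 * pi) * (\<Sum>k\<le>m. c k)
      = integral {- pi..pi} (\<lambda>\<theta>. f (of_real r * cis \<theta>) / ((1 - of_real r * cis \<theta>) * (of_real r * cis \<theta>) ^ m))" .
  have "complex_of_real (1 / (2 * pi)) * (of_real (2 * pi) * S) = S" for S
    by (simp only: mult.assoc[symmetric] of_real_mult[symmetric]) simp
  then show ?thesis unfolding eq[symmetric] by (rule sym)
qed

text \<open>The difference of the values of \<open>\<rho> / (1 + \<tau> \<rho>)\<close> at \<open>\<rho>\<close> and at \<open>1\<close>.\<close>

definition moebdiff :: "real \<Rightarrow> complex \<Rightarrow> complex" where
  "moebdiff \<tau> \<rho> = (\<rho> - 1) / ((1 + of_real \<tau> * \<rho>) * (1 + of_real \<tau>))"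

lemma one_plus_nonzero:
  assumes "\<bar>\<tau>\<bar> < 1" "norm \<rho> \<le> 1"
  shows "1 + of_real \<tau> * \<rho> \<noteq> (0::complex)"
proof
  assume "1 + of_real \<tau> * \<rho> = 0"
  then have "of_real \<tau> * \<rho> = - 1" by (simp add: eq_neg_iff_add_eq_0 add.commute)
  then have "norm (of_real \<tau> * \<rho>) = 1" by simp
  moreover have "norm (of_real \<tau> * \<rho>) \<le> \<bar>\<tau>\<bar> * 1"
    using assms by (simp add: norm_mult mult_left_le)
  ultimately show False using assms by simp
qed

text \<open>Partial fractions split Mehler's exponent along x + y and x - y, with the Moebius maps
  \<rho> / (1 + t \<rho>) and \<rho> / (1 - t \<rho>). Dividing by the value at \<rho> = 1 leaves
  only increments of these maps.\<close>

lemma mehler_ratio: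
  fixes t :: real and n :: nat
  assumes t: "0 < t" "t < 1" and n: "n > 0" and \<rho>: "norm \<rho> \<le> 1"
  shows "mehler t (kap t n) x y \<rho> / mehler t (kap t n) x y 1 =
    csqrt (1 - of_real t ^ 2) / csqrt (1 - of_real t ^ 2 * \<rho>\<^sup>2) *
    exp (of_nat n * (1 - of_real t ^ 2) * (((x + y) / 2)\<^sup>2 * moebdiff t \<rho> - ((x - y) / 2)\<^sup>2 * moebdiff (- t) \<rho>))"
proof -
  define T where "T = complex_of_real t"
  have nz: "1 + T * \<rho> \<noteq> 0" "1 - T * \<rho> \<noteq> 0" "1 + T \<noteq> 0" "1 - T \<noteq> 0"
    using one_plus_nonzero[of t \<rho>] one_plus_nonzero[of "- t" \<rho>] one_plus_nonzero[of t 1] one_plus_nonzero[of "- t" 1] t \<rho>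
    by (auto simp: T_def)
  have fac: "1 - T\<^sup>2 * \<rho>\<^sup>2 = (1 + T * \<rho>) * (1 - T * \<rho>)" "1 - T\<^sup>2 = (1 + T) * (1 - T)"
    by (simp_all add: power2_eq_square algebra_simps)
  have kap: "of_real (kap t n) = 1 / (of_nat n * (1 - T\<^sup>2))" by (simp add: kap_def T_def)
  have key: "(2 * x * y * \<rho> - (x\<^sup>2 + y\<^sup>2) * T * \<rho>\<^sup>2) / (1 - T\<^sup>2 * \<rho>\<^sup>2) = 2 * (((x + y) / 2)\<^sup>2 * (\<rho> / (1 + T * \<rho>)) - ((x - y) / 2)\<^sup>2 * (\<rho> / (1 - T * \<rho>)))"
    if "1 + T * \<rho> \<noteq> 0" "1 - T * \<rho> \<noteq> 0" for \<rho>
  proof -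
    have den: "1 - T\<^sup>2 * \<rho>\<^sup>2 = (1 + T * \<rho>) * (1 - T * \<rho>)" by (simp add: power2_eq_square algebra_simps)
    have split: "2 * (p * (\<rho> / a) - q * (\<rho> / b)) = 2 * (p * \<rho> * b - q * \<rho> * a) / (a * b)"
      if "a \<noteq> 0" "b \<noteq> 0" for p q a b :: complex
      using that by (simp add: field_simps)
    have num: "2 * x * y * \<rho> - (x\<^sup>2 + y\<^sup>2) * T * \<rho>\<^sup>2
        = 2 * (((x + y) / 2)\<^sup>2 * \<rho> * (1 - T * \<rho>) - ((x - y) / 2)\<^sup>2 * \<rho> * (1 + T * \<rho>))"
      by (simp add: power2_eq_square field_simps)
    show ?thesis unfolding split[OF that] den num ..
  qed
  have ex: "(2 * x * y * \<rho> - (x\<^sup>2 + y\<^sup>2) * T * \<rho>\<^sup>2) / (2 * of_real (kap t n) * (1 - T\<^sup>2 * \<rho>\<^sup>2))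
     = of_nat n * (1 - T\<^sup>2) * (((x + y) / 2)\<^sup>2 * (\<rho> / (1 + T * \<rho>)) - ((x - y) / 2)\<^sup>2 * (\<rho> / (1 - T * \<rho>)))"
    if "1 + T * \<rho> \<noteq> 0" "1 - T * \<rho> \<noteq> 0" for \<rho>
  proof -
    have "(2 * x * y * \<rho> - (x\<^sup>2 + y\<^sup>2) * T * \<rho>\<^sup>2) / (2 * of_real (kap t n) * (1 - T\<^sup>2 * \<rho>\<^sup>2))
      = (1 / (2 * of_real (kap t n))) * ((2 * x * y * \<rho> - (x\<^sup>2 + y\<^sup>2) * T * \<rho>\<^sup>2) / (1 - T\<^sup>2 * \<rho>\<^sup>2))"
      by simp
    also have "1 / (2 * of_real (kap t n)) = of_nat n * (1 - T\<^sup>2) / 2" by (simp add: kap)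
    finally have *: "(2 * x * y * \<rho> - (x\<^sup>2 + y\<^sup>2) * T * \<rho>\<^sup>2) / (2 * of_real (kap t n) * (1 - T\<^sup>2 * \<rho>\<^sup>2))
      = of_nat n * (1 - T\<^sup>2) / 2 * ((2 * x * y * \<rho> - (x\<^sup>2 + y\<^sup>2) * T * \<rho>\<^sup>2) / (1 - T\<^sup>2 * \<rho>\<^sup>2))" .
    have "q / 2 * (2 * X) = q * X" for q X :: complex by simp
    then show ?thesis unfolding * key[OF that] .
  qed
  have md: "\<rho> / (1 + T * \<rho>) - 1 / (1 + T) = moebdiff t \<rho>" "\<rho> / (1 - T * \<rho>) - 1 / (1 - T) = moebdiff (- t) \<rho>"
    using nz by (simp_all add: moebdiff_def flip: T_def) (simp_all add: divide_simps, simp_all add: algebra_simps)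
  have "mehler t (kap t n) x y \<rho> / mehler t (kap t n) x y 1 = csqrt (1 - T\<^sup>2) / csqrt (1 - T\<^sup>2 * \<rho>\<^sup>2) *
     (exp (of_nat n * (1 - T\<^sup>2) * (((x + y) / 2)\<^sup>2 * (\<rho> / (1 + T * \<rho>)) - ((x - y) / 2)\<^sup>2 * (\<rho> / (1 - T * \<rho>))))
      / exp (of_nat n * (1 - T\<^sup>2) * (((x + y) / 2)\<^sup>2 * (1 / (1 + T * 1)) - ((x - y) / 2)\<^sup>2 * (1 / (1 - T * 1)))))"
  proof -
    have "mehler t (kap t n) x y \<rho> = inverse (csqrt (1 - T\<^sup>2 * \<rho>\<^sup>2)) * exp (of_nat n * (1 - T\<^sup>2) * (((x + y) / 2)\<^sup>2 * (\<rho> / (1 + T * \<rho>)) - ((x - y) / 2)\<^sup>2 * (\<rho> / (1 - T * \<rho>))))"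
      using ex[OF nz(1,2)] by (simp add: mehler_def T_def)
    moreover have "mehler t (kap t n) x y 1 = inverse (csqrt (1 - T\<^sup>2 * 1\<^sup>2)) * exp (of_nat n * (1 - T\<^sup>2) * (((x + y) / 2)\<^sup>2 * (1 / (1 + T * 1)) - ((x - y) / 2)\<^sup>2 * (1 / (1 - T * 1))))"
      using ex[of 1] nz(3,4) by (simp add: mehler_def T_def)
    moreover have "inverse a * E / (inverse b * F) = b / a * (E / F)" for a b E F :: complex
      by (simp add: divide_inverse mult_ac)
    moreover have "1 - T\<^sup>2 * 1\<^sup>2 = 1 - T\<^sup>2" by simp
    ultimately show ?thesis by (simp only:)
  qed
  also have "\<dots> = csqrt (1 - T\<^sup>2) / csqrt (1 - T\<^sup>2 * \<rho>\<^sup>2) * exp (of_nat n * (1 - T\<^sup>2) * (((x + y) / 2)\<^sup>2 * moebdiff t \<rho> - ((x - y) / 2)\<^sup>2 * moebdiff (- t) \<rho>))"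
  proof -
    have "c * (P * A - D * B) - c * (P * A' - D * B') = c * (P * (A - A') - D * (B - B'))" for c P A A' D B B' :: complex
      by (simp add: algebra_simps)
    then show ?thesis by (simp only: exp_diff[symmetric] md[symmetric] mult_1_right)
  qed
  finally show ?thesis by (simp only: T_def)
qed

section \<open>Expansions and global bounds for the exponent\<close>

lemma tendsto_expm1_over: "((\<lambda>u::complex. (exp u - 1) / u) \<longlongrightarrow> 1) (at 0)"
  using DERIV_exp[of "0::complex"] by (simp add: has_field_derivative_iff)

lemma tendsto_expm1m_over: "((\<lambda>u::complex. (exp u - 1 - u) / u\<^sup>2) \<longlongrightarrow> 1 / 2) (at 0)"
proof -
  have "((\<lambda>u::complex. (exp u - 1 - u) / u\<^sup>2 - 1 / 2) \<longlongrightarrow> 0) (at 0)"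
  proof (rule Lim_null_comparison)
    have "((\<lambda>u::complex. exp \<bar>Re u\<bar> * norm u / 2) \<longlongrightarrow> exp \<bar>Re 0\<bar> * norm (0::complex) / 2) (at 0)"
      by (intro tendsto_intros) auto
    then show "((\<lambda>u::complex. exp \<bar>Re u\<bar> * norm u / 2) \<longlongrightarrow> 0) (at 0)" by simp
    show "\<forall>\<^sub>F u in at (0::complex). norm ((exp u - 1 - u) / u\<^sup>2 - 1 / 2) \<le> exp \<bar>Re u\<bar> * norm u / 2"
    proof (rule eventually_mono[OF eventually_neq_at_within[of 0]])
      fix u :: complex assume u: "u \<noteq> 0"
      have "(exp u - 1 - u) / u\<^sup>2 - 1 / 2 = (exp u - (\<Sum>i\<le>2. u ^ i / fact i)) / u\<^sup>2"
        using u by (simp add: numeral_2_eq_2 field_simps)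
      also have "norm \<dots> \<le> (exp \<bar>Re u\<bar> * norm u ^ Suc 2 / fact 2) / norm (u\<^sup>2)"
        unfolding norm_divide by (intro divide_right_mono Taylor_exp) auto
      also have "\<dots> = exp \<bar>Re u\<bar> * norm u / 2"
        using u by (simp add: norm_power norm_mult power2_eq_square power3_eq_cube field_simps)
      finally show "norm ((exp u - 1 - u) / u\<^sup>2 - 1 / 2) \<le> exp \<bar>Re u\<bar> * norm u / 2" .
    qed
  qed
  from tendsto_add[OF this tendsto_const[of "1 / 2"]] show ?thesis by simp
qed

text \<open>In the closed left half-plane, which is convex, the derivative of exp has modulus at
  most 1.\<close>

lemma norm_expm1_le:
  fixes u :: complex
  assumes "Re u \<le> 0"
  shows "norm (exp u - 1) \<le> norm u"
proof -
  have "norm (exp u - exp 0) \<le> 1 * norm (u - 0)"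
  proof (rule field_differentiable_bound[where S = "{z. Re z \<le> 0}" and f' = exp])
    show "convex {z. Re z \<le> 0}" by (rule convex_halfspace_Re_le)
    show "(exp has_field_derivative exp z) (at z within {z. Re z \<le> 0})" for z :: complex
      by (auto intro!: derivative_eq_intros)
  qed (use assms in auto)
  then show ?thesis by simp
qed

text \<open>The constant is crude but valid on the entire circle. With y half the modulus of x, so y
  \<le> 2, Taylor gives sin y \<ge> y - y^3 / 6 \<ge> y / 3, and 1 - cos x = 2 (sin y)^2.\<close>

lemma one_minus_cos_ge:
  assumes "\<bar>x\<bar> \<le> pi"
  shows "1 - cos x \<ge> x\<^sup>2 / 18"
proof -
  define y where "y = \<bar>x\<bar> / 2"
  have y: "0 \<le> y" "y \<le> 2" using assms pi_less_4 by (auto simp: y_def)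
  have "\<bar>sin y - (\<Sum>m<3. sin_coeff m * y ^ m)\<bar> \<le> inverse (fact 3) * \<bar>y\<bar> ^ 3"
    by (rule Maclaurin_sin_bound)
  moreover have "(\<Sum>m<3. sin_coeff m * y ^ m) = y"
    by (simp add: numeral_3_eq_3 sin_coeff_def)
  ultimately have "\<bar>sin y - y\<bar> \<le> y ^ 3 / 6"
    using y by (simp add: fact_numeral)
  moreover have "y ^ 3 \<le> 4 * y"
  proof -
    have "y * y \<le> 2 * 2" using y by (intro mult_mono) auto
    then have "y * y * y \<le> 4 * y" using y by (intro mult_right_mono) auto
    then show ?thesis by (simp add: power3_eq_cube)
  qed
  ultimately have "sin y \<ge> y / 3" by linarith
  then have "(sin y)\<^sup>2 \<ge> (y / 3)\<^sup>2" using y by (intro power_mono) auto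
  moreover have "1 - cos x = 2 * (sin y)\<^sup>2"
    using cos_double_sin[of y] by (simp add: y_def)
  ultimately show ?thesis by (simp add: y_def power_divide)
qed

lemma norm_one_plus_ge:
  assumes "\<bar>\<tau>\<bar> \<le> t" "norm \<rho> \<le> 1"
  shows "norm (1 + of_real \<tau> * \<rho> :: complex) \<ge> 1 - t"
proof -
  have "norm (of_real \<tau> * \<rho>) \<le> t * 1"
    unfolding norm_mult using assms by (intro mult_mono) auto
  then show ?thesis using norm_diff_ineq[of 1 "of_real \<tau> * \<rho>"] by simp
qed

lemma norm_moebdiff_le:
  assumes "\<bar>\<tau>\<bar> \<le> t" "t < 1" "norm \<rho> \<le> 1"
  shows "norm (moebdiff \<tau> \<rho>) \<le> norm (\<rho> - 1) / (1 - t)\<^sup>2"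
proof -
  have "(1 - t)\<^sup>2 \<le> norm (1 + of_real \<tau> * \<rho>) * norm (1 + of_real \<tau> * 1 :: complex)"
    unfolding power2_eq_square using assms norm_one_plus_ge[of \<tau> t 1]
    by (intro mult_mono norm_one_plus_ge) auto
  then show ?thesis
    unfolding moebdiff_def norm_divide norm_mult using assms by (intro divide_left_mono) (auto intro!: mult_pos_pos)
qed

text \<open>Domination needs a bound at every angle. The three terms are the linear radial part, its
  quadratic error and the angular decay; the linear coefficient is kept exact because the ellipse
  equation later cancels it.\<close>

lemma Re_moebdiff_le:
  assumes \<tau>: "\<bar>\<tau>\<bar> \<le> t" "t < 1" and r: "0 < r" "r \<le> 1" and \<theta>: "\<bar>\<theta>\<bar> \<le> pi"
  shows "Re (moebdiff \<tau> (of_real r * cis \<theta>)) \<le>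
    (r - 1) / (1 + \<tau>)\<^sup>2 + (1 - r)\<^sup>2 / (1 - t) ^ 3 - r * (1 - t) * \<theta>\<^sup>2 / 144"
proof -
  define \<rho> where "\<rho> = of_real r * cis \<theta>"
  have n\<rho>: "norm \<rho> = r" using r by (simp add: \<rho>_def norm_mult)
  have tr: "\<bar>\<tau> * r\<bar> \<le> t" using \<tau> r by (simp add: abs_mult mult_left_le order_trans[OF mult_left_le])
  define a where "a = 1 + of_real \<tau> * \<rho>"
  have a: "norm a \<ge> 1 - t" "norm a \<le> 2"
  proof -
    show "norm a \<ge> 1 - t" unfolding a_def using \<tau> r n\<rho> by (intro norm_one_plus_ge) auto
    have "norm a \<le> 1 + \<bar>\<tau>\<bar> * r" unfolding a_def using n\<rho> norm_triangle_ineq[of 1 "of_real \<tau> * \<rho>"] by (simp add: norm_mult)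
    then show "norm a \<le> 2" using tr \<tau> r by (simp add: abs_mult)
  qed
  have a0: "a \<noteq> 0" "norm a > 0" using a \<tau> by auto
  have b: "1 + \<tau> * r > 0" "1 + \<tau> * r \<le> 2" "1 - \<tau> * r \<ge> 1 - t" "1 + \<tau> > 0" "1 + \<tau> * r \<ge> 1 - t" "1 + \<tau> \<ge> 1 - t"
    using tr \<tau> by (auto simp: abs_le_iff)
  \<comment> \<open>The way from 1 to \<rho> is taken through the real point r: first radially, then
    along the circle.\<close>
  have split: "moebdiff \<tau> \<rho> = of_real ((r - 1) / ((1 + \<tau> * r) * (1 + \<tau>))) + (\<rho> - of_real r) / (a * of_real (1 + \<tau> * r))"
  proof -
    have nz: "1 + complex_of_real \<tau> \<noteq> 0" "1 + complex_of_real \<tau> * of_real r \<noteq> 0" "1 + of_real \<tau> * \<rho> \<noteq> 0"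
      using one_plus_nonzero[of \<tau> 1] one_plus_nonzero[of \<tau> "of_real r"] one_plus_nonzero[of \<tau> \<rho>] \<tau> r n\<rho> by auto
    have "(\<rho> - 1) / (A * T) = (R - 1) / (B * T) + (\<rho> - R) / (A * B)"
      if "A = 1 + of_real \<tau> * \<rho>" "B = 1 + of_real \<tau> * R" "T = 1 + of_real \<tau>" "A \<noteq> 0" "B \<noteq> 0" "T \<noteq> 0" for A B T R :: complex
    proof -
      have "(R - 1) / (B * T) + (\<rho> - R) / (A * B) = ((R - 1) * A + (\<rho> - R) * T) / (A * B * T)"
        using that(4-6) by (simp add: divide_simps)
      also have "(R - 1) * A + (\<rho> - R) * T = (\<rho> - 1) * B"
        unfolding that(1-3) by (simp add: algebra_simps)
      finally show ?thesis using that(4-6) by (simp add: mult_ac)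
    qed
    from this[OF refl refl refl nz(3,2,1)] show ?thesis
      unfolding moebdiff_def a_def by simp
  qed
  have "Re ((\<rho> - of_real r) / (a * of_real (1 + \<tau> * r))) = - (r * (1 - \<tau> * r) * (1 - cos \<theta>)) / ((norm a)\<^sup>2 * (1 + \<tau> * r))"
  proof -
    have "(\<rho> - of_real r) / (a * of_real (1 + \<tau> * r)) = (\<rho> - of_real r) * cnj a / of_real ((norm a)\<^sup>2 * (1 + \<tau> * r))"
      using complex_div_cnj[of "\<rho> - of_real r" a] by (simp add: divide_divide_eq_left[symmetric] del: divide_divide_eq_left)
    moreover have "Re ((\<rho> - of_real r) * cnj a) = - (r * (1 - \<tau> * r) * (1 - cos \<theta>))"
    proof -
      have "(cos \<theta>)\<^sup>2 + (sin \<theta>)\<^sup>2 = 1" by simp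
      then have ss: "(sin \<theta>)\<^sup>2 = 1 - (cos \<theta>)\<^sup>2" by linarith
      show ?thesis
        by (simp add: a_def \<rho>_def algebra_simps power2_eq_square[symmetric] ss)
    qed
    ultimately show ?thesis by (simp only: Re_divide_of_real)
  qed
  also have "\<dots> \<le> - (r * (1 - t) * (\<theta>\<^sup>2 / 18)) / (2\<^sup>2 * 2)"
  proof -
    \<comment> \<open>The constant 144 is 18 times 8: the 18 comes from
      \<open>one_minus_cos_ge\<close>, and 8 bounds the denominator because \<open>norm a\<close>
      and 1 + \<tau> r are at most 2.\<close>
    have "r * (1 - t) * (\<theta>\<^sup>2 / 18) / (2\<^sup>2 * 2) \<le> r * (1 - \<tau> * r) * (1 - cos \<theta>) / ((norm a)\<^sup>2 * (1 + \<tau> * r))"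
      using b a a0 r \<tau> one_minus_cos_ge[OF \<theta>] by (intro frac_le mult_mono power_mono mult_nonneg_nonneg mult_pos_pos) auto
    then show ?thesis by simp
  qed
  finally have 1: "Re ((\<rho> - of_real r) / (a * of_real (1 + \<tau> * r))) \<le> - (r * (1 - t) * \<theta>\<^sup>2 / 144)" by simp
  have "(r - 1) / ((1 + \<tau> * r) * (1 + \<tau>)) = (r - 1) / (1 + \<tau>)\<^sup>2 + (- \<tau>) * (1 - r)\<^sup>2 / ((1 + \<tau> * r) * (1 + \<tau>)\<^sup>2)"
    using b by (simp add: divide_simps power2_eq_square) (simp add: algebra_simps)
  moreover have "(- \<tau>) * (1 - r)\<^sup>2 / ((1 + \<tau> * r) * (1 + \<tau>)\<^sup>2) \<le> 1 * (1 - r)\<^sup>2 / ((1 - t) * (1 - t)\<^sup>2)"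
    using b \<tau> by (intro frac_le mult_mono power_mono mult_nonneg_nonneg mult_pos_pos mult_right_mono) auto
  ultimately have 2: "(r - 1) / ((1 + \<tau> * r) * (1 + \<tau>)) \<le> (r - 1) / (1 + \<tau>)\<^sup>2 + (1 - r)\<^sup>2 / (1 - t) ^ 3"
    by (simp add: power3_eq_cube power2_eq_square mult.assoc)
  show ?thesis
    using 1 2 unfolding \<rho>_def[symmetric] split by simp
qed

lemma tendsto_scaled_arg:
  fixes v :: complex
  assumes "\<sigma> > 0" "v \<noteq> 0"
  shows "filterlim (\<lambda>n. v / of_real (\<sigma> * sqrt (real n))) (at 0) sequentially"
proof -
  have "filterlim (\<lambda>n. \<sigma> * sqrt (real n)) at_top sequentially"
    using assms by real_asymp
  then have "filterlim (\<lambda>n. complex_of_real (\<sigma> * sqrt (real n))) at_infinity sequentially"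
    by (rule filterlim_compose[OF filterlim_of_real_at_infinity])
  then have "(\<lambda>n. v / of_real (\<sigma> * sqrt (real n))) \<longlonglongrightarrow> 0"
    by (intro tendsto_divide_0[OF tendsto_const])
  moreover have "\<forall>\<^sub>F n in sequentially. v / of_real (\<sigma> * sqrt (real n)) \<noteq> 0"
    using eventually_gt_at_top[of 0] by eventually_elim (use assms in auto)
  ultimately show ?thesis by (simp add: filterlim_at)
qed

text \<open>Taylor expansion of \<open>moebdiff \<tau> (exp u)\<close> at u = 0, with linear
  coefficient 1 / (1 + \<tau>)^2 and quadratic coefficient (1 - \<tau>) / (2 (1 + \<tau>)^3). The
  first limit serves the cross terms, which carry sqrt n; the second serves the terms carrying n,
  once their linear part is removed.\<close>

lemma tendsto_moebdiff:
  fixes v :: complex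
  assumes \<tau>: "\<bar>\<tau>\<bar> < 1" and \<sigma>: "\<sigma> > 0" and v: "v \<noteq> 0"
  defines "u \<equiv> \<lambda>n. v / of_real (\<sigma> * sqrt (real n))"
  shows "(\<lambda>n. of_real (sqrt n) * moebdiff \<tau> (exp (u n))) \<longlonglongrightarrow> v / (of_real \<sigma> * (1 + of_real \<tau>)\<^sup>2)" (is ?A)
    and "(\<lambda>n. of_nat n * (moebdiff \<tau> (exp (u n)) - u n / (1 + of_real \<tau>)\<^sup>2)) \<longlonglongrightarrow>
           v\<^sup>2 / (2 * (of_real \<sigma>)\<^sup>2) * ((1 - of_real \<tau>) / (1 + of_real \<tau>) ^ 3)" (is ?B)
proof -
  define T where "T = complex_of_real \<tau>"
  have T: "1 + T \<noteq> 0" using one_plus_nonzero[of \<tau> 1] \<tau> by (simp add: T_def)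
  have u: "filterlim u (at 0) sequentially"
    unfolding u_def by (rule tendsto_scaled_arg[OF \<sigma> v])
  then have u0: "u \<longlonglongrightarrow> 0" by (simp add: filterlim_at)
  have unz: "\<forall>\<^sub>F n in sequentially. u n \<noteq> 0 \<and> 1 + T * exp (u n) \<noteq> 0"
  proof (rule eventually_conj)
    show "\<forall>\<^sub>F n in sequentially. u n \<noteq> 0" using u by (simp add: filterlim_at)
    have "(\<lambda>n. 1 + T * exp (u n)) \<longlonglongrightarrow> 1 + T * exp 0" by (intro tendsto_intros u0)
    then show "\<forall>\<^sub>F n in sequentially. 1 + T * exp (u n) \<noteq> 0"
      using T by (intro tendsto_imp_eventually_ne) auto
  qed
  note E1 = filterlim_compose[OF tendsto_expm1_over u] and E2 = filterlim_compose[OF tendsto_expm1m_over u]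
  have lim1: "(\<lambda>n. v / of_real \<sigma> * ((exp (u n) - 1) / u n / ((1 + T * exp (u n)) * (1 + T)))) \<longlonglongrightarrow> v / of_real \<sigma> * (1 / ((1 + T * exp 0) * (1 + T)))"
    using T by (intro tendsto_intros E1 u0) auto
  show ?A
  proof (rule Lim_transform_eventually)
    show "(\<lambda>n. v / of_real \<sigma> * ((exp (u n) - 1) / u n / ((1 + T * exp (u n)) * (1 + T)))) \<longlonglongrightarrow> v / (of_real \<sigma> * (1 + of_real \<tau>)\<^sup>2)"
      using lim1 by (simp add: T_def power2_eq_square)
    show "\<forall>\<^sub>F n in sequentially. v / of_real \<sigma> * ((exp (u n) - 1) / u n / ((1 + T * exp (u n)) * (1 + T))) = of_real (sqrt n) * moebdiff \<tau> (exp (u n))"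
      using eventually_gt_at_top[of 0]
    proof eventually_elim
      case (elim n)
      then have "v / of_real \<sigma> = of_real (sqrt n) * u n" "u n \<noteq> 0" using \<sigma> v by (auto simp: u_def)
      then show ?case by (simp add: moebdiff_def T_def)
    qed
  qed
  \<comment> \<open>The remainder is split exactly into multiples of exp u - 1 - u and (exp u -
    1)^2, whose quotients by u^2 have known limits.\<close>
  have lim2: "(\<lambda>n. (v / of_real \<sigma>)\<^sup>2 * ((exp (u n) - 1 - u n) / (u n)\<^sup>2 / (1 + T)\<^sup>2
      - T * ((exp (u n) - 1) / u n)\<^sup>2 / ((1 + T * exp (u n)) * (1 + T)\<^sup>2)))
     \<longlonglongrightarrow> (v / of_real \<sigma>)\<^sup>2 * (1 / 2 / (1 + T)\<^sup>2 - T * 1\<^sup>2 / ((1 + T * exp 0) * (1 + T)\<^sup>2))"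
    using T by (intro tendsto_intros E1 E2 u0) auto
  have val: "(v / of_real \<sigma>)\<^sup>2 * (1 / 2 / (1 + T)\<^sup>2 - T * 1\<^sup>2 / ((1 + T * exp 0) * (1 + T)\<^sup>2))
     = v\<^sup>2 / (2 * (of_real \<sigma>)\<^sup>2) * ((1 - T) / (1 + T) ^ 3)"
  proof -
    have "1 / 2 / (1 + T)\<^sup>2 - T * 1\<^sup>2 / ((1 + T * exp 0) * (1 + T)\<^sup>2) = (1 - T) / (1 + T) ^ 3 / 2"
    proof -
      have "1 / 2 / A\<^sup>2 - T / (A * A\<^sup>2) = (A - 2 * T) / A ^ 3 / 2" if "A \<noteq> 0" for A
        using that by (simp add: field_simps power2_eq_square power3_eq_cube)
      from this[OF T] show ?thesis by simp
    qed
    then show ?thesis by (simp add: power_divide)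
  qed
  show ?B
  proof (rule Lim_transform_eventually)
    show "(\<lambda>n. (v / of_real \<sigma>)\<^sup>2 * ((exp (u n) - 1 - u n) / (u n)\<^sup>2 / (1 + T)\<^sup>2
      - T * ((exp (u n) - 1) / u n)\<^sup>2 / ((1 + T * exp (u n)) * (1 + T)\<^sup>2))) \<longlonglongrightarrow> v\<^sup>2 / (2 * (of_real \<sigma>)\<^sup>2) * ((1 - of_real \<tau>) / (1 + of_real \<tau>) ^ 3)"
      using lim2 unfolding val by (simp add: T_def)
    show "\<forall>\<^sub>F n in sequentially. (v / of_real \<sigma>)\<^sup>2 * ((exp (u n) - 1 - u n) / (u n)\<^sup>2 / (1 + T)\<^sup>2
      - T * ((exp (u n) - 1) / u n)\<^sup>2 / ((1 + T * exp (u n)) * (1 + T)\<^sup>2)) = of_nat n * (moebdiff \<tau> (exp (u n)) - u n / (1 + of_real \<tau>)\<^sup>2)"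
      using eventually_gt_at_top[of 0] unz
    proof eventually_elim
      case (elim n)
      then have vs: "v / of_real \<sigma> = of_real (sqrt n) * u n" using \<sigma> v by (auto simp: u_def)
      have sq: "(complex_of_real (sqrt n))\<^sup>2 = of_nat n" by (simp flip: of_real_power)
      have alg: "(r - 1 - w) / (1 + T)\<^sup>2 - T * (r - 1)\<^sup>2 / ((1 + T * r) * (1 + T)\<^sup>2) = (r - 1) / ((1 + T * r) * (1 + T)) - w / (1 + T)\<^sup>2"
        if "1 + T * r \<noteq> 0" for r w
        using that T by (simp add: divide_simps power2_eq_square) (simp add: algebra_simps)
      have "(u n)\<^sup>2 * ((exp (u n) - 1 - u n) / (u n)\<^sup>2 / (1 + T)\<^sup>2 - T * ((exp (u n) - 1) / u n)\<^sup>2 / ((1 + T * exp (u n)) * (1 + T)\<^sup>2))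
        = (exp (u n) - 1 - u n) / (1 + T)\<^sup>2 - T * (exp (u n) - 1)\<^sup>2 / ((1 + T * exp (u n)) * (1 + T)\<^sup>2)"
      proof -
        have "w\<^sup>2 * (a / w\<^sup>2 / b - T * (c / w)\<^sup>2 / d) = a / b - T * c\<^sup>2 / d" if "w \<noteq> 0" for w a b c d :: complex
          using that by (simp add: right_diff_distrib power_divide)
        then show ?thesis using elim by blast
      qed
      also have "\<dots> = moebdiff \<tau> (exp (u n)) - u n / (1 + T)\<^sup>2"
        using alg elim by (simp add: moebdiff_def T_def)
      finally show ?case unfolding vs power_mult_distrib sq by (simp add: mult.assoc T_def)
    qed
  qed
qed

section \<open>Boundary points of the ellipse\<close>

text \<open>The boundary point is \<open>x0 + i y0\<close>; for local coordinates \<open>a\<close> and \<open>b\<close> of the two arguments,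
  \<open>p\<close> and \<open>d\<close> are half the sum and half the difference of \<open>cnj a\<close> and \<open>b\<close>, because the exponent
  in Mehler's formula is diagonal in the sum and the difference of its arguments.\<close>

locale boundary_point =
  fixes t x0 y0 :: real and p d :: complex
  assumes t: "0 < t" "t < 1"
    and form: "(1 - t\<^sup>2) * (x0\<^sup>2 / (1 + t)\<^sup>2 + y0\<^sup>2 / (1 - t)\<^sup>2) = 1"
begin

text \<open>Square root of the second derivative, at u = 0, of the leading exponent per n as a
  function of u = log \<rho>. After scaling by \<sigma> sqrt n the quadratic term becomes v^2 /
  2.\<close>

definition \<sigma> :: real where
  "\<sigma> = sqrt ((1 - t\<^sup>2) * (x0\<^sup>2 * ((1 - t) / (1 + t) ^ 3) + y0\<^sup>2 * ((1 + t) / (1 - t) ^ 3)))"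

text \<open>The linear coefficient of v in the limit, coming from the cross terms between the
  boundary point and the local displacements.\<close>

definition \<beta> :: complex where
  "\<beta> = of_real (2 * (1 - t\<^sup>2)) * (of_real (x0 / (1 + t)\<^sup>2) * p + \<i> * of_real (y0 / (1 - t)\<^sup>2) * d) / of_real \<sigma>"

definition u :: "nat \<Rightarrow> real \<Rightarrow> complex" where
  "u n s = Complex (- 1) s / of_real (\<sigma> * sqrt n)"

text \<open>Exponent of the Mehler ratio minus n u, which accounts for the power of \<rho> in
  Cauchy's formula. The minus sign before the second square turns (- \<i> y0)^2 into + y0^2.\<close>

definition \<Phi> :: "nat \<Rightarrow> real \<Rightarrow> complex" where
  "\<Phi> n s = of_nat n * (1 - of_real t ^ 2) * ((of_real x0 + p / of_real (sqrt n))\<^sup>2 * moebdiff t (exp (u n s))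
      - (- \<i> * of_real y0 + d / of_real (sqrt n))\<^sup>2 * moebdiff (- t) (exp (u n s))) - of_nat n * u n s"

lemma xy_pos: "x0\<^sup>2 + y0\<^sup>2 > 0"
proof (rule ccontr)
  assume "\<not> ?thesis"
  then have "x0 = 0" "y0 = 0" by (auto simp: sum_power2_gt_zero_iff)
  then show False using form by simp
qed

lemma \<sigma>_sq: "\<sigma>\<^sup>2 = (1 - t\<^sup>2) * (x0\<^sup>2 * ((1 - t) / (1 + t) ^ 3) + y0\<^sup>2 * ((1 + t) / (1 - t) ^ 3))"
  unfolding \<sigma>_def using t_sq[OF t] t
  by (intro real_sqrt_pow2 mult_nonneg_nonneg add_nonneg_nonneg) auto

lemma \<sigma>_pos: "\<sigma> > 0"
proof -
  have "x0\<^sup>2 * ((1 - t) / (1 + t) ^ 3) + y0\<^sup>2 * ((1 + t) / (1 - t) ^ 3) > 0"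
  proof (cases "x0 = 0")
    case True
    then have "y0\<^sup>2 > 0" using xy_pos by simp
    then show ?thesis using True t by simp
  next
    case False
    then have "x0\<^sup>2 * ((1 - t) / (1 + t) ^ 3) > 0" using t by simp
    moreover have "y0\<^sup>2 * ((1 + t) / (1 - t) ^ 3) \<ge> 0" using t by simp
    ultimately show ?thesis by linarith
  qed
  then show ?thesis using t_sq[OF t] by (simp add: \<sigma>_def)
qed

text \<open>Separates orders: in the first summand the linear parts have order sqrt n and cancel by
  \<open>form\<close>; the second stays bounded, since sqrt n meets an increment of order 1 / sqrt
  n.\<close>

lemma \<Phi>_split:
  assumes "n > 0"
  shows "\<Phi> n s = (of_nat n * (of_real (1 - t\<^sup>2) * (of_real (x0\<^sup>2) * moebdiff t (exp (u n s)) + of_real (y0\<^sup>2) * moebdiff (- t) (exp (u n s)))) - of_nat n * u n s)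
    + of_real (1 - t\<^sup>2) * ((2 * of_real x0 * p * of_real (sqrt n) + p\<^sup>2) * moebdiff t (exp (u n s))
        + (2 * \<i> * of_real y0 * d * of_real (sqrt n) - d\<^sup>2) * moebdiff (- t) (exp (u n s)))"
proof -
  define q where "q = complex_of_real (sqrt n)"
  have q: "of_nat n = q\<^sup>2" "q \<noteq> 0" using assms by (auto simp: q_def simp flip: of_real_power)
  have 1: "q\<^sup>2 * (of_real x0 + p / q)\<^sup>2 = q\<^sup>2 * of_real (x0\<^sup>2) + (2 * of_real x0 * p * q + p\<^sup>2)"
    using q(2) by (simp add: power2_eq_square field_simps)
  have 2: "q\<^sup>2 * (- \<i> * of_real y0 + d / q)\<^sup>2 = - (q\<^sup>2 * of_real (y0\<^sup>2)) - (2 * \<i> * of_real y0 * d * q - d\<^sup>2)"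
    using q(2) by (simp add: power2_eq_square field_simps)
  have "q\<^sup>2 * c * (A * m - B * m') - w = c * ((q\<^sup>2 * A) * m - (q\<^sup>2 * B) * m') - w" for A B m m' w c
    by (simp add: algebra_simps)
  then have "\<Phi> n s = (1 - of_real t ^ 2) * ((q\<^sup>2 * of_real (x0\<^sup>2) + (2 * of_real x0 * p * q + p\<^sup>2)) * moebdiff t (exp (u n s))
      - (- (q\<^sup>2 * of_real (y0\<^sup>2)) - (2 * \<i> * of_real y0 * d * q - d\<^sup>2)) * moebdiff (- t) (exp (u n s))) - q\<^sup>2 * u n s"
    unfolding \<Phi>_def q_def[symmetric] q(1) 1[symmetric] 2[symmetric] by (simp only:)
  then show ?thesis
    unfolding q_def[symmetric] q(1) by (simp add: algebra_simps)
qed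

lemma tendsto_\<Phi>:
  "(\<lambda>n. \<Phi> n s) \<longlonglongrightarrow> \<beta> * Complex (- 1) s + (Complex (- 1) s)\<^sup>2 / 2"
proof -
  define v where "v = Complex (- 1) s"
  have v: "v \<noteq> 0" by (simp add: v_def complex_eq_iff)
  have u: "u n s = v / of_real (\<sigma> * sqrt (real n))" for n by (simp add: u_def v_def)
  note A = tendsto_moebdiff(1)[OF _ \<sigma>_pos v, folded u] and B = tendsto_moebdiff(2)[OF _ \<sigma>_pos v, folded u]
  have At: "(\<lambda>n. of_real (sqrt n) * moebdiff t (exp (u n s))) \<longlonglongrightarrow> v / (of_real \<sigma> * (1 + of_real t)\<^sup>2)"
    and Am: "(\<lambda>n. of_real (sqrt n) * moebdiff (- t) (exp (u n s))) \<longlonglongrightarrow> v / (of_real \<sigma> * (1 - of_real t)\<^sup>2)"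
    using A[of t] A[of "- t"] t by simp_all
  have Bt: "(\<lambda>n. of_nat n * (moebdiff t (exp (u n s)) - u n s / (1 + of_real t)\<^sup>2)) \<longlonglongrightarrow> v\<^sup>2 / (2 * (of_real \<sigma>)\<^sup>2) * ((1 - of_real t) / (1 + of_real t) ^ 3)"
    and Bm: "(\<lambda>n. of_nat n * (moebdiff (- t) (exp (u n s)) - u n s / (1 - of_real t)\<^sup>2)) \<longlonglongrightarrow> v\<^sup>2 / (2 * (of_real \<sigma>)\<^sup>2) * ((1 + of_real t) / (1 - of_real t) ^ 3)"
    using B[of t] B[of "- t"] t by simp_all
  have "filterlim (\<lambda>n. sqrt (real n)) at_top sequentially" by real_asymp
  then have inv: "(\<lambda>n. 1 / complex_of_real (sqrt n)) \<longlonglongrightarrow> 0"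
    by (intro tendsto_divide_0[OF tendsto_const] filterlim_compose[OF filterlim_of_real_at_infinity])
  have Ct: "(\<lambda>n. 1 / of_real (sqrt n) * (of_real (sqrt n) * moebdiff t (exp (u n s)))) \<longlonglongrightarrow> 0"
    and Cm: "(\<lambda>n. 1 / of_real (sqrt n) * (of_real (sqrt n) * moebdiff (- t) (exp (u n s)))) \<longlonglongrightarrow> 0"
    using tendsto_mult[OF inv At] tendsto_mult[OF inv Am] by simp_all
  let ?L = "of_real (1 - t\<^sup>2) * (of_real (x0\<^sup>2) * (v\<^sup>2 / (2 * (of_real \<sigma>)\<^sup>2) * ((1 - of_real t) / (1 + of_real t) ^ 3))
       + of_real (y0\<^sup>2) * (v\<^sup>2 / (2 * (of_real \<sigma>)\<^sup>2) * ((1 + of_real t) / (1 - of_real t) ^ 3)))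
     + of_real (1 - t\<^sup>2) * ((2 * of_real x0 * p * (v / (of_real \<sigma> * (1 + of_real t)\<^sup>2)) + p\<^sup>2 * 0)
       + (2 * \<i> * of_real y0 * d * (v / (of_real \<sigma> * (1 - of_real t)\<^sup>2)) - d\<^sup>2 * 0))"
  let ?F = "\<lambda>n. of_real (1 - t\<^sup>2) * (of_real (x0\<^sup>2) * (of_nat n * (moebdiff t (exp (u n s)) - u n s / (1 + of_real t)\<^sup>2))
       + of_real (y0\<^sup>2) * (of_nat n * (moebdiff (- t) (exp (u n s)) - u n s / (1 - of_real t)\<^sup>2)))
     + of_real (1 - t\<^sup>2) * ((2 * of_real x0 * p * (of_real (sqrt n) * moebdiff t (exp (u n s))) + p\<^sup>2 * (1 / of_real (sqrt n) * (of_real (sqrt n) * moebdiff t (exp (u n s)))))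
       + (2 * \<i> * of_real y0 * d * (of_real (sqrt n) * moebdiff (- t) (exp (u n s))) - d\<^sup>2 * (1 / of_real (sqrt n) * (of_real (sqrt n) * moebdiff (- t) (exp (u n s))))))"
  have lim: "?F \<longlonglongrightarrow> ?L"
    by (intro tendsto_intros At Am Bt Bm Ct Cm)
  have L: "?L = \<beta> * v + v\<^sup>2 / 2"
  proof -
    have s2: "of_real (1 - t\<^sup>2) * (of_real (x0\<^sup>2) * ((1 - of_real t) / (1 + of_real t) ^ 3) + of_real (y0\<^sup>2) * ((1 + of_real t) / (1 - of_real t) ^ 3)) = (complex_of_real \<sigma>)\<^sup>2"
      unfolding of_real_power[symmetric] \<sigma>_sq by simp
    have "of_real (1 - t\<^sup>2) * (of_real (x0\<^sup>2) * (v\<^sup>2 / (2 * (of_real \<sigma>)\<^sup>2) * ((1 - of_real t) / (1 + of_real t) ^ 3))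
       + of_real (y0\<^sup>2) * (v\<^sup>2 / (2 * (of_real \<sigma>)\<^sup>2) * ((1 + of_real t) / (1 - of_real t) ^ 3)))
       = v\<^sup>2 / (2 * (of_real \<sigma>)\<^sup>2) * (of_real (1 - t\<^sup>2) * (of_real (x0\<^sup>2) * ((1 - of_real t) / (1 + of_real t) ^ 3) + of_real (y0\<^sup>2) * ((1 + of_real t) / (1 - of_real t) ^ 3)))"
      by (simp only: distrib_left mult_ac)
    also have "\<dots> = v\<^sup>2 / 2" unfolding s2 using \<sigma>_pos by simp
    finally have 1: "of_real (1 - t\<^sup>2) * (of_real (x0\<^sup>2) * (v\<^sup>2 / (2 * (of_real \<sigma>)\<^sup>2) * ((1 - of_real t) / (1 + of_real t) ^ 3))
       + of_real (y0\<^sup>2) * (v\<^sup>2 / (2 * (of_real \<sigma>)\<^sup>2) * ((1 + of_real t) / (1 - of_real t) ^ 3))) = v\<^sup>2 / 2" .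
    have 2: "of_real (1 - t\<^sup>2) * ((2 * of_real x0 * p * (v / (of_real \<sigma> * (1 + of_real t)\<^sup>2)) + p\<^sup>2 * 0)
       + (2 * \<i> * of_real y0 * d * (v / (of_real \<sigma> * (1 - of_real t)\<^sup>2)) - d\<^sup>2 * 0)) = \<beta> * v"
      unfolding \<beta>_def by (simp add: divide_inverse algebra_simps)
    show ?thesis unfolding 1 2 by (rule add.commute)
  qed
  have ev: "\<forall>\<^sub>F n in sequentially. ?F n = \<Phi> n s"
    using eventually_gt_at_top[of 0]
  proof eventually_elim
    case (elim n)
    have f: "of_real (1 - t\<^sup>2) * (of_real (x0\<^sup>2) / (1 + of_real t)\<^sup>2 + of_real (y0\<^sup>2) / (1 - of_real t)\<^sup>2) = (1::complex)"
      using arg_cong[OF form, of complex_of_real] by simp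
    \<comment> \<open>The linear Taylor parts are pulled out together; by \<open>form\<close> their
      coefficients add up to 1, so they amount to exactly n u.\<close>
    have g: "c * (X * (N * (m - w / e)) + Y * (N * (m' - w / e'))) = N * (c * (X * m + Y * m')) - N * (w * (c * (X / e + Y / e')))"
      for c X Y N m m' w e e' :: complex
      by (simp add: divide_inverse algebra_simps)
    have h: "1 / of_real (sqrt n) * (of_real (sqrt n) * m) = m" for m :: complex using elim by simp
    have k: "(X * p * (r * m) + p\<^sup>2 * m) + (Y * d * (r * m') - d\<^sup>2 * m') = (X * p * r + p\<^sup>2) * m + (Y * d * r - d\<^sup>2) * m'" for X Y m m' r :: complex
      by (simp add: algebra_simps)
    show ?case
      unfolding \<Phi>_split[OF elim] g f h k by (simp only: mult_1_right)
  qed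
  show ?thesis
    using Lim_transform_eventually[OF lim ev] unfolding L by (simp only: v_def)
qed

text \<open>A Gaussian majorant on the whole circle, uniform in n, so no separate estimate away from
  \<rho> = 1 is required. The conditions on n travel with the bound because later estimates reuse
  them.\<close>

lemma Re_\<Phi>_le:
  "\<exists>C c n0. c > 0 \<and> (\<forall>n\<ge>n0. \<forall>s. n > 0 \<and> \<sigma> * sqrt n \<ge> 1 \<and> (\<bar>s\<bar> \<le> pi * (\<sigma> * sqrt n) \<longrightarrow> Re (\<Phi> n s) \<le> C - c * s\<^sup>2))"
proof -
  \<comment> \<open>\<open>M\<close> weighs both increments, \<open>K\<close> controls the radial
    error, \<open>B\<close> the cross terms and \<open>c\<close> the angular decay; exp (-1) bounds
    the radius from below once \<sigma> sqrt n \<ge> 1.\<close>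
  define M where "M = (1 - t\<^sup>2) * (x0\<^sup>2 + y0\<^sup>2)"
  define K where "K = M / (1 - t) ^ 3"
  define B where "B = (1 - t\<^sup>2) * ((2 * \<bar>x0\<bar> * norm p + (norm p)\<^sup>2) + (2 * \<bar>y0\<bar> * norm d + (norm d)\<^sup>2)) / (\<sigma> * (1 - t)\<^sup>2)"
  define c where "c = M * exp (- 1) * (1 - t) / 144 / \<sigma>\<^sup>2"
  have M: "M > 0" using xy_pos t_sq[OF t] by (simp add: M_def)
  have K: "K > 0" using M t by (simp add: K_def)
  have c: "c > 0" using M t \<sigma>_pos by (simp add: c_def)
  have B: "B \<ge> 0" using t_sq[OF t] \<sigma>_pos t by (simp add: B_def)
  define n0 where "n0 = nat \<lceil>1 / \<sigma>\<^sup>2\<rceil> + 1"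
  have "n > 0 \<and> \<sigma> * sqrt n \<ge> 1 \<and> (\<bar>s\<bar> \<le> pi * (\<sigma> * sqrt n) \<longrightarrow> Re (\<Phi> n s) \<le> (B + (1 + K) / \<sigma>\<^sup>2 + B\<^sup>2 / (2 * c)) - c / 2 * s\<^sup>2)"
    if n: "n \<ge> n0" for n s
  proof (intro conjI impI)
    show n0: "n > 0" using n by (simp add: n0_def)
    define N where "N = \<sigma> * sqrt n"
    have "real n \<ge> 1 / \<sigma>\<^sup>2" using n by (simp add: n0_def) linarith
    then have "\<sigma>\<^sup>2 * real n \<ge> 1" using \<sigma>_pos by (simp add: field_simps)
    then have "(\<sigma> * sqrt n)\<^sup>2 \<ge> 1" by (simp add: power_mult_distrib)
    then show N1: "\<sigma> * sqrt n \<ge> 1" using \<sigma>_pos by (metis abs_of_nonneg less_eq_real_def mult_nonneg_nonneg of_nat_0_le_iff one_le_power power2_le_imp_le power_one real_sqrt_ge_zero)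
    assume s: "\<bar>s\<bar> \<le> pi * (\<sigma> * sqrt n)"
    have N: "N \<ge> 1" "N > 0" using N1 by (auto simp: N_def)
    have Nsq: "N\<^sup>2 = \<sigma>\<^sup>2 * n" by (simp add: N_def power_mult_distrib)
    define r where "r = exp (- (1 / N))"
    define \<theta> where "\<theta> = s / N"
    have r: "0 < r" "r \<le> 1" "r \<ge> exp (- 1)" using N by (auto simp: r_def)
    have \<theta>: "\<bar>\<theta>\<bar> \<le> pi" using s N by (simp add: \<theta>_def N_def field_simps)
    define \<rho> where "\<rho> = exp (u n s)"
    have un: "u n s = Complex (- (1 / N)) \<theta>" using N by (simp add: u_def N_def[symmetric] \<theta>_def complex_eq_iff Re_divide_of_real Im_divide_of_real del: of_real_mult)
    have \<rho>: "\<rho> = of_real r * cis \<theta>" unfolding \<rho>_def un by (simp add: exp_eq_polar r_def)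
    have n\<rho>: "norm \<rho> \<le> 1" using r by (simp add: \<rho> norm_mult)
    have u1: "norm (\<rho> - 1) \<le> (1 + \<bar>s\<bar>) / N"
    proof -
      have "norm (\<rho> - 1) \<le> norm (u n s)" unfolding \<rho>_def using N by (intro norm_expm1_le) (simp add: un)
      also have "\<dots> \<le> \<bar>- (1 / N)\<bar> + \<bar>\<theta>\<bar>" using cmod_le[of "u n s"] by (simp add: un)
      also have "\<dots> = (1 + \<bar>s\<bar>) / N" using N by (simp add: \<theta>_def add_divide_distrib)
      finally show ?thesis .
    qed
    have md: "norm (moebdiff \<tau> \<rho>) \<le> (1 + \<bar>s\<bar>) / (N * (1 - t)\<^sup>2)" if "\<bar>\<tau>\<bar> \<le> t" for \<tau>
    proof -
      have "norm (moebdiff \<tau> \<rho>) \<le> norm (\<rho> - 1) / (1 - t)\<^sup>2" by (rule norm_moebdiff_le[OF that t(2) n\<rho>])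
      also have "\<dots> \<le> ((1 + \<bar>s\<bar>) / N) / (1 - t)\<^sup>2" using u1 by (intro divide_right_mono) auto
      finally show ?thesis by simp
    qed
    have sn: "sqrt n \<ge> 1" using n0 by simp
    have cross: "Re (of_real (1 - t\<^sup>2) * ((2 * of_real x0 * p * of_real (sqrt n) + p\<^sup>2) * moebdiff t \<rho>
        + (2 * \<i> * of_real y0 * d * of_real (sqrt n) - d\<^sup>2) * moebdiff (- t) \<rho>)) \<le> B * (1 + \<bar>s\<bar>)"
    proof -
      have a1: "norm (2 * of_real x0 * p * of_real (sqrt n) + p\<^sup>2) \<le> sqrt n * (2 * \<bar>x0\<bar> * norm p + (norm p)\<^sup>2)"
        using norm_triangle_ineq[of "2 * of_real x0 * p * of_real (sqrt n)" "p\<^sup>2"] mult_right_mono[OF sn, of "(norm p)\<^sup>2"]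
        by (simp add: norm_mult norm_power algebra_simps)
      have a2: "norm (2 * \<i> * of_real y0 * d * of_real (sqrt n) - d\<^sup>2) \<le> sqrt n * (2 * \<bar>y0\<bar> * norm d + (norm d)\<^sup>2)"
        using norm_triangle_ineq4[of "2 * \<i> * of_real y0 * d * of_real (sqrt n)" "d\<^sup>2"] mult_right_mono[OF sn, of "(norm d)\<^sup>2"]
        by (simp add: norm_mult norm_power algebra_simps)
      have "Re (of_real (1 - t\<^sup>2) * ((2 * of_real x0 * p * of_real (sqrt n) + p\<^sup>2) * moebdiff t \<rho>
        + (2 * \<i> * of_real y0 * d * of_real (sqrt n) - d\<^sup>2) * moebdiff (- t) \<rho>))
        \<le> norm (of_real (1 - t\<^sup>2) * ((2 * of_real x0 * p * of_real (sqrt n) + p\<^sup>2) * moebdiff t \<rho>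
        + (2 * \<i> * of_real y0 * d * of_real (sqrt n) - d\<^sup>2) * moebdiff (- t) \<rho>))"
        by (rule complex_Re_le_cmod)
      also have "\<dots> \<le> (1 - t\<^sup>2) * ((sqrt n * (2 * \<bar>x0\<bar> * norm p + (norm p)\<^sup>2)) * ((1 + \<bar>s\<bar>) / (N * (1 - t)\<^sup>2))
          + (sqrt n * (2 * \<bar>y0\<bar> * norm d + (norm d)\<^sup>2)) * ((1 + \<bar>s\<bar>) / (N * (1 - t)\<^sup>2)))"
      proof -
        have n1: "norm (of_real (1 - t\<^sup>2) * z) = (1 - t\<^sup>2) * norm z" for z :: complex
          using t_sq[OF t] by (simp only: norm_mult norm_of_real)
        have n2: "norm (z * m + z' * m') \<le> Z * E + Z' * E" if "norm z \<le> Z" "norm z' \<le> Z'" "norm m \<le> E" "norm m' \<le> E" for z z' m m' :: complex and Z Z' E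
          using that order_trans[OF norm_ge_zero that(1)] order_trans[OF norm_ge_zero that(2)]
          by (intro order_trans[OF norm_triangle_ineq] add_mono; simp add: norm_mult mult_mono)
        show ?thesis
          unfolding n1 using t_sq[OF t] t by (intro mult_left_mono n2 a1 a2 md) auto
      qed
      also have "\<dots> = B * (1 + \<bar>s\<bar>)"
        using \<sigma>_pos n0 t unfolding B_def N_def by (simp add: field_simps)
      finally show ?thesis .
    qed
    have main: "real n * ((1 - t\<^sup>2) * (x0\<^sup>2 * Re (moebdiff t \<rho>) + y0\<^sup>2 * Re (moebdiff (- t) \<rho>))) + n / N \<le> (1 + K) / \<sigma>\<^sup>2 - c * s\<^sup>2"
    proof -
      define q where "q = (1 - r)\<^sup>2 / (1 - t) ^ 3 - r * (1 - t) * \<theta>\<^sup>2 / 144"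
      have m1: "Re (moebdiff t \<rho>) \<le> (r - 1) / (1 + t)\<^sup>2 + q" and m2: "Re (moebdiff (- t) \<rho>) \<le> (r - 1) / (1 - t)\<^sup>2 + q"
        using Re_moebdiff_le[of t t r \<theta>] Re_moebdiff_le[of "- t" t r \<theta>] t r \<theta> unfolding \<rho> q_def by simp_all
      have "(1 - t\<^sup>2) * (x0\<^sup>2 * Re (moebdiff t \<rho>) + y0\<^sup>2 * Re (moebdiff (- t) \<rho>))
          \<le> (1 - t\<^sup>2) * (x0\<^sup>2 * ((r - 1) / (1 + t)\<^sup>2 + q) + y0\<^sup>2 * ((r - 1) / (1 - t)\<^sup>2 + q))"
        using m1 m2 t_sq[OF t] by (intro mult_left_mono add_mono) auto
      also have "\<dots> = (r - 1) * ((1 - t\<^sup>2) * (x0\<^sup>2 / (1 + t)\<^sup>2 + y0\<^sup>2 / (1 - t)\<^sup>2)) + M * q"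
        by (simp add: M_def divide_inverse algebra_simps)
      also have "\<dots> = (r - 1) + M * q" by (simp only: form mult_1_right)
      also have "M * q = K * (1 - r)\<^sup>2 - M * r * (1 - t) / 144 * \<theta>\<^sup>2"
        by (simp add: q_def K_def right_diff_distrib)
      finally have 1: "(1 - t\<^sup>2) * (x0\<^sup>2 * Re (moebdiff t \<rho>) + y0\<^sup>2 * Re (moebdiff (- t) \<rho>)) \<le> (r - 1) + K * (1 - r)\<^sup>2 - M * r * (1 - t) / 144 * \<theta>\<^sup>2"
        by simp
      have r1: "1 - r \<le> 1 / N" using exp_ge_add_one_self[of "- (1 / N)"] by (simp add: r_def)
      have 2: "(1 - r)\<^sup>2 \<le> 1 / N\<^sup>2" using power_mono[OF r1, of 2] r by (simp add: power_divide)
      \<comment> \<open>The comparison exp (- x) \<le> 1 / (1 + x) at x = 1 / N leaves an error of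
        order 1 / N^2; multiplied by n this is the constant 1 / \<sigma>^2.\<close>
      have 3: "r - 1 + 1 / N \<le> 1 / N\<^sup>2"
      proof -
        have "r = inverse (exp (1 / N))" by (simp add: r_def exp_minus)
        also have "\<dots> \<le> inverse (1 + 1 / N)" using N exp_ge_add_one_self[of "1 / N"] by (intro le_imp_inverse_le) (auto simp: add_pos_pos)
        also have "\<dots> = N / (N + 1)" using N by (simp add: field_simps)
        also have "\<dots> \<le> 1 - 1 / N + 1 / N\<^sup>2"
          using N by (simp add: field_simps power2_eq_square)
        finally show ?thesis by simp
      qed
      have 4: "M * r * (1 - t) / 144 * \<theta>\<^sup>2 \<ge> M * exp (- 1) * (1 - t) / 144 * \<theta>\<^sup>2"
        using M r t by (intro mult_right_mono divide_right_mono mult_left_mono) auto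
      have "(r - 1) + K * (1 - r)\<^sup>2 - M * r * (1 - t) / 144 * \<theta>\<^sup>2 + 1 / N \<le> (1 + K) * (1 / N\<^sup>2) - M * exp (- 1) * (1 - t) / 144 * \<theta>\<^sup>2"
      proof -
        have "K * (1 - r)\<^sup>2 \<le> K * (1 / N\<^sup>2)" using mult_left_mono[OF 2, of K] K by simp
        moreover have "(1 + K) * (1 / N\<^sup>2) = 1 / N\<^sup>2 + K * (1 / N\<^sup>2)" by (simp only: distrib_right mult_1_left)
        ultimately show ?thesis using 3 4 by linarith
      qed
      with 1 have "(1 - t\<^sup>2) * (x0\<^sup>2 * Re (moebdiff t \<rho>) + y0\<^sup>2 * Re (moebdiff (- t) \<rho>)) + 1 / N \<le> (1 + K) * (1 / N\<^sup>2) - M * exp (- 1) * (1 - t) / 144 * \<theta>\<^sup>2"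
        by linarith
      then have "real n * ((1 - t\<^sup>2) * (x0\<^sup>2 * Re (moebdiff t \<rho>) + y0\<^sup>2 * Re (moebdiff (- t) \<rho>)) + 1 / N) \<le> real n * ((1 + K) * (1 / N\<^sup>2) - M * exp (- 1) * (1 - t) / 144 * \<theta>\<^sup>2)"
        by (rule mult_left_mono) simp
      also have "\<dots> = (1 + K) / \<sigma>\<^sup>2 - c * s\<^sup>2"
        using n0 \<sigma>_pos unfolding \<theta>_def power_divide Nsq c_def by (simp add: field_simps)
      finally show ?thesis by (simp add: distrib_left)
    qed
    have "Re (\<Phi> n s) = (real n * ((1 - t\<^sup>2) * (x0\<^sup>2 * Re (moebdiff t \<rho>) + y0\<^sup>2 * Re (moebdiff (- t) \<rho>))) + n / N)
       + Re (of_real (1 - t\<^sup>2) * ((2 * of_real x0 * p * of_real (sqrt n) + p\<^sup>2) * moebdiff t \<rho>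
        + (2 * \<i> * of_real y0 * d * of_real (sqrt n) - d\<^sup>2) * moebdiff (- t) \<rho>))"
    proof -
      have "Re (of_nat n * (of_real (1 - t\<^sup>2) * (of_real (x0\<^sup>2) * moebdiff t \<rho> + of_real (y0\<^sup>2) * moebdiff (- t) \<rho>)) - of_nat n * u n s)
         = real n * ((1 - t\<^sup>2) * (x0\<^sup>2 * Re (moebdiff t \<rho>) + y0\<^sup>2 * Re (moebdiff (- t) \<rho>))) + n / N"
        unfolding un by (simp del: of_real_power of_real_diff)
      then show ?thesis unfolding \<Phi>_split[OF n0] \<rho>_def[symmetric] by simp
    qed
    also have "\<dots> \<le> ((1 + K) / \<sigma>\<^sup>2 - c * s\<^sup>2) + B * (1 + \<bar>s\<bar>)"
      using main cross by (rule add_mono)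
    also have "\<dots> \<le> (B + (1 + K) / \<sigma>\<^sup>2 + B\<^sup>2 / (2 * c)) - c / 2 * s\<^sup>2"
    proof -
      \<comment> \<open>Half of the quadratic decay absorbs the linear term
        \<open>B * \<bar>s\<bar>\<close>, at the cost of the constant B^2 / (2 c).\<close>
      have "0 \<le> c / 2 * (\<bar>s\<bar> - B / c)\<^sup>2" using c by simp
      also have "\<dots> = c / 2 * s\<^sup>2 - B * \<bar>s\<bar> + B\<^sup>2 / (2 * c)"
        using c by (simp add: power2_diff field_simps power2_eq_square)
      finally show ?thesis by (simp add: distrib_left)
    qed
    finally show "Re (\<Phi> n s) \<le> (B + (1 + K) / \<sigma>\<^sup>2 + B\<^sup>2 / (2 * c)) - c / 2 * s\<^sup>2" .
  qed
  then show ?thesis using c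
    by (intro exI[of _ "B + (1 + K) / \<sigma>\<^sup>2 + B\<^sup>2 / (2 * c)"] exI[of _ "c / 2"] exI[of _ n0]) auto
qed

end

section \<open>The rescaled circle integral and its limit\<close>

context boundary_point
begin

text \<open>\<open>X\<close> and \<open>Y\<close> become the conjugated first and the second
  argument of the kernel once \<open>p\<close> and \<open>d\<close> are chosen from the local
  coordinates.\<close>

definition X :: "nat \<Rightarrow> complex" where
  "X n = of_real x0 - \<i> * of_real y0 + (p + d) / of_real (sqrt n)"

definition Y :: "nat \<Rightarrow> complex" where
  "Y n = of_real x0 + \<i> * of_real y0 + (p - d) / of_real (sqrt n)"

text \<open>Extended by zero beyond the circle, so that all n share one domain for dominated
  convergence. The Jacobian 1 / (\<sigma> sqrt n) is grouped with the pole because \<sigma> sqrt n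
  (1 - exp u) tends to -v.\<close>

definition integrand :: "nat \<Rightarrow> real \<Rightarrow> complex" where
  "integrand n s = indicator {- pi..pi} (s / (\<sigma> * sqrt n)) *\<^sub>R
     (csqrt (1 - of_real t ^ 2) / csqrt (1 - of_real t ^ 2 * (exp (u n s))\<^sup>2) * exp (\<Phi> n s) *
      (exp (u n s) / (of_real (\<sigma> * sqrt n) * (1 - exp (u n s)))))"

lemma u_conv: "n > 0 \<Longrightarrow> exp (u n s) = of_real (exp (- (1 / (\<sigma> * sqrt n)))) * cis (s / (\<sigma> * sqrt n))"
proof -
  assume "n > 0"
  then have "u n s = Complex (- (1 / (\<sigma> * sqrt n))) (s / (\<sigma> * sqrt n))"
    by (simp add: u_def complex_eq_iff Re_divide_of_real Im_divide_of_real del: of_real_mult)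
  then show ?thesis by (simp add: exp_eq_polar)
qed

lemma norm_exp_u: "n > 0 \<Longrightarrow> norm (exp (u n s)) = exp (- (1 / (\<sigma> * sqrt n)))"
  by (simp add: u_conv norm_mult)

lemma norm_exp_u_less: "n > 0 \<Longrightarrow> norm (exp (u n s)) < 1"
  using \<sigma>_pos by (simp add: norm_exp_u del: norm_exp_eq_Re)

lemma t_exp_u: "n > 0 \<Longrightarrow> norm (of_real t * exp (u n s)) < 1"
proof -
  assume n: "n > 0"
  have "norm (of_real t * exp (u n s)) = t * norm (exp (u n s))" using t by (simp add: norm_mult del: norm_exp_eq_Re)
  also have "\<dots> < 1 * 1" using t norm_exp_u_less[OF n, of s] by (intro mult_strict_mono) (auto simp del: norm_exp_eq_Re)
  finally show ?thesis by simp
qed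

lemma integrand_continuous:
  assumes "n > 0"
  shows "continuous_on UNIV (\<lambda>s. csqrt (1 - of_real t ^ 2) / csqrt (1 - of_real t ^ 2 * (exp (u n s))\<^sup>2) * exp (\<Phi> n s) *
      (exp (u n s) / (of_real (\<sigma> * sqrt n) * (1 - exp (u n s)))))"
proof -
  have cu: "continuous_on UNIV (u n)"
    unfolding u_def Complex_eq using \<sigma>_pos assms by (intro continuous_intros) auto
  have nz: "1 + of_real t * exp (u n s) \<noteq> 0" "1 + of_real (- t) * exp (u n s) \<noteq> 0" "1 + complex_of_real t \<noteq> 0" "1 + complex_of_real (- t) \<noteq> 0" for s
    using one_plus_nonzero[of t "exp (u n s)"] one_plus_nonzero[of "- t" "exp (u n s)"] one_plus_nonzero[of t 1] one_plus_nonzero[of "- t" 1] norm_exp_u_less[OF assms, of s] t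
    by (auto simp del: norm_exp_eq_Re)
  have c\<Phi>: "continuous_on UNIV (\<Phi> n)"
    unfolding \<Phi>_def moebdiff_def using nz by (intro continuous_intros cu) (auto simp del: of_real_minus)
  have ne1: "exp (u n s) \<noteq> 1" for s using norm_exp_u_less[OF assms, of s] by (metis less_irrefl norm_one)
  have cs: "continuous_on UNIV (\<lambda>s. csqrt (1 - of_real t ^ 2 * (exp (u n s))\<^sup>2))"
  proof (intro continuous_on_compose2[OF continuous_on_csqrt] continuous_intros cu)
    show "(\<lambda>s. 1 - of_real t ^ 2 * (exp (u n s))\<^sup>2) ` UNIV \<subseteq> - \<real>\<^sub>\<le>\<^sub>0"
      using one_minus_notin_nonpos_Reals[OF t_exp_u[OF assms]] by auto
  qed
  show ?thesis
    using \<sigma>_pos assms ne1 one_minus_nonzero[OF t_exp_u[OF assms]]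
    by (intro continuous_intros cu c\<Phi> cs) auto
qed

lemma integrand_measurable: "n > 0 \<Longrightarrow> integrand n \<in> borel_measurable lborel"
proof -
  assume n: "n > 0"
  have [measurable]: "(\<lambda>s. csqrt (1 - of_real t ^ 2) / csqrt (1 - of_real t ^ 2 * (exp (u n s))\<^sup>2) * exp (\<Phi> n s) *
      (exp (u n s) / (of_real (\<sigma> * sqrt n) * (1 - exp (u n s))))) \<in> borel_measurable borel"
    by (rule borel_measurable_continuous_onI[OF integrand_continuous[OF n]])
  show ?thesis unfolding integrand_def[abs_def] by measurable
qed

lemma hcoeff_ratio_eq_integral:
  assumes n: "n > 0"
  shows "(\<Sum>k<n. hcoeff t (kap t n) (X n) (Y n) k) / mehler t (kap t n) (X n) (Y n) 1 =
    of_real (1 / (2 * pi)) * (\<integral>s. integrand n s \<partial>lborel)"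
proof -
  define N where "N = \<sigma> * sqrt n"
  have N: "N > 0" using n \<sigma>_pos by (simp add: N_def)
  define r where "r = exp (- (1 / N))"
  have r: "0 < r" "r < 1" using N by (auto simp: r_def)
  let ?f = "mehler t (kap t n) (X n) (Y n)"
  \<comment> \<open>The exponent is n - 1 because the kernel sums over k < n. Relative to the n u in
    \<Phi> one factor \<rho> is left over; it is the numerator \<open>exp (u n s)\<close> in
    \<open>integrand\<close>.\<close>
  define H where "H \<theta> = ?f (of_real r * cis \<theta>) / ((1 - of_real r * cis \<theta>) * (of_real r * cis \<theta>) ^ (n - 1))" for \<theta>
  have kap: "kap t n \<noteq> 0" using kap_pos[OF t n] by simp
  have "1 < 1 / t" using t by simp
  then have sub: "ball 0 1 \<subseteq> eball (0::complex) (ereal (1 / t))" by auto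
  then have "?f holomorphic_on ball 0 1"
    by (rule holomorphic_on_subset[OF mehler_holomorphic[OF t(1) kap]])
  from partial_sum_eq_circle_integral[OF mehler_has_fps_expansion[OF t(1) kap] \<open>?f holomorphic_on ball 0 1\<close> r, of "n - 1"]
  have S: "(\<Sum>k<n. hcoeff t (kap t n) (X n) (Y n) k) = of_real (1 / (2 * pi)) * integral {- pi..pi} H"
    using n by (simp add: H_def[abs_def] lessThan_Suc_atMost[symmetric])
  have ru: "of_real r * cis (s / N) = exp (u n s)" for s
    using u_conv[OF n, of s] by (simp add: r_def N_def)
  have Hc: "continuous_on UNIV H"
  proof -
    have contf: "continuous_on (cball 0 r) ?f"
      using r by (intro holomorphic_on_imp_continuous_on holomorphic_on_subset[OF \<open>?f holomorphic_on ball 0 1\<close>]) auto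
    have cf: "continuous_on UNIV (\<lambda>\<theta>. ?f (of_real r * cis \<theta>))"
    proof (rule continuous_on_compose2[OF contf])
      show "continuous_on UNIV (\<lambda>\<theta>. of_real r * cis \<theta>)" by (intro continuous_intros)
      show "(\<lambda>\<theta>. of_real r * cis \<theta>) ` UNIV \<subseteq> cball 0 r" using r by (auto simp: norm_mult)
    qed
    have ne: "of_real r * cis \<theta> \<noteq> 1" for \<theta>
    proof
      assume "of_real r * cis \<theta> = 1"
      then have "norm (of_real r * cis \<theta>) = 1" by simp
      then show False using r by (simp add: norm_mult)
    qed
    have "(1 - of_real r * cis \<theta>) * (of_real r * cis \<theta>) ^ (n - 1) \<noteq> 0" for \<theta>
      using ne[of \<theta>] r by (intro no_zero_divisors) auto
    then show ?thesis
      unfolding H_def[abs_def] by (intro continuous_on_divide cf continuous_intros ballI)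
  qed
  have "set_integrable lborel {- pi..pi} H"
    by (intro borel_integrable_atLeastAtMost' continuous_on_subset[OF Hc]) auto
  then have "integral {- pi..pi} H = (\<integral>\<theta>. indicator {- pi..pi} \<theta> *\<^sub>R H \<theta> \<partial>lborel)"
    using set_borel_integral_eq_integral(2)[of "{- pi..pi}" H] by (simp add: set_lebesgue_integral_def)
  also have "\<dots> = \<bar>1 / N\<bar> *\<^sub>R (\<integral>s. indicator {- pi..pi} (0 + 1 / N * s) *\<^sub>R H (0 + 1 / N * s) \<partial>lborel)"
    by (rule lborel_integral_real_affine) (use N in auto)
  also have "\<dots> = (\<integral>s. indicator {- pi..pi} (s / N) *\<^sub>R (H (s / N) / of_real N) \<partial>lborel)"
  proof -
    have "\<bar>1 / N\<bar> *\<^sub>R (e *\<^sub>R h) = e *\<^sub>R (h / of_real N)" for e and h :: complex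
      using N by (simp add: scaleR_conv_of_real divide_inverse)
    moreover have "0 + 1 / N * s = s / N" for s by simp
    ultimately show ?thesis by (simp only: integral_scaleR_right[symmetric])
  qed
  finally have I: "integral {- pi..pi} H = (\<integral>s. indicator {- pi..pi} (s / N) *\<^sub>R (H (s / N) / of_real N) \<partial>lborel)" .
  have "indicator {- pi..pi} (s / N) *\<^sub>R (H (s / N) / of_real N) = ?f 1 * integrand n s" for s
  proof -
    let ?\<rho> = "exp (u n s)"
    have f1: "?f 1 \<noteq> 0"
    proof -
      have "csqrt (1 - of_real t ^ 2 * 1\<^sup>2) \<noteq> 0" using one_minus_nonzero[of t 1] t by simp
      then show ?thesis unfolding mehler_def by simp
    qed
    have PD: "(X n + Y n) / 2 = of_real x0 + p / of_real (sqrt n)" "(X n - Y n) / 2 = - \<i> * of_real y0 + d / of_real (sqrt n)"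
      by (simp_all add: X_def Y_def add_divide_distrib diff_divide_distrib)
    have ratio: "?f ?\<rho> = ?f 1 * (csqrt (1 - of_real t ^ 2) / csqrt (1 - of_real t ^ 2 * ?\<rho>\<^sup>2) * (exp (\<Phi> n s) * ?\<rho> ^ n))"
    proof -
      have pw: "?\<rho> ^ n = exp (of_nat n * u n s)" by (rule exp_of_nat_mult[symmetric])
      have "exp (\<Phi> n s) * ?\<rho> ^ n = exp (of_nat n * (1 - of_real t ^ 2) * ((of_real x0 + p / of_real (sqrt n))\<^sup>2 * moebdiff t (exp (u n s))
      - (- \<i> * of_real y0 + d / of_real (sqrt n))\<^sup>2 * moebdiff (- t) (exp (u n s))))"
        unfolding \<Phi>_def pw exp_add[symmetric] by (simp only: diff_add_cancel)
      then show ?thesis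
        using mehler_ratio[OF t n less_imp_le[OF norm_exp_u_less[OF n, of s]], of "X n" "Y n"] f1 unfolding PD
        by (simp add: field_simps)
    qed
    have pw: "?\<rho> ^ n = ?\<rho> * ?\<rho> ^ (n - 1)" using n by (simp add: power_eq_if)
    have ring: "f * (A * (E * (\<rho> * P))) / (q * P) / M = f * (A * E * (\<rho> / (M * q)))" if "P \<noteq> 0" for f A E \<rho> P q M :: complex
      using that by (simp add: mult.commute)
    have "H (s / N) / of_real N = ?f ?\<rho> / ((1 - ?\<rho>) * ?\<rho> ^ (n - 1)) / of_real N"
      by (simp only: H_def ru)
    also have "\<dots> = ?f 1 * (csqrt (1 - of_real t ^ 2) / csqrt (1 - of_real t ^ 2 * ?\<rho>\<^sup>2) * exp (\<Phi> n s) * (?\<rho> / (of_real N * (1 - ?\<rho>))))"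
      unfolding ratio pw by (rule ring) simp
    finally have e: "H (s / N) / of_real N = ?f 1 * (csqrt (1 - of_real t ^ 2) / csqrt (1 - of_real t ^ 2 * ?\<rho>\<^sup>2) * exp (\<Phi> n s) * (?\<rho> / (of_real N * (1 - ?\<rho>))))" .
    show ?thesis unfolding e integrand_def N_def[symmetric] by (simp only: mult_scaleR_right)
  qed
  then have "integral {- pi..pi} H = ?f 1 * (\<integral>s. integrand n s \<partial>lborel)"
    unfolding I by simp
  moreover have "?f 1 \<noteq> 0"
  proof -
    have "csqrt (1 - of_real t ^ 2 * 1\<^sup>2) \<noteq> 0" using one_minus_nonzero[of t 1] t by simp
    then show ?thesis unfolding mehler_def by simp
  qed
  ultimately show ?thesis unfolding S by simp
qed

lemma integrand_tendsto:
  "(\<lambda>n. integrand n s) \<longlonglongrightarrow> exp (\<beta> * Complex (- 1) s + (Complex (- 1) s)\<^sup>2 / 2) / (- Complex (- 1) s)"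
proof -
  define v where "v = Complex (- 1) s"
  have v: "v \<noteq> 0" by (simp add: v_def complex_eq_iff)
  have u: "filterlim (\<lambda>n. u n s) (at 0) sequentially"
    unfolding u_def by (rule tendsto_scaled_arg[OF \<sigma>_pos v[unfolded v_def]])
  then have u0: "(\<lambda>n. u n s) \<longlonglongrightarrow> 0" by (simp add: filterlim_at)
  have A: "(\<lambda>n. csqrt (1 - of_real t ^ 2) / csqrt (1 - of_real t ^ 2 * (exp (u n s))\<^sup>2)) \<longlonglongrightarrow> csqrt (1 - of_real t ^ 2) / csqrt (1 - of_real t ^ 2 * (exp 0)\<^sup>2)"
  proof (intro tendsto_intros isCont_tendsto_compose[OF continuous_at_csqrt] u0)
    show "1 - of_real t ^ 2 * (exp 0)\<^sup>2 \<notin> (\<real>\<^sub>\<le>\<^sub>0 :: complex set)" "csqrt (1 - of_real t ^ 2 * (exp 0)\<^sup>2) \<noteq> 0"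
      using one_minus_notin_nonpos_Reals[of t 1] one_minus_nonzero[of t 1] t by auto
  qed
  have B: "(\<lambda>n. exp (u n s) / (v * ((1 - exp (u n s)) / u n s))) \<longlonglongrightarrow> exp 0 / (v * - 1)"
  proof (intro tendsto_intros u0)
    show "(\<lambda>n. (1 - exp (u n s)) / u n s) \<longlonglongrightarrow> - 1"
      using tendsto_minus[OF filterlim_compose[OF tendsto_expm1_over u]]
      by (simp only: minus_divide_left minus_diff_eq)
  qed (use v in auto)
  have "filterlim (\<lambda>n. \<sigma> * sqrt (real n)) at_top sequentially"
    using \<sigma>_pos by real_asymp
  \<comment> \<open>Each fixed s eventually lies within the rescaled angular range, where the
    indicator is 1.\<close>
  then have "\<forall>\<^sub>F n in sequentially. \<bar>s\<bar> / pi \<le> \<sigma> * sqrt (real n)"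
    by (simp add: filterlim_at_top)
  then have C: "(\<lambda>n. indicator {- pi..pi} (s / (\<sigma> * sqrt n)) :: real) \<longlonglongrightarrow> 1"
  proof (intro tendsto_eventually, elim eventually_rev_mp, intro eventually_mono[OF eventually_gt_at_top[of 0]] impI)
    fix n :: nat assume n: "n > 0" "\<bar>s\<bar> / pi \<le> \<sigma> * sqrt (real n)"
    have "\<sigma> * sqrt n > 0" using n \<sigma>_pos by simp
    moreover from this have "\<bar>s / (\<sigma> * sqrt n)\<bar> = \<bar>s\<bar> / (\<sigma> * sqrt n)"
      by (simp only: abs_divide abs_of_pos)
    ultimately have "\<bar>s / (\<sigma> * sqrt n)\<bar> \<le> pi" using n by (simp add: field_simps)
    then have "- pi \<le> s / (\<sigma> * sqrt n) \<and> s / (\<sigma> * sqrt n) \<le> pi" by linarith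
    then show "indicator {- pi..pi} (s / (\<sigma> * sqrt n)) = (1::real)" by simp
  qed
  have "(\<lambda>n. indicator {- pi..pi} (s / (\<sigma> * sqrt n)) *\<^sub>R
     (csqrt (1 - of_real t ^ 2) / csqrt (1 - of_real t ^ 2 * (exp (u n s))\<^sup>2) * exp (\<Phi> n s) *
      (exp (u n s) / (v * ((1 - exp (u n s)) / u n s))))) \<longlonglongrightarrow>
     1 *\<^sub>R (csqrt (1 - of_real t ^ 2) / csqrt (1 - of_real t ^ 2 * (exp 0)\<^sup>2) * exp (\<beta> * v + v\<^sup>2 / 2) * (exp 0 / (v * - 1)))"
    unfolding v_def by (intro tendsto_scaleR tendsto_mult tendsto_exp tendsto_\<Phi> A B[unfolded v_def] C)
  moreover have "csqrt (1 - of_real t ^ 2 * (exp 0)\<^sup>2) \<noteq> (0::complex)" using one_minus_nonzero[of t 1] t by simp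
  ultimately have lim: "(\<lambda>n. indicator {- pi..pi} (s / (\<sigma> * sqrt n)) *\<^sub>R
     (csqrt (1 - of_real t ^ 2) / csqrt (1 - of_real t ^ 2 * (exp (u n s))\<^sup>2) * exp (\<Phi> n s) *
      (exp (u n s) / (v * ((1 - exp (u n s)) / u n s))))) \<longlonglongrightarrow> exp (\<beta> * v + v\<^sup>2 / 2) / (- v)"
    by simp
  show ?thesis
    unfolding v_def[symmetric]
  proof (rule Lim_transform_eventually[OF lim], rule eventually_mono[OF eventually_gt_at_top[of 0]])
    fix n :: nat assume n: "n > 0"
    have "v * ((1 - exp (u n s)) / u n s) = of_real (\<sigma> * sqrt n) * (1 - exp (u n s))"
      using n \<sigma>_pos v by (simp add: u_def v_def[symmetric])
    then show "indicator {- pi..pi} (s / (\<sigma> * sqrt n)) *\<^sub>R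
     (csqrt (1 - of_real t ^ 2) / csqrt (1 - of_real t ^ 2 * (exp (u n s))\<^sup>2) * exp (\<Phi> n s) *
      (exp (u n s) / (v * ((1 - exp (u n s)) / u n s)))) = integrand n s"
      by (simp only: integrand_def)
  qed
qed

text \<open>Two factors remain beside \<open>Re_\<Phi>_le\<close>. The square root ratio is at most
  1, since 1 - t^2 \<rho>^2 has modulus at least 1 - t^2. The pole factor is at most 2, since on the
  circle of radius exp (- 1 / N) the distance to 1 is at least 1 / (N + 1), and N \<ge> 1.\<close>

lemma integrand_bound:
  "\<exists>C c n0. c > 0 \<and> (\<forall>n\<ge>n0. n > 0 \<and> (\<forall>s. norm (integrand n s) \<le> C * exp (- (c * s\<^sup>2))))"
proof -
  obtain C c n0 where c: "c > 0" and bd: "\<And>n s. n \<ge> n0 \<Longrightarrow> n > 0 \<and> \<sigma> * sqrt n \<ge> 1 \<and> (\<bar>s\<bar> \<le> pi * (\<sigma> * sqrt n) \<longrightarrow> Re (\<Phi> n s) \<le> C - c * s\<^sup>2)"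
    using Re_\<Phi>_le by blast
  have "n > 0 \<and> (\<forall>s. norm (integrand n s) \<le> (2 * exp C) * exp (- (c * s\<^sup>2)))" if n: "n \<ge> n0" for n
  proof (intro conjI allI)
    show n0: "n > 0" using bd[OF n] by blast
    fix s
    define N where "N = \<sigma> * sqrt n"
    have N: "N \<ge> 1" using bd[OF n] by (simp add: N_def)
    show "norm (integrand n s) \<le> (2 * exp C) * exp (- (c * s\<^sup>2))"
    proof (cases "s / N \<in> {- pi..pi}")
      case False
      then show ?thesis by (simp add: integrand_def N_def[symmetric])
    next
      case True
      then have s: "\<bar>s\<bar> \<le> pi * (\<sigma> * sqrt n)"
        unfolding N_def[symmetric] using N by (auto simp: abs_le_iff field_simps)
      let ?\<rho> = "exp (u n s)"
      have 1: "norm (exp (\<Phi> n s)) \<le> exp C * exp (- (c * s\<^sup>2))"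
        using bd[OF n, of s] s by (simp add: exp_add[symmetric])
      have 2: "norm (csqrt (1 - of_real t ^ 2) / csqrt (1 - of_real t ^ 2 * ?\<rho>\<^sup>2)) \<le> 1"
      proof -
        have "norm (1 - of_real t ^ 2 :: complex) = 1 - t\<^sup>2"
          using t_sq[OF t] by (metis abs_of_pos norm_of_real of_real_1 of_real_diff of_real_power)
        also have "\<dots> \<le> 1 - norm (of_real t ^ 2 * ?\<rho>\<^sup>2)"
          using norm_exp_u_less[OF n0, of s] by (simp add: norm_mult norm_power mult_left_le power_le_one del: norm_exp_eq_Re)
        also have "\<dots> \<le> norm (1 - of_real t ^ 2 * ?\<rho>\<^sup>2)"
          using norm_triangle_ineq2[of 1 "of_real t ^ 2 * ?\<rho>\<^sup>2"] by (simp del: norm_exp_eq_Re)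
        finally have "sqrt (norm (1 - of_real t ^ 2 :: complex)) \<le> sqrt (norm (1 - of_real t ^ 2 * ?\<rho>\<^sup>2))"
          by simp
        then have "norm (csqrt (1 - of_real t ^ 2)) \<le> norm (csqrt (1 - of_real t ^ 2 * ?\<rho>\<^sup>2))"
          by (simp only: norm_csqrt)
        moreover have "norm (csqrt (1 - of_real t ^ 2 * ?\<rho>\<^sup>2)) > 0" using one_minus_nonzero[OF t_exp_u[OF n0]] by simp
        ultimately show ?thesis by (simp only: norm_divide divide_le_eq_1_pos)
      qed
      have 3: "norm (?\<rho> / (of_real N * (1 - ?\<rho>))) \<le> 2"
      proof -
        have nr: "norm ?\<rho> = exp (- (1 / N))" using norm_exp_u[OF n0] by (simp only: N_def)
        have "exp (- (1 / N)) = inverse (exp (1 / N))" by (simp add: exp_minus)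
        also have "\<dots> \<le> inverse (1 + 1 / N)" using N exp_ge_add_one_self[of "1 / N"] by (intro le_imp_inverse_le) (auto simp: add_pos_pos)
        also have "\<dots> = 1 - 1 / (N + 1)" using N by (simp add: field_simps)
        finally have "1 / (N + 1) \<le> 1 - norm ?\<rho>" by (simp only: nr)
        also have "\<dots> \<le> norm (1 - ?\<rho>)" using norm_triangle_ineq2[of 1 ?\<rho>] by (simp del: norm_exp_eq_Re)
        finally have "N * (1 / (N + 1)) \<le> N * norm (1 - ?\<rho>)" using N by (intro mult_left_mono) auto
        moreover have "N * (1 / (N + 1)) \<ge> 1 / 2" using N by (simp add: field_simps)
        ultimately have den: "N * norm (1 - ?\<rho>) \<ge> 1 / 2" by linarith
        have "norm (?\<rho> / (of_real N * (1 - ?\<rho>))) = norm ?\<rho> / (N * norm (1 - ?\<rho>))"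
          using N by (simp add: norm_divide norm_mult del: norm_exp_eq_Re)
        also have "\<dots> \<le> 1 / (1 / 2)"
          using den norm_exp_u_less[OF n0, of s] by (intro frac_le) (auto simp del: norm_exp_eq_Re)
        finally show ?thesis by simp
      qed
      have "norm (integrand n s) = norm (csqrt (1 - of_real t ^ 2) / csqrt (1 - of_real t ^ 2 * ?\<rho>\<^sup>2)) * norm (exp (\<Phi> n s)) * norm (?\<rho> / (of_real N * (1 - ?\<rho>)))"
        using True unfolding integrand_def N_def[symmetric] by (simp only: indicator_simps scaleR_one norm_mult)
      also have "\<dots> \<le> 1 * (exp C * exp (- (c * s\<^sup>2))) * 2"
        using 1 2 3 by (intro mult_mono) auto
      finally show ?thesis by simp
    qed
  qed
  then show ?thesis using c by blast
qed

theorem hcoeff_ratio_tendsto: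
  "(\<lambda>n. (\<Sum>k<n. hcoeff t (kap t n) (X n) (Y n) k) / mehler t (kap t n) (X n) (Y n) 1)
     \<longlonglongrightarrow> erfc (\<beta> / of_real (sqrt 2)) / 2"
proof -
  obtain C c n0 where c: "c > 0" and bd: "\<And>n s. n \<ge> n0 \<Longrightarrow> n > 0 \<and> norm (integrand n s) \<le> C * exp (- (c * s\<^sup>2))"
    using integrand_bound by blast
  have pos: "n + n0 > 0" for n using bd[of "n + n0"] by simp
  let ?l = "\<lambda>s. exp (\<beta> * Complex (- 1) s + (Complex (- 1) s)\<^sup>2 / 2) / (- Complex (- 1) s)"
  \<comment> \<open>The majorant is available only from \<open>n0\<close> on, while dominated
    convergence asks for it at every index; hence the shift, undone at the end.\<close>
  have "(\<lambda>n. \<integral>s. integrand (n + n0) s \<partial>lborel) \<longlonglongrightarrow> (\<integral>s. ?l s \<partial>lborel)"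
  proof (rule integral_dominated_convergence)
    show "integrand (n + n0) \<in> borel_measurable lborel" for n by (rule integrand_measurable[OF pos])
    show "integrable lborel (\<lambda>s. C * exp (- (c * s\<^sup>2)))"
      using c by (intro integrable_mult_right integrable_gaussian)
    show "AE s in lborel. (\<lambda>n. integrand (n + n0) s) \<longlonglongrightarrow> ?l s"
      by (intro AE_I2 LIMSEQ_ignore_initial_segment integrand_tendsto)
    show "AE s in lborel. norm (integrand (n + n0) s) \<le> C * exp (- (c * s\<^sup>2))" for n
      using bd[of "n + n0"] by (intro AE_I2) auto
    have ne: "Complex (- 1) s \<noteq> 0" for s by (simp add: complex_eq_iff)
    have "continuous_on UNIV (\<lambda>s. Complex (- 1) s)" unfolding Complex_eq by (intro continuous_intros)
    then have "continuous_on UNIV ?l" using ne by (intro continuous_intros) auto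
    then show "?l \<in> borel_measurable lborel" by (simp add: borel_measurable_continuous_onI)
  qed
  then have "(\<lambda>n. of_real (1 / (2 * pi)) * (\<integral>s. integrand (n + n0) s \<partial>lborel)) \<longlonglongrightarrow> of_real (1 / (2 * pi)) * (of_real pi * erfc (\<beta> / of_real (sqrt 2)))"
    unfolding erfc_contour_integral by (intro tendsto_intros)
  then have "(\<lambda>n. (\<Sum>k<n + n0. hcoeff t (kap t (n + n0)) (X (n + n0)) (Y (n + n0)) k) / mehler t (kap t (n + n0)) (X (n + n0)) (Y (n + n0)) 1)
     \<longlonglongrightarrow> erfc (\<beta> / of_real (sqrt 2)) / 2"
    by (simp add: hcoeff_ratio_eq_integral[OF pos])
  then show ?thesis by (rule LIMSEQ_offset)
qed

end

section \<open>Correlation functions\<close>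

text \<open>Conjugation by the diagonal matrix of \<open>f\<close>: in every Leibniz term each row
  contributes one factor from \<open>f\<close> and each column one from \<open>g\<close>.\<close>

lemma det_scale_conjugate:
  fixes M :: "complex ^ 'm ^ 'm"
  assumes "\<And>k. f k * g k = 1"
  shows "det (\<chi> k l. c * M $ k $ l * (f k * g l)) = c ^ CARD('m) * det M"
proof -
  have "(\<Prod>i\<in>UNIV. c * M $ i $ q i * (f i * g (q i))) = c ^ CARD('m) * (\<Prod>i\<in>UNIV. M $ i $ q i)"
    if "q permutes UNIV" for q
  proof -
    have "(\<Prod>i\<in>UNIV. f i) * (\<Prod>i\<in>UNIV. g (q i)) = (\<Prod>i\<in>UNIV. f i) * (\<Prod>i\<in>UNIV. g i)"
      using prod.permute[OF that, of g] by (simp add: o_def)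
    also have "\<dots> = 1" using assms by (simp flip: prod.distrib)
    finally show ?thesis by (simp add: prod.distrib)
  qed
  then show ?thesis
    unfolding det_def sum_distrib_left by (intro sum.cong) (simp_all add: mult_ac)
qed

lemma tendsto_det:
  fixes A :: "nat \<Rightarrow> complex ^ 'm ^ 'm"
  assumes "\<And>k l. (\<lambda>n. A n $ k $ l) \<longlonglongrightarrow> L $ k $ l"
  shows "(\<lambda>n. det (A n)) \<longlonglongrightarrow> det L"
  unfolding det_def by (intro tendsto_intros assms)

text \<open>The phases \<theta> are free, so each entry need converge only after a correction that
  may itself diverge with n.\<close>

lemma corr_fun_tendsto:
  fixes z :: "nat \<Rightarrow> 'm::finite \<Rightarrow> complex"
  assumes "\<And>k l. (\<lambda>n. kernel V n (z n k) (z n l) / of_nat n * cis (\<theta> n k - \<theta> n l)) \<longlonglongrightarrow> L k l"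
  shows "(\<lambda>n. 1 / of_nat n ^ CARD('m) * corr_fun V n (\<chi> k. z n k)) \<longlonglongrightarrow> det (\<chi> k l. L k l :: complex ^ 'm ^ 'm)"
proof -
  have "1 / of_nat n ^ CARD('m) * corr_fun V n (\<chi> k. z n k)
      = det (\<chi> k l. kernel V n (z n k) (z n l) / of_nat n * cis (\<theta> n k - \<theta> n l))" for n
  proof -
    have "cis (\<theta> n k) * cis (- \<theta> n k) = 1" for k by (simp add: cis_mult)
    from det_scale_conjugate[of "\<lambda>k. cis (\<theta> n k)" "\<lambda>k. cis (- \<theta> n k)", OF this, of "1 / of_nat n" "\<chi> k l. kernel V n (z n k) (z n l)"]
    show ?thesis by (simp add: corr_fun_def cis_mult power_one_over)
  qed
  moreover have "(\<lambda>n. det (\<chi> k l. kernel V n (z n k) (z n l) / of_nat n * cis (\<theta> n k - \<theta> n l))) \<longlonglongrightarrow> det (\<chi> k l. L k l :: complex ^ 'm ^ 'm)"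
    using assms by (intro tendsto_det) simp
  ultimately show ?thesis by simp
qed

text \<open>The two terms are the phases left beside the Ginibre factor: the cross term of
  \<open>cnj w * z\<close> with the base point, and the imaginary parts of the squares in Mehler's
  exponent. Each phase belongs to one point only, which makes it removable.\<close>

definition gauge :: "real \<Rightarrow> complex \<Rightarrow> nat \<Rightarrow> complex \<Rightarrow> real" where
  "gauge t z0 n a = sqrt n * Im (cnj z0 * a) - n * t / 2 * Im ((z0 + a / of_real (sqrt n))\<^sup>2)"

lemma full_kernel_eq:
  fixes t :: real and z0 a b :: complex
  assumes t: "0 < t" "t < 1" and n: "n > 0"
  defines "w \<equiv> z0 + a / of_real (sqrt n)" and "z \<equiv> z0 + b / of_real (sqrt n)"
  shows "of_real (sqrt (1 - t\<^sup>2) / pi * exp (- (real n / 2) * (elliptic_potential t w + elliptic_potential t z)))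
     * mehler t (kap t n) (cnj w) z 1
    = of_real (1 / pi) * ginibre_factor a b * cis (gauge t z0 n b - gauge t z0 n a)"
proof -
  have nz: "1 - complex_of_real t ^ 2 \<noteq> 0" using one_minus_nonzero[of t 1] t by simp
  have sq: "csqrt (1 - complex_of_real t ^ 2) = of_real (sqrt (1 - t\<^sup>2))"
    using t_sq[OF t] by (subst csqrt_of_real_nonneg) (auto simp flip: of_real_power)
  have k: "2 * of_real (kap t n) * (1 - complex_of_real t ^ 2) = 2 / of_nat n"
  proof -
    have "2 * (1 / (N * D)) * D = 2 / N" if "D \<noteq> 0" for N D :: complex
      using that by simp
    from this[OF nz] show ?thesis by (simp add: kap_def)
  qed
  have m: "mehler t (kap t n) (cnj w) z 1 = exp (of_nat n * (cnj w * z - of_real t * ((cnj w)\<^sup>2 + z\<^sup>2) / 2)) / of_real (sqrt (1 - t\<^sup>2))"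
  proof -
    have "mehler t (kap t n) (cnj w) z 1 = inverse (csqrt (1 - of_real t ^ 2)) *
        exp ((2 * cnj w * z - ((cnj w)\<^sup>2 + z\<^sup>2) * of_real t) / (2 * of_real (kap t n) * (1 - of_real t ^ 2)))"
      by (simp add: mehler_def)
    moreover have "(2 * x * y - S * T) / (2 / N) = N * (x * y - T * S / 2)" for x y S T N :: complex
      by (simp add: field_simps)
    moreover have "inverse A * E = E / A" for A E :: complex
      by (rule divide_inverse_commute[symmetric])
    ultimately show ?thesis by (simp only: k sq)
  qed
  \<comment> \<open>In the real part, the t-terms of the potential cancel those of Mehler's
    exponent, which leaves minus n / 2 times the squared distance of w and z, that is, minus half
    the squared distance of a and b.\<close>
  have expo: "of_real (- (real n / 2) * (elliptic_potential t w + elliptic_potential t z)) + of_nat n * (cnj w * z - of_real t * ((cnj w)\<^sup>2 + z\<^sup>2) / 2)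
     = (of_real (- (1 / 2) * (cmod (a - b))\<^sup>2) + \<i> * of_real (Im (cnj a * b))) + \<i> * of_real (gauge t z0 n b - gauge t z0 n a)"
  proof -
    define q where "q = sqrt n"
    have q: "real n = q\<^sup>2" "q > 0" "complex_of_nat n = of_real (q\<^sup>2)" using n by (auto simp: q_def)
    have a: "a = of_real q * (w - z0)" and b: "b = of_real q * (z - z0)"
      using q(2) by (simp_all add: w_def z_def q_def)
    have g: "gauge t z0 n b - gauge t z0 n a = q * Im (cnj z0 * b) - q * Im (cnj z0 * a) - q\<^sup>2 * t / 2 * (Im (z\<^sup>2) - Im (w\<^sup>2))"
    proof -
      have "gauge t z0 n a = q * Im (cnj z0 * a) - real n * t / 2 * Im (w\<^sup>2)" "gauge t z0 n b = q * Im (cnj z0 * b) - real n * t / 2 * Im (z\<^sup>2)"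
        by (simp_all only: gauge_def w_def z_def q_def)
      then show ?thesis unfolding q(1) by (simp add: algebra_simps)
    qed
    show ?thesis
      unfolding g q(1) q(3) unfolding a b
      by (simp add: complex_eq_iff elliptic_potential_eq cmod_power2) (simp add: power2_eq_square field_simps)
  qed
  have "of_real (sqrt (1 - t\<^sup>2) / pi * exp (- (real n / 2) * (elliptic_potential t w + elliptic_potential t z)))
     * mehler t (kap t n) (cnj w) z 1 = of_real (1 / pi) * (exp (of_real (- (real n / 2) * (elliptic_potential t w + elliptic_potential t z)))
        * exp (of_nat n * (cnj w * z - of_real t * ((cnj w)\<^sup>2 + z\<^sup>2) / 2)))"
    unfolding m exp_of_real using t_sq[OF t] by simp
  also have "\<dots> = of_real (1 / pi) * (ginibre_factor a b * cis (gauge t z0 n b - gauge t z0 n a))"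
    unfolding exp_add[symmetric] expo unfolding exp_add ginibre_factor_def cis_conv_exp ..
  finally show ?thesis by (simp only: mult.assoc)
qed

lemma tendsto_local_coordinate: "(\<lambda>n. z0 + a / of_real (sqrt (real n)) :: complex) \<longlonglongrightarrow> z0"
proof -
  have "filterlim (\<lambda>n. sqrt (real n)) at_top sequentially" by real_asymp
  then have "(\<lambda>n. z0 + a / of_real (sqrt (real n))) \<longlonglongrightarrow> z0 + 0"
    by (intro tendsto_add tendsto_const tendsto_divide_0[OF tendsto_const] filterlim_compose[OF filterlim_of_real_at_infinity])
  then show ?thesis by simp
qed

lemma kernel_gauge_tendsto_inside:
  assumes t: "0 < t" "t < 1" and z0: "z0 \<in> inside_ellipse t"
  shows "(\<lambda>n. kernel (elliptic_potential t) n (z0 + a / of_real (sqrt (real n))) (z0 + b / of_real (sqrt (real n))) / of_nat n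
      * cis (gauge t z0 n a - gauge t z0 n b)) \<longlonglongrightarrow> of_real (1 / pi) * ginibre_factor a b"
proof (rule LIM_zero_cancel, rule tendsto_norm_zero_cancel, rule Lim_transform_eventually)
  let ?K = "\<lambda>n. kernel (elliptic_potential t) n (z0 + a / of_real (sqrt (real n))) (z0 + b / of_real (sqrt (real n))) / of_nat n"
  let ?F = "\<lambda>n. of_real (sqrt (1 - t\<^sup>2) / pi * exp (- (real n / 2) * (elliptic_potential t (z0 + a / of_real (sqrt (real n))) + elliptic_potential t (z0 + b / of_real (sqrt (real n))))))
       * mehler t (kap t n) (cnj (z0 + a / of_real (sqrt (real n)))) (z0 + b / of_real (sqrt (real n))) 1"
  show "(\<lambda>n. norm (?K n - ?F n)) \<longlonglongrightarrow> 0"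
    by (intro tendsto_norm_zero kernel_inside[OF t z0] tendsto_local_coordinate)
  show "\<forall>\<^sub>F n in sequentially. norm (?K n - ?F n) = norm (?K n * cis (gauge t z0 n a - gauge t z0 n b) - of_real (1 / pi) * ginibre_factor a b)"
  proof (rule eventually_mono[OF eventually_gt_at_top[of 0]])
    fix n :: nat assume n: "n > 0"
    have "(?K n - ?F n) * cis (gauge t z0 n a - gauge t z0 n b) = ?K n * cis (gauge t z0 n a - gauge t z0 n b)
        - of_real (1 / pi) * ginibre_factor a b * (cis (gauge t z0 n b - gauge t z0 n a) * cis (gauge t z0 n a - gauge t z0 n b))"
      unfolding full_kernel_eq[OF t n] by (simp only: left_diff_distrib mult.assoc)
    also have "cis (gauge t z0 n b - gauge t z0 n a) * cis (gauge t z0 n a - gauge t z0 n b) = 1"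
      by (simp add: cis_mult)
    finally have "norm ((?K n - ?F n) * cis (gauge t z0 n a - gauge t z0 n b)) = norm (?K n * cis (gauge t z0 n a - gauge t z0 n b) - of_real (1 / pi) * ginibre_factor a b)"
      by (simp only: mult_1_right)
    then show "norm (?K n - ?F n) = norm (?K n * cis (gauge t z0 n a - gauge t z0 n b) - of_real (1 / pi) * ginibre_factor a b)"
      by (simp only: norm_mult norm_cis mult_1_right)
  qed
qed

text \<open>Since \<open>semi_a t * semi_b t\<close> is 1, the vector with components
  \<open>semi_b t * cos \<phi>\<close> and \<open>semi_a t * sin \<phi>\<close> is an outward normal
  of the ellipse. The arctangent sees only its slope; adding \<open>sgn \<phi> * pi\<close> reaches
  the half-plane of negative cosine.\<close>

lemma normal_angle_polar:
  assumes t: "0 < t" "t < 1" and \<phi>: "\<phi> \<in> {- pi<..pi}"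
  defines "R \<equiv> sqrt ((semi_b t * cos \<phi>)\<^sup>2 + (semi_a t * sin \<phi>)\<^sup>2)"
  shows "R * cos (normal_angle t \<phi>) = semi_b t * cos \<phi>" "R * sin (normal_angle t \<phi>) = semi_a t * sin \<phi>"
proof -
  define q where "q = (1 + t) / (1 - t)"
  have b: "semi_b t > 0" using t by (simp add: semi_b_def)
  have ab: "semi_a t = q * semi_b t"
  proof -
    have "q = sqrt q * sqrt q" using t by (simp add: q_def)
    moreover have "sqrt q * semi_b t = 1" using t by (simp add: semi_b_def q_def flip: real_sqrt_mult)
    ultimately show ?thesis by (metis mult.assoc mult.right_neutral semi_a_def q_def)
  qed
  have R: "R = semi_b t * \<bar>cos \<phi>\<bar> * sqrt (1 + (q * tan \<phi>)\<^sup>2)" if "cos \<phi> \<noteq> 0"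
  proof -
    have "(semi_b t * cos \<phi>)\<^sup>2 + (semi_a t * sin \<phi>)\<^sup>2 = (semi_b t * \<bar>cos \<phi>\<bar>)\<^sup>2 * (1 + (q * tan \<phi>)\<^sup>2)"
      using that by (simp add: ab tan_def power_mult_distrib power_divide field_simps)
    then show ?thesis using b by (simp add: R_def real_sqrt_mult)
  qed
  have pos: "sqrt (1 + (q * tan \<phi>)\<^sup>2) > 0" by (simp add: add_pos_nonneg)
  have "R * cos (normal_angle t \<phi>) = semi_b t * cos \<phi> \<and> R * sin (normal_angle t \<phi>) = semi_a t * sin \<phi>"
  proof (cases "\<phi> \<in> {- pi / 2<..<pi / 2}")
    case True
    then have c: "cos \<phi> > 0" by (intro cos_gt_zero_pi) auto
    have "normal_angle t \<phi> = arctan (q * tan \<phi>)" using True by (simp add: normal_angle_def q_def)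
    then show ?thesis
      using pos c by (simp add: R cos_arctan sin_arctan ab tan_def)
  next
    case False
    show ?thesis
    proof (cases "\<phi> \<in> {- pi / 2..pi / 2}")
      case True
      with False have "\<phi> = pi / 2 \<or> \<phi> = - (pi / 2)" by auto
      then have "cos \<phi> = 0" by (metis cos_minus cos_pi_half)
      then have \<phi>': "cos \<phi> = 0" "(sin \<phi>)\<^sup>2 = 1" by (simp_all add: sin_squared_eq)
      moreover have "normal_angle t \<phi> = \<phi>" using True False by (simp only: normal_angle_def if_False not_True_eq_False)
      moreover have "R = semi_a t" using \<phi>' b t by (simp add: R_def power_mult_distrib semi_a_def)
      ultimately show ?thesis by simp
    next
      case F2: False
      have c: "cos \<phi> < 0"
      proof -
        have "cos (\<bar>\<phi>\<bar> - pi) > 0" using F2 False \<phi> by (intro cos_gt_zero_pi) (auto simp: abs_if)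
        moreover have "cos (\<bar>\<phi>\<bar> - pi) = - cos \<bar>\<phi>\<bar>" by (simp add: cos_diff)
        ultimately show ?thesis by (simp add: abs_if split: if_splits)
      qed
      have na: "normal_angle t \<phi> = arctan (q * tan \<phi>) + sgn \<phi> * pi" using F2 False
        by (simp only: normal_angle_def q_def if_False if_True not_False_eq_True)
      have "sgn \<phi> = 1 \<or> sgn \<phi> = - 1" using False by (auto simp: sgn_if)
      then have "cos (normal_angle t \<phi>) = - cos (arctan (q * tan \<phi>))" "sin (normal_angle t \<phi>) = - sin (arctan (q * tan \<phi>))"
        unfolding na by (auto simp: cos_add sin_add)
      then show ?thesis
        using pos c by (simp add: R cos_arctan sin_arctan ab tan_def)
    qed
  qed
  then show "R * cos (normal_angle t \<phi>) = semi_b t * cos \<phi>" "R * sin (normal_angle t \<phi>) = semi_a t * sin \<phi>"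
    by auto
qed

text \<open>The rotation by the normal angle aligns the real axis of the local coordinates with the
  outward normal, so that \<beta> reduces to \<open>cnj a + b\<close>; the Ginibre factor is
  rotation invariant.\<close>

lemma kernel_gauge_tendsto_boundary:
  fixes a b :: complex
  assumes t: "0 < t" "t < 1" and \<phi>: "\<phi> \<in> {- pi<..pi}"
    and z0: "z0 = of_real (semi_a t * cos \<phi>) + \<i> * of_real (semi_b t * sin \<phi>)"
  defines "e \<equiv> exp (\<i> * of_real (normal_angle t \<phi>))"
  shows "(\<lambda>n. kernel (elliptic_potential t) n (z0 + a * e / of_real (sqrt (real n))) (z0 + b * e / of_real (sqrt (real n))) / of_nat n
      * cis (gauge t z0 n (a * e) - gauge t z0 n (b * e))) \<longlonglongrightarrow>
      of_real (1 / (2 * pi)) * erfc ((cnj a + b) / of_real (sqrt 2)) * ginibre_factor a b"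
proof -
  define \<psi> where "\<psi> = normal_angle t \<phi>"
  have e: "e = cis \<psi>" by (simp add: e_def \<psi>_def cis_conv_exp)
  have ee: "cnj e * e = 1" by (simp add: e cis_cnj cis_mult)
  define x0 where "x0 = semi_a t * cos \<phi>"
  define y0 where "y0 = semi_b t * sin \<phi>"
  define p where "p = (cnj (a * e) + b * e) / 2"
  define d where "d = (cnj (a * e) - b * e) / 2"
  have sa: "(semi_a t)\<^sup>2 = (1 + t) / (1 - t)" and sb: "(semi_b t)\<^sup>2 = (1 - t) / (1 + t)"
    using t by (simp_all add: semi_a_def semi_b_def)
  have sab: "semi_a t * (1 - t) = semi_b t * (1 + t)"
  proof -
    have "(semi_a t * (1 - t))\<^sup>2 = (semi_b t * (1 + t))\<^sup>2"
      unfolding power_mult_distrib sa sb using t by (simp add: power2_eq_square)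
    then show ?thesis
      by (rule power2_eq_imp_eq) (use t in \<open>auto simp: semi_a_def semi_b_def\<close>)
  qed
  have fac: "1 - t\<^sup>2 = (1 - t) * (1 + t)" by (simp add: power2_eq_square algebra_simps)
  interpret B: boundary_point t x0 y0 p d
  proof
    have "(1 - t\<^sup>2) * (x0\<^sup>2 / (1 + t)\<^sup>2 + y0\<^sup>2 / (1 - t)\<^sup>2) = (cos \<phi>)\<^sup>2 + (sin \<phi>)\<^sup>2"
    proof -
      have "(1 - t) * (1 + t) * ((1 + t) / (1 - t) * C / (1 + t)\<^sup>2) = C" "(1 - t) * (1 + t) * ((1 - t) / (1 + t) * C / (1 - t)\<^sup>2) = C" for C
        using t by (simp_all add: divide_simps power2_eq_square)
      then show ?thesis
        unfolding x0_def y0_def power_mult_distrib sa sb fac by (simp only: distrib_left)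
    qed
    then show "(1 - t\<^sup>2) * (x0\<^sup>2 / (1 + t)\<^sup>2 + y0\<^sup>2 / (1 - t)\<^sup>2) = 1" by simp
  qed (use t in auto)
  have \<sigma>: "B.\<sigma> = sqrt ((semi_b t * cos \<phi>)\<^sup>2 + (semi_a t * sin \<phi>)\<^sup>2)"
  proof -
    have "(1 - t\<^sup>2) * (x0\<^sup>2 * ((1 - t) / (1 + t) ^ 3) + y0\<^sup>2 * ((1 + t) / (1 - t) ^ 3)) = (semi_b t * cos \<phi>)\<^sup>2 + (semi_a t * sin \<phi>)\<^sup>2"
    proof -
      have "(1 - t) * (1 + t) * ((1 + t) / (1 - t) * C * ((1 - t) / (1 + t) ^ 3)) = (1 - t) / (1 + t) * C"
        "(1 - t) * (1 + t) * ((1 - t) / (1 + t) * C * ((1 + t) / (1 - t) ^ 3)) = (1 + t) / (1 - t) * C" for C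
        using t by (simp_all add: divide_simps power2_eq_square power3_eq_cube)
      then show ?thesis
        unfolding x0_def y0_def power_mult_distrib sa sb fac by (simp only: distrib_left)
    qed
    then show ?thesis by (simp add: B.\<sigma>_def)
  qed
  \<comment> \<open>These two coefficients in \<beta> are half the gradient of the ellipse form at
    the boundary point; its length is \<sigma> and its direction the normal angle.\<close>
  have cs: "(1 - t\<^sup>2) * (x0 / (1 + t)\<^sup>2) = B.\<sigma> * cos \<psi>" "(1 - t\<^sup>2) * (y0 / (1 - t)\<^sup>2) = B.\<sigma> * sin \<psi>"
  proof -
    have "(1 - t\<^sup>2) * (x0 / (1 + t)\<^sup>2) = semi_b t * cos \<phi>"
    proof -
      have "(1 - t\<^sup>2) * (x0 / (1 + t)\<^sup>2) = (semi_a t * (1 - t)) * cos \<phi> / (1 + t)"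
        unfolding x0_def fac using t by (simp add: divide_simps power2_eq_square)
      then show ?thesis unfolding sab using t by simp
    qed
    moreover have "(1 - t\<^sup>2) * (y0 / (1 - t)\<^sup>2) = semi_a t * sin \<phi>"
    proof -
      have "(1 - t\<^sup>2) * (y0 / (1 - t)\<^sup>2) = (semi_b t * (1 + t)) * sin \<phi> / (1 - t)"
        unfolding y0_def fac using t by (simp add: divide_simps power2_eq_square)
      then show ?thesis unfolding sab[symmetric] using t by simp
    qed
    ultimately show "(1 - t\<^sup>2) * (x0 / (1 + t)\<^sup>2) = B.\<sigma> * cos \<psi>" "(1 - t\<^sup>2) * (y0 / (1 - t)\<^sup>2) = B.\<sigma> * sin \<psi>"
      using normal_angle_polar[OF t \<phi>] unfolding \<sigma> \<psi>_def by simp_all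
  qed
  have \<beta>: "B.\<beta> = cnj a + b"
  proof -
    have "of_real (2 * (1 - t\<^sup>2)) * (of_real (x0 / (1 + t)\<^sup>2) * p + \<i> * of_real (y0 / (1 - t)\<^sup>2) * d)
       = 2 * (of_real ((1 - t\<^sup>2) * (x0 / (1 + t)\<^sup>2)) * p + \<i> * of_real ((1 - t\<^sup>2) * (y0 / (1 - t)\<^sup>2)) * d)"
    proof -
      have "of_real (2 * q) * (of_real A * p + \<i> * of_real C * d) = 2 * (of_real (q * A) * p + \<i> * of_real (q * C) * d)" for q A C :: real
        by (simp add: algebra_simps)
      then show ?thesis .
    qed
    also have "\<dots> = of_real B.\<sigma> * (cnj (a * e) * (of_real (cos \<psi>) + \<i> * of_real (sin \<psi>)) + b * e * (of_real (cos \<psi>) - \<i> * of_real (sin \<psi>)))"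
      unfolding cs p_def d_def by (simp add: field_simps)
    also have "of_real (cos \<psi>) + \<i> * of_real (sin \<psi>) = e"
      by (simp add: e complex_eq_iff)
    also have "of_real (cos \<psi>) - \<i> * of_real (sin \<psi>) = cnj e"
      by (simp add: e complex_eq_iff)
    also have "cnj (a * e) * e + b * e * cnj e = cnj a + b"
      using ee by (simp add: mult.assoc mult.commute[of e])
    finally show ?thesis using B.\<sigma>_pos by (simp add: B.\<beta>_def)
  qed
  let ?w = "\<lambda>n. z0 + a * e / of_real (sqrt (real n))" and ?z = "\<lambda>n. z0 + b * e / of_real (sqrt (real n))"
  have pd: "p + d = cnj (a * e)" "p - d = b * e"
    by (simp_all add: p_def d_def field_simps)
  have X: "B.X n = cnj (?w n)" for n
    unfolding B.X_def pd unfolding z0 x0_def y0_def by simp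
  have Y: "B.Y n = ?z n" for n
    unfolding B.Y_def pd unfolding z0 x0_def y0_def by simp
  have gin: "ginibre_factor (a * e) (b * e) = ginibre_factor a b"
  proof -
    have "cmod (a * e - b * e) = cmod (a - b)"
      by (simp add: e norm_mult flip: left_diff_distrib)
    moreover have "cnj (a * e) * (b * e) = cnj a * b * (cnj e * e)" by (simp add: mult_ac)
    then have "cnj (a * e) * (b * e) = cnj a * b" by (simp only: ee mult_1_right)
    ultimately show ?thesis by (simp only: ginibre_factor_def)
  qed
  have lim: "(\<lambda>n. of_real (1 / pi) * ginibre_factor a b * ((\<Sum>k<n. hcoeff t (kap t n) (cnj (?w n)) (?z n) k) / mehler t (kap t n) (cnj (?w n)) (?z n) 1))
     \<longlonglongrightarrow> of_real (1 / pi) * ginibre_factor a b * (erfc ((cnj a + b) / of_real (sqrt 2)) / 2)"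
    by (intro tendsto_mult tendsto_const B.hcoeff_ratio_tendsto[unfolded X Y \<beta>])
  have "(\<lambda>n. kernel (elliptic_potential t) n (?w n) (?z n) / of_nat n * cis (gauge t z0 n (a * e) - gauge t z0 n (b * e)))
      \<longlonglongrightarrow> of_real (1 / pi) * ginibre_factor a b * (erfc ((cnj a + b) / of_real (sqrt 2)) / 2)"
  proof (rule Lim_transform_eventually[OF lim], rule eventually_mono[OF eventually_gt_at_top[of 0]])
    fix n :: nat assume n: "n > 0"
    let ?c = "of_real (sqrt (1 - t\<^sup>2) / pi * exp (- (real n / 2) * (elliptic_potential t (?w n) + elliptic_potential t (?z n))))"
    let ?m = "mehler t (kap t n) (cnj (?w n)) (?z n) 1" and ?S = "\<Sum>k<n. hcoeff t (kap t n) (cnj (?w n)) (?z n) k"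
    let ?g = "cis (gauge t z0 n (b * e) - gauge t z0 n (a * e))" and ?g' = "cis (gauge t z0 n (a * e) - gauge t z0 n (b * e))"
    have full: "?c * ?m = of_real (1 / pi) * ginibre_factor a b * ?g"
      using full_kernel_eq[OF t n, of z0 "a * e" "b * e"] unfolding gin .
    have m0: "?m \<noteq> 0"
      using one_minus_nonzero[of t 1] t by (simp add: mehler_def)
    have gg: "?g * ?g' = 1" by (simp add: cis_mult)
    have "?c * ?S = ?c * ?m * (?S / ?m)" using m0 by simp
    then have "?c * ?S * ?g' = of_real (1 / pi) * ginibre_factor a b * (?S / ?m) * (?g * ?g')"
      unfolding full by (simp only: mult_ac)
    then show "of_real (1 / pi) * ginibre_factor a b * (?S / ?m) = kernel (elliptic_potential t) n (?w n) (?z n) / of_nat n * ?g'"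
      unfolding kernel_eq_hcoeff[OF t n] gg by simp
  qed
  then show ?thesis by (simp add: mult_ac)
qed

theorem theorem8p17:
  fixes t :: real and a :: "complex ^ 'm"
  assumes "0 < t" and "t < 1"
  shows
    "(\<forall>z0 \<in> inside_ellipse t.
        (\<lambda>n. 1 / of_nat n ^ CARD('m) *
             corr_fun (elliptic_potential t) n (\<chi> k. z0 + a $ k / of_real (sqrt (real n))))
        \<longlonglongrightarrow> det (\<chi> k l. of_real (1 / pi) * ginibre_factor (a $ k) (a $ l) :: complex ^ 'm ^ 'm)) \<and>
     (\<forall>z0 \<in> outside_ellipse t.
        (\<lambda>n. 1 / of_nat n ^ CARD('m) *
             corr_fun (elliptic_potential t) n (\<chi> k. z0 + a $ k / of_real (sqrt (real n))))
        \<longlonglongrightarrow> 0) \<and>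
     (\<forall>\<phi> \<in> {- pi<..pi}. \<forall>z0.
        z0 = of_real (semi_a t * cos \<phi>) + \<i> * of_real (semi_b t * sin \<phi>) \<longrightarrow>
        (\<lambda>n. 1 / of_nat n ^ CARD('m) *
             corr_fun (elliptic_potential t) n
               (\<chi> k. z0 + a $ k * exp (\<i> * of_real (normal_angle t \<phi>)) / of_real (sqrt (real n))))
        \<longlonglongrightarrow> det (\<chi> k l. of_real (1 / (2 * pi)) *
              erfc ((cnj (a $ k) + a $ l) / of_real (sqrt 2)) *
              ginibre_factor (a $ k) (a $ l) :: complex ^ 'm ^ 'm))"
proof (intro conjI ballI allI impI)
  fix z0 assume "z0 \<in> inside_ellipse t"
  from kernel_gauge_tendsto_inside[OF assms this]
  show "(\<lambda>n. 1 / of_nat n ^ CARD('m) *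
             corr_fun (elliptic_potential t) n (\<chi> k. z0 + a $ k / of_real (sqrt (real n))))
        \<longlonglongrightarrow> det (\<chi> k l. of_real (1 / pi) * ginibre_factor (a $ k) (a $ l) :: complex ^ 'm ^ 'm)"
    by (rule corr_fun_tendsto)
next
  fix z0 assume z0: "z0 \<in> outside_ellipse t"
  have "(\<lambda>n. 1 / of_nat n ^ CARD('m) *
             corr_fun (elliptic_potential t) n (\<chi> k. z0 + a $ k / of_real (sqrt (real n))))
        \<longlonglongrightarrow> det (\<chi> k l. 0 :: complex ^ 'm ^ 'm)"
  proof (rule corr_fun_tendsto)
    \<comment> \<open>The limit is zero, so the trivial gauge suffices.\<close>
    show "(\<lambda>n. kernel (elliptic_potential t) n (z0 + a $ k / of_real (sqrt (real n))) (z0 + a $ l / of_real (sqrt (real n))) / of_nat n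
        * cis (0 - 0)) \<longlonglongrightarrow> 0" for k l
      using kernel_outside[OF assms z0 tendsto_local_coordinate tendsto_local_coordinate] by simp
  qed
  moreover have "det (\<chi> k l. 0 :: complex ^ 'm ^ 'm) = 0" by (simp add: det_def zero_power)
  ultimately show "(\<lambda>n. 1 / of_nat n ^ CARD('m) *
             corr_fun (elliptic_potential t) n (\<chi> k. z0 + a $ k / of_real (sqrt (real n))))
        \<longlonglongrightarrow> 0"
    by simp
next
  fix \<phi> z0
  assume "\<phi> \<in> {- pi<..pi}" "z0 = of_real (semi_a t * cos \<phi>) + \<i> * of_real (semi_b t * sin \<phi>)"
  from kernel_gauge_tendsto_boundary[OF assms this]
  show "(\<lambda>n. 1 / of_nat n ^ CARD('m) *
             corr_fun (elliptic_potential t) n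
               (\<chi> k. z0 + a $ k * exp (\<i> * of_real (normal_angle t \<phi>)) / of_real (sqrt (real n))))
        \<longlonglongrightarrow> det (\<chi> k l. of_real (1 / (2 * pi)) *
              erfc ((cnj (a $ k) + a $ l) / of_real (sqrt 2)) *
              ginibre_factor (a $ k) (a $ l) :: complex ^ 'm ^ 'm)"
    by (rule corr_fun_tendsto)
qed

end
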